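(* A function $g\in L^2(I)$ is in the range of the multi-interval finite Hilbert transform $\mathcal H:L^2(I)\to L^2(I)$, $(\mathcal Hf)(z)=\frac1\pi\int_I\frac{f(x)}{x-z}dx$, if and only if $$\frac1\lambda\,(\mathcal F\mathcal M Tg)_m\in L^2_{\rm loc},\qquad m=1,2,\dots,n,$$ in a neighborhood of $\lambda=0$. If $g\in L^2(I)$ is in the range of $\mathcal H$, then the inversion formula is given by $$\mathcal H^{-1}g=(\mathcal F\mathcal M T)^{-1}\Big(\frac1{i\tanh(\lambda\pi/2)}\,\mathrm{Id}\Big)(\mathcal F\mathcal M T)g,$$ where $\lambda$ is the spectral (Fourier) variable.
   Context: Let $n\in\mathbb N$, $I_j=[\alpha_j,\beta_j]$ with $-\infty<\alpha_1<\beta_1<\alpha_2<\dots<\alpha_n<\beta_n<\infty$, $I=\bigcup_{j=1}^n I_j$. The integral defining $\mathcal Hf$ is a Cauchy principal value for $z\in I$. Put $\beta_{\rm od}(z)=\prod_{j=1}^n(z-\alpha_j)$, $\beta_{\rm ev}(z)=\prod_{j=1}^n(z-\beta_j)$, $\beta(z)=\beta_{\rm ev}(z)/\beta_{\rm od}(z)$, $\phi(z)=\mathrm{Re}\,\ln\beta(z)=\ln|\beta(z)|$ for $z$ in the interior of $I$, and $Q(x)=\beta_{\rm ev}'(x)\beta_{\rm od}(x)-\beta_{\rm ev}(x)\beta_{\rm od}'(x)$, so that $\phi'(x)=Q(x)/(\beta_{\rm od}(x)\beta_{\rm ev}(x))$. $Q$ is positive and bounded away from zero on $I$, and $\phi$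 maps the interior of each $I_k$ monotonically onto $\mathbb R$; $\phi_k^{-1}:\mathbb R\to(\alpha_k,\beta_k)$ denotes the inverse of $\phi$ on the $k$-th interval. $B=(B_{ij})$ is the (symmetric) Bézout matrix of $\beta_{\rm ev},\beta_{\rm od}$: $\sum_{i,j=1}^nB_{ij}z^{i-1}x^{j-1}=\frac{\beta_{\rm ev}(x)\beta_{\rm od}(z)-\beta_{\rm ev}(z)\beta_{\rm od}(x)}{x-z}$. Write $B=\Omega^t\,\mathrm{diag}(\rho_1,\dots,\rho_n)\,\Omega$ with $\Omega$ orthogonal, and let $(P_1(z),\dots,P_n(z))=(1,z,\dots,z^{n-1})\Omega^t$. $L^2_n(\mathbb R)$ is the direct sum of $n$ copies of $L^2(\mathbb R)$. The isometry $T:L^2(I)\to L^2_n(\mathbb R)$ is $$(Tf)_k(t)=\sqrt2\,\left.\frac{\mathrm{sgn}(\beta_{\rm od}(x))f(x)}{\sqrt{|\phi'(x)|}}\right|_{x=\phi_k^{-1}(2t)},\qquad k=1,\dots,n.$$ $\mathcal M$ is the operator on $L_n^2(\mathbb R)$ of pointwise multiplication by the matrix function $\{M_{jk}(t)\}$, $M_{jk}(t)=P_j(x_k)\sqrt{\rho_j/Q(x_k)}$, $x_k=\phi_k^{-1}(2t)$ (an orthogonal matrix for each $t\in\mathbb R$). $\mathcal F:L_n^2(\mathbb R)\to L_n^2(\mathbb R)$ is the component-wise one-dimensional Fourier transform in $t$, with kernel $e^{i\lambda t}$ (i.e. $\tilde h(\lambda)=\int_{\mathbb R}h(t)e^{i\lambda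 t}dt$), $\lambda$ being the Fourier variable. *)

theory Defs
  imports
    "HOL-Analysis.Analysis"
    "HOL-Computational_Algebra.Polynomial"
    "Jordan_Normal_Form.Matrix"
begin

text \<open>Elements of complex \<open>L\<^sup>2\<close> spaces are represented by functions; equality in \<open>L\<^sup>2\<close> is
  equality almost everywhere and is always written explicitly. Indices run over \<open>{0..<n}\<close>
  instead of \<open>{1..n}\<close>.\<close>

definition L2 :: "real set \<Rightarrow> (real \<Rightarrow> complex) set" where
  "L2 S = {f. f \<in> borel_measurable (lebesgue_on S) \<and> integrable (lebesgue_on S) (\<lambda>x. (cmod (f x))\<^sup>2)}"

definition L2_loc :: "real set \<Rightarrow> (real \<Rightarrow> complex) set" where
  "L2_loc U = {f. \<forall>K. compact K \<and> K \<subseteq> U \<longrightarrow> f \<in> L2 K}"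

definition eq_ae :: "real set \<Rightarrow> (real \<Rightarrow> complex) \<Rightarrow> (real \<Rightarrow> complex) \<Rightarrow> bool" where
  "eq_ae S f g \<longleftrightarrow> (AE x in lebesgue_on S. f x = g x)"

definition eq_ae_n :: "nat \<Rightarrow> (nat \<Rightarrow> real \<Rightarrow> complex) \<Rightarrow> (nat \<Rightarrow> real \<Rightarrow> complex) \<Rightarrow> bool" where
  "eq_ae_n n h h' \<longleftrightarrow> (\<forall>k<n. eq_ae UNIV (h k) (h' k))"

text \<open>\<open>f0\<close> represents the value at \<open>y\<close> of the inverse of \<open>A\<close>, an operator on \<open>L\<^sup>2(S)\<close>:
  up to the equality \<open>E\<close> of the codomain, \<open>A f = y\<close> holds for \<open>f0\<close> and, modulo null sets, for
  nothing else.\<close>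

definition is_inverse_value ::
    "real set \<Rightarrow> ((real \<Rightarrow> complex) \<Rightarrow> 'b) \<Rightarrow> ('b \<Rightarrow> 'b \<Rightarrow> bool) \<Rightarrow> 'b \<Rightarrow> (real \<Rightarrow> complex) \<Rightarrow> bool" where
  "is_inverse_value S A E y f0 \<longleftrightarrow> f0 \<in> L2 S \<and> (\<forall>f\<in>L2 S. E (A f) y \<longleftrightarrow> eq_ae S f f0)"

text \<open>The Fourier transform on \<open>L\<^sup>2(\<real>)\<close> with kernel \<open>exp (\<i>\<lambda>t)\<close>, as the \<open>L\<^sup>2\<close>-limit of the
  transforms of the truncations to \<open>[-R, R]\<close>. It is determined up to a null set.\<close>

definition is_L2_fourier :: "(real \<Rightarrow> complex) \<Rightarrow> (real \<Rightarrow> complex) \<Rightarrow> bool" where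
  "is_L2_fourier h u \<longleftrightarrow> u \<in> L2 UNIV \<and>
     ((\<lambda>R. \<integral>\<^sup>+s. ennreal ((cmod (u s - (LINT t:{-R..R}|lebesgue. h t * exp (\<i> * of_real (s * t)))))\<^sup>2)
        \<partial>lebesgue) \<longlongrightarrow> 0) at_top"

definition L2_fourier :: "(real \<Rightarrow> complex) \<Rightarrow> real \<Rightarrow> complex" where
  "L2_fourier h = (SOME u. is_L2_fourier h u)"

definition multi_interval :: "nat \<Rightarrow> (nat \<Rightarrow> real) \<Rightarrow> (nat \<Rightarrow> real) \<Rightarrow> real set" where
  "multi_interval n \<alpha> \<beta> = (\<Union>j<n. {\<alpha> j..\<beta> j})"

text \<open>Cauchy principal value; for \<open>f \<in> L\<^sup>2(S)\<close> with \<open>S\<close> bounded the limit exists for almost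
  every \<open>z\<close>.\<close>

definition finite_hilbert :: "real set \<Rightarrow> (real \<Rightarrow> complex) \<Rightarrow> real \<Rightarrow> complex" where
  "finite_hilbert S f z =
     of_real (1 / pi) *
     Lim (at_right 0) (\<lambda>\<epsilon>. LINT x:(S - {z - \<epsilon><..<z + \<epsilon>})|lebesgue. f x / of_real (x - z))"

definition hilbert_range :: "real set \<Rightarrow> (real \<Rightarrow> complex) set" where
  "hilbert_range S = {g \<in> L2 S. \<exists>f\<in>L2 S. eq_ae S (finite_hilbert S f) g}"

definition beta_od :: "nat \<Rightarrow> (nat \<Rightarrow> real) \<Rightarrow> real poly" where
  "beta_od n \<alpha> = (\<Prod>j<n. [:- \<alpha> j, 1:])"

definition beta_ev :: "nat \<Rightarrow> (nat \<Rightarrow> real) \<Rightarrow> real poly" where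
  "beta_ev n \<beta> = (\<Prod>j<n. [:- \<beta> j, 1:])"

definition phi :: "nat \<Rightarrow> (nat \<Rightarrow> real) \<Rightarrow> (nat \<Rightarrow> real) \<Rightarrow> real \<Rightarrow> real" where
  "phi n \<alpha> \<beta> z = ln \<bar>poly (beta_ev n \<beta>) z / poly (beta_od n \<alpha>) z\<bar>"

definition phi_inv :: "nat \<Rightarrow> (nat \<Rightarrow> real) \<Rightarrow> (nat \<Rightarrow> real) \<Rightarrow> nat \<Rightarrow> real \<Rightarrow> real" where
  "phi_inv n \<alpha> \<beta> k = inv_into {\<alpha> k<..<\<beta> k} (phi n \<alpha> \<beta>)"

definition Q_poly :: "nat \<Rightarrow> (nat \<Rightarrow> real) \<Rightarrow> (nat \<Rightarrow> real) \<Rightarrow> real poly" where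
  "Q_poly n \<alpha> \<beta> = pderiv (beta_ev n \<beta>) * beta_od n \<alpha> - beta_ev n \<beta> * pderiv (beta_od n \<alpha>)"

definition is_bezout_mat :: "nat \<Rightarrow> real poly \<Rightarrow> real poly \<Rightarrow> real mat \<Rightarrow> bool" where
  "is_bezout_mat n p q B \<longleftrightarrow> B \<in> carrier_mat n n \<and>
     (\<forall>x z. x \<noteq> z \<longrightarrow>
        (\<Sum>i<n. \<Sum>j<n. B $$ (i, j) * z ^ i * x ^ j) =
        (poly p x * poly q z - poly p z * poly q x) / (x - z))"

text \<open>Entry \<open>j\<close> of the row vector \<open>(1, z, \<dots>, z\<^bsup>n-1\<^esup>) W\<^sup>T\<close>.\<close>

definition P_fun :: "nat \<Rightarrow> real mat \<Rightarrow> nat \<Rightarrow> real \<Rightarrow> real" where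
  "P_fun n W j z = (\<Sum>i<n. z ^ i * transpose_mat W $$ (i, j))"

definition T_op :: "nat \<Rightarrow> (nat \<Rightarrow> real) \<Rightarrow> (nat \<Rightarrow> real) \<Rightarrow> (real \<Rightarrow> complex) \<Rightarrow> nat \<Rightarrow> real \<Rightarrow> complex" where
  "T_op n \<alpha> \<beta> f k t =
     (let x = phi_inv n \<alpha> \<beta> k (2 * t)
      in of_real (sqrt 2) * (of_real (sgn (poly (beta_od n \<alpha>) x)) * f x
           / of_real (sqrt \<bar>deriv (phi n \<alpha> \<beta>) x\<bar>)))"

definition M_fun ::
    "nat \<Rightarrow> (nat \<Rightarrow> real) \<Rightarrow> (nat \<Rightarrow> real) \<Rightarrow> real mat \<Rightarrow> (nat \<Rightarrow> real) \<Rightarrow> nat \<Rightarrow> nat \<Rightarrow> real \<Rightarrow> real" where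
  "M_fun n \<alpha> \<beta> W \<rho> j k t =
     (let x = phi_inv n \<alpha> \<beta> k (2 * t)
      in P_fun n W j x * sqrt (\<rho> j / poly (Q_poly n \<alpha> \<beta>) x))"

definition M_op ::
    "nat \<Rightarrow> (nat \<Rightarrow> real) \<Rightarrow> (nat \<Rightarrow> real) \<Rightarrow> real mat \<Rightarrow> (nat \<Rightarrow> real) \<Rightarrow>
     (nat \<Rightarrow> real \<Rightarrow> complex) \<Rightarrow> nat \<Rightarrow> real \<Rightarrow> complex" where
  "M_op n \<alpha> \<beta> W \<rho> h j t = (\<Sum>k<n. of_real (M_fun n \<alpha> \<beta> W \<rho> j k t) * h k t)"

definition F_op :: "(nat \<Rightarrow> real \<Rightarrow> complex) \<Rightarrow> nat \<Rightarrow> real \<Rightarrow> complex" where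
  "F_op h k = L2_fourier (h k)"

definition FMT ::
    "nat \<Rightarrow> (nat \<Rightarrow> real) \<Rightarrow> (nat \<Rightarrow> real) \<Rightarrow> real mat \<Rightarrow> (nat \<Rightarrow> real) \<Rightarrow>
     (real \<Rightarrow> complex) \<Rightarrow> nat \<Rightarrow> real \<Rightarrow> complex" where
  "FMT n \<alpha> \<beta> W \<rho> f = F_op (M_op n \<alpha> \<beta> W \<rho> (T_op n \<alpha> \<beta> f))"

end

theory Submission
  imports Defs "HOL-Analysis.Analysis" "HOL-Real_Asymp.Real_Asymp" "Jordan_Normal_Form.Determinant"
begin

text \<open>
  The composition of the isometry, the orthogonal matrix function and the Fourier transform
  diagonalises the finite Hilbert transform: it turns it into multiplication by
  \<open>\<i> tanh (\<lambda> \<pi> / 2)\<close>. Once this is known, \<open>g\<close> is in the range exactly if its transform divided by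
  \<open>tanh (\<lambda> \<pi> / 2)\<close> is square integrable. As this function is comparable to \<open>\<lambda>\<close> near \<open>0\<close> and bounded
  away from \<open>0\<close> elsewhere, the condition concerns a neighbourhood of \<open>0\<close> only, and the inverse is
  division by the symbol.

  The diagonalisation rests on an algebraic identity (\<open>kernel_identity\<close>). On the intervals
  \<open>\<beta>\<^sub>e\<^sub>v / \<beta>\<^sub>o\<^sub>d = - exp \<phi>\<close>. In the variables \<open>\<phi> x = 2 t\<close>, \<open>\<phi> z = 2 s\<close> the Bezout form of the two
  polynomials is therefore \<open>exp (2 s) - exp (2 t)\<close> divided by \<open>x - z\<close>, up to a factor that splits into
  one depending on \<open>x\<close> and one depending on \<open>z\<close>.
  Hence the Cauchy kernel is, up to the weights of the isometry, the kernel
  \<open>1 / (\<pi> sinh (s - t))\<close> multiplied on both sides by the matrix function. The values of the Bezout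
  form at points with equal parameter \<open>t\<close> show that the matrix function is orthogonal and that the
  eigenvalues \<open>\<rho>\<^sub>j\<close> are positive. It remains to see that convolution with \<open>1 / (\<pi> sinh u)\<close> has the
  Fourier multiplier \<open>\<i> tanh (\<lambda> \<pi> / 2)\<close>, which is a form of the partial fraction expansion of
  \<open>1 / sinh\<close> (\<open>csch_partial_fractions\<close>, \<open>csch_convolution\<close>).

  Principal values of square-integrable functions exist only almost everywhere, so this
  argument has to be made pointwise. At a Lebesgue point a truncated integral differs by a vanishing
  amount from the integral with the conjugate Poisson kernel, because the difference of the kernels is
  odd and dominated by the Poisson kernel (\<open>truncation_vs_conj_poisson\<close>). After the change of
  variables the conjugate Poisson kernel in \<open>x\<close>, with its height rescaled by the local derivative,
  differs from a regularisation of \<open>1 / sinh\<close> in \<open>t\<close> by a kernel that tends to \<open>0\<close> and stays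
  dominated (\<open>D_integral_tendsto_0\<close>). The regularised convolutions in \<open>t\<close> converge almost everywhere
  by Abel summation of the inverse Fourier integral (\<open>abel_inversion\<close>).

  The Abel weights \<open>exp (- e |s|)\<close> also give the properties of the transform on \<open>L\<^sup>2\<close>. They reduce the
  boundedness of the transform to Schur's test for the Poisson kernel (\<open>N2_ft_le\<close>), and
  inversion to the behaviour of Poisson integrals at Lebesgue points, from which injectivity and
  surjectivity of the transform follow.
\<close>

section \<open>Square-integrable functions and the Fourier integral\<close>

text \<open>Sigma-finiteness makes Fubini's theorem available for \<open>lebesgue \<Otimes>\<^sub>M lebesgue\<close>, so that
  Lebesgue measurable functions can be treated without passing to Borel representatives.\<close>

lemma sigma_finite_lebesgue: "sigma_finite_measure (lebesgue :: real measure)"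
proof
  obtain A :: "real set set" where A: "countable A" "A \<subseteq> sets lborel" "\<Union>A = space lborel"
      "\<forall>a\<in>A. emeasure lborel a \<noteq> \<infinity>"
    using lborel.sigma_finite_countable by blast
  show "\<exists>A::real set set. countable A \<and> A \<subseteq> sets lebesgue \<and> \<Union>A = space lebesgue \<and> (\<forall>a\<in>A. emeasure lebesgue a \<noteq> \<infinity>)"
    using A by (intro exI[of _ A]) (auto simp: subset_iff)
qed

interpretation lebesgue: sigma_finite_measure "lebesgue :: real measure"
  by (rule sigma_finite_lebesgue)
interpretation lebesgue_pair: pair_sigma_finite "lebesgue :: real measure" "lebesgue :: real measure" ..

lemma borel_measurable_ident_lebesgue [measurable]: "(\<lambda>x. x) \<in> lebesgue \<rightarrow>\<^sub>M (borel :: real measure)"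
  by (rule measurable_completion) simp

definition ft :: "(real \<Rightarrow> complex) \<Rightarrow> real \<Rightarrow> complex" where
  "ft h s = (LINT t|lebesgue. h t * exp (\<i> * of_real (s * t)))"

lemma norm_exp_i_of_real [simp]: "cmod (exp (\<i> * (of_real x * of_real y))) = 1"
  using norm_exp_i_times[of "x * y"] by (simp del: norm_exp_i_times)

lemma integrable_mult_bounded:
  fixes f g :: "real \<Rightarrow> complex"
  assumes "integrable lebesgue f" "g \<in> borel_measurable lebesgue" "\<And>x. cmod (g x) \<le> C"
  shows "integrable lebesgue (\<lambda>x. f x * g x)"
proof (rule Bochner_Integration.integrable_bound[where f="\<lambda>x. C * norm (f x)"])
  show "integrable lebesgue (\<lambda>x. C * norm (f x))" using assms by auto
  show "(\<lambda>x. f x * g x) \<in> borel_measurable lebesgue"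
    using assms borel_measurable_integrable by (intro borel_measurable_times) auto
  show "AE x in lebesgue. norm (f x * g x) \<le> norm (C * norm (f x))"
  proof (rule AE_I2)
    fix x show "norm (f x * g x) \<le> norm (C * norm (f x))"
      using mult_right_mono[OF assms(3)[of x], of "cmod (f x)"] by (simp add: norm_mult mult.commute abs_mult)
       (meson abs_ge_self mult_right_mono norm_ge_zero order_trans)
  qed
qed

lemma integrable_ft_integrand:
  assumes "integrable lebesgue h"
  shows "integrable lebesgue (\<lambda>t. h t * exp (\<i> * of_real (s * t)))"
  by (rule integrable_mult_bounded[OF assms, where C=1]) auto

lemma borel_measurable_ft [measurable]:
  assumes [measurable]: "h \<in> borel_measurable lebesgue"
  shows "ft h \<in> borel_measurable lebesgue"
proof -
  have "(\<lambda>s. LINT t|lebesgue. (\<lambda>(s,t). h t * exp (\<i> * of_real (s * t))) (s,t)) \<in> borel_measurable lebesgue"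
    by (rule lebesgue.borel_measurable_lebesgue_integral) measurable
  then show ?thesis unfolding ft_def[abs_def] by simp
qed

lemma norm_ft_le: "integrable lebesgue h \<Longrightarrow> cmod (ft h s) \<le> (LINT t|lebesgue. cmod (h t))"
  unfolding ft_def
  by (rule order_trans[OF integral_norm_bound]) (simp add: norm_mult)

text \<open>Fubini's theorem. Every later identity between a function and its transform comes from this
  formula by choosing \<open>a\<close> with a known transform.\<close>

lemma ft_multiplication_formula:
  assumes h: "integrable lebesgue h" and a: "integrable lebesgue a"
  shows "(LINT s|lebesgue. ft h s * a s) = (LINT t|lebesgue. h t * ft a t)"
proof -
  have [measurable]: "h \<in> borel_measurable lebesgue" "a \<in> borel_measurable lebesgue"
    using h a by auto
  define F where "F = (\<lambda>(s,t). h t * a s * exp (\<i> * of_real (s * t)))"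
  have int: "integrable (lebesgue \<Otimes>\<^sub>M lebesgue) F"
  proof (rule lebesgue_pair.Fubini_integrable)
    show "F \<in> borel_measurable (lebesgue \<Otimes>\<^sub>M lebesgue)" unfolding F_def by measurable
    have "(\<lambda>x. LINT y|lebesgue. norm (F (x, y))) = (\<lambda>x. cmod (a x) * (LINT t|lebesgue. cmod (h t)))"
      by (rule ext, subst integral_mult_right_zero[symmetric]) (auto simp: F_def norm_mult mult_ac)
    then show "integrable lebesgue (\<lambda>x. LINT y|lebesgue. norm (F (x, y)))" using a by simp
    have "integrable lebesgue (\<lambda>y. F (x, y))" for x
      using integrable_mult_right[OF integrable_ft_integrand[OF h, of x], of "a x"] by (simp add: F_def mult_ac)
    then show "AE x in lebesgue. integrable lebesgue (\<lambda>y. F (x, y))" by simp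
  qed
  have "(LINT y|lebesgue. LINT x|lebesgue. h y * a x * exp (\<i> * of_real (x * y))) =
     (LINT x|lebesgue. LINT y|lebesgue. h y * a x * exp (\<i> * of_real (x * y)))"
    using lebesgue_pair.Fubini_integral[of "\<lambda>s t. h t * a s * exp (\<i> * of_real (s * t))"] int
    unfolding F_def by simp
  moreover have "(LINT y|lebesgue. h y * a x * exp (\<i> * of_real (x * y))) = ft h x * a x" for x
    unfolding ft_def by (subst integral_mult_left_zero[symmetric]) (simp add: mult_ac)
  moreover have "(LINT x|lebesgue. h y * a x * exp (\<i> * of_real (x * y))) = h y * ft a y" for y
    unfolding ft_def by (subst integral_mult_right_zero[symmetric]) (simp add: mult_ac)
  ultimately show ?thesis by simp
qed

text \<open>The squared \<open>L\<^sup>2\<close> norm as an extended real: Fatou's lemma and Tonelli's theorem then apply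
  without integrability side conditions.\<close>

definition N2 :: "(real \<Rightarrow> complex) \<Rightarrow> ennreal" where
  "N2 f = (\<integral>\<^sup>+x. ennreal ((cmod (f x))\<^sup>2) \<partial>lebesgue)"

lemma L2_UNIV_iff: "f \<in> L2 UNIV \<longleftrightarrow> f \<in> borel_measurable lebesgue \<and> N2 f < \<infinity>"
  unfolding L2_def N2_def lebesgue_on_UNIV_eq by (auto simp: integrable_iff_bounded)

lemma L2_on_iff:
  assumes "K \<in> sets lebesgue"
  shows "f \<in> L2 K \<longleftrightarrow> (\<lambda>x. if x \<in> K then f x else 0) \<in> L2 UNIV"
proof -
  have "(\<lambda>x. (cmod (if x \<in> K then f x else 0))\<^sup>2) = (\<lambda>x. if x \<in> K then (cmod (f x))\<^sup>2 else 0)" by auto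
  then show ?thesis
    unfolding L2_def lebesgue_on_UNIV_eq
    using borel_measurable_if[OF assms, of f] Lebesgue_Measure.integrable_restrict_UNIV[OF assms, of "\<lambda>x. (cmod (f x))\<^sup>2"]
    by simp
qed

lemma L2_measurable: "f \<in> L2 UNIV \<Longrightarrow> f \<in> borel_measurable lebesgue" by (simp add: L2_UNIV_iff)

lemma N2_cong_AE: "AE x in lebesgue. f x = g x \<Longrightarrow> N2 f = N2 g"
  unfolding N2_def by (rule nn_integral_cong_AE) auto

lemma L2_cong_AE:
  assumes "AE x in lebesgue. f x = g x" "f \<in> L2 UNIV" shows "g \<in> L2 UNIV"
  using assms borel_measurable_AE[of f g] N2_cong_AE[of f g] by (simp add: L2_UNIV_iff)

lemma cmod_add_sq: "(cmod (a + b))\<^sup>2 \<le> 2 * (cmod a)\<^sup>2 + 2 * (cmod b)\<^sup>2"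
proof -
  have "(cmod (a + b))\<^sup>2 \<le> (cmod a + cmod b)\<^sup>2" by (intro power_mono norm_triangle_ineq) auto
  also have "\<dots> \<le> 2 * (cmod a)\<^sup>2 + 2 * (cmod b)\<^sup>2"
    using sum_squares_bound[of "cmod a" "cmod b"] by (simp add: power2_sum)
  finally show ?thesis .
qed

lemma N2_add_le:
  assumes [measurable]: "f \<in> borel_measurable lebesgue" "g \<in> borel_measurable lebesgue"
  shows "N2 (\<lambda>x. f x + g x) \<le> 2 * N2 f + 2 * N2 g"
proof -
  have "N2 (\<lambda>x. f x + g x) \<le> (\<integral>\<^sup>+x. 2 * ennreal ((cmod (f x))\<^sup>2) + 2 * ennreal ((cmod (g x))\<^sup>2) \<partial>lebesgue)"
    unfolding N2_def
  proof (rule nn_integral_mono)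
    fix x show "ennreal ((cmod (f x + g x))\<^sup>2) \<le> 2 * ennreal ((cmod (f x))\<^sup>2) + 2 * ennreal ((cmod (g x))\<^sup>2)"
      using ennreal_leI[OF cmod_add_sq[of "f x" "g x"]]
      by (simp add: ennreal_plus ennreal_mult)
  qed
  also have "\<dots> = 2 * N2 f + 2 * N2 g" unfolding N2_def by (simp add: nn_integral_add nn_integral_cmult)
  finally show ?thesis .
qed

lemma N2_diff_commute: "N2 (\<lambda>x. f x - g x) = N2 (\<lambda>x. g x - f x)" unfolding N2_def by (simp add: norm_minus_commute)
lemma N2_cnj [simp]: "N2 (\<lambda>x. cnj (f x)) = N2 f" unfolding N2_def by simp

lemma N2_triangle:
  assumes [measurable]: "f \<in> borel_measurable lebesgue" "g \<in> borel_measurable lebesgue" "h \<in> borel_measurable lebesgue"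
  shows "N2 (\<lambda>x. f x - h x) \<le> 2 * N2 (\<lambda>x. f x - g x) + 2 * N2 (\<lambda>x. g x - h x)"
  using N2_add_le[of "\<lambda>x. f x - g x" "\<lambda>x. g x - h x"] by simp

lemma L2_add: "f \<in> L2 UNIV \<Longrightarrow> g \<in> L2 UNIV \<Longrightarrow> (\<lambda>x. f x + g x) \<in> L2 UNIV"
  unfolding L2_UNIV_iff using N2_add_le[of f g]
  by (auto simp: ennreal_mult_less_top intro: order_le_less_trans)

lemma L2_mult_bounded:
  assumes "f \<in> L2 UNIV" "g \<in> borel_measurable lebesgue" "AE x in lebesgue. cmod (g x) \<le> C"
  shows "(\<lambda>x. g x * f x) \<in> L2 UNIV"
proof -
  have [measurable]: "f \<in> borel_measurable lebesgue" "g \<in> borel_measurable lebesgue"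
    using assms L2_measurable by auto
  have "N2 (\<lambda>x. g x * f x) \<le> (\<integral>\<^sup>+x. ennreal (C\<^sup>2) * ennreal ((cmod (f x))\<^sup>2) \<partial>lebesgue)"
    unfolding N2_def
  proof (rule nn_integral_mono_AE)
    show "AE x in lebesgue. ennreal ((cmod (g x * f x))\<^sup>2) \<le> ennreal (C\<^sup>2) * ennreal ((cmod (f x))\<^sup>2)"
      using assms(3)
    proof eventually_elim
      case (elim x)
      have "(cmod (g x))\<^sup>2 \<le> C\<^sup>2" using elim by (intro power_mono) auto
      then have "(cmod (g x * f x))\<^sup>2 \<le> C\<^sup>2 * (cmod (f x))\<^sup>2" by (simp add: norm_mult power_mult_distrib mult_right_mono)
      from ennreal_leI[OF this] show ?case by (simp add: ennreal_mult)
    qed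
  qed
  also have "\<dots> = ennreal (C\<^sup>2) * N2 f" unfolding N2_def by (simp add: nn_integral_cmult)
  also have "\<dots> < \<infinity>" using assms(1) by (simp add: L2_UNIV_iff ennreal_mult_less_top)
  finally show ?thesis by (simp add: L2_UNIV_iff)
qed

lemma L2_cmult: "f \<in> L2 UNIV \<Longrightarrow> (\<lambda>x. c * f x) \<in> L2 UNIV"
  by (rule L2_mult_bounded[where C="cmod c"]) auto

lemma L2_diff: "f \<in> L2 UNIV \<Longrightarrow> g \<in> L2 UNIV \<Longrightarrow> (\<lambda>x. f x - g x) \<in> L2 UNIV"
  using L2_add[of f "\<lambda>x. (-1) * g x"] L2_cmult[of g "-1"] by simp

lemma L2_zero: "(\<lambda>x. 0) \<in> L2 UNIV" by (simp add: L2_UNIV_iff N2_def)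

lemma L2_sum: "(\<And>k. k \<in> K \<Longrightarrow> f k \<in> L2 UNIV) \<Longrightarrow> (\<lambda>x. \<Sum>k\<in>K. f k x) \<in> L2 UNIV"
  by (induction K rule: infinite_finite_induct) (auto simp: L2_zero L2_add)

lemma L2_cnj: "f \<in> L2 UNIV \<Longrightarrow> (\<lambda>x. cnj (f x)) \<in> L2 UNIV"
  using borel_measurable_continuous_onI[OF continuous_on_cnj[OF continuous_on_id], THEN measurable_compose[rotated], of f lebesgue]
  by (simp add: L2_UNIV_iff)

lemma L2_dominated:
  assumes "g \<in> L2 UNIV" "f \<in> borel_measurable lebesgue" "AE x in lebesgue. cmod (f x) \<le> cmod (g x)"
  shows "f \<in> L2 UNIV"
proof -
  have "N2 f \<le> N2 g" unfolding N2_def using assms(3)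
    by (intro nn_integral_mono_AE) (auto intro!: ennreal_leI power_mono)
  then show ?thesis using assms by (auto simp: L2_UNIV_iff)
qed

lemma L2_integrable_mult:
  assumes "f \<in> L2 UNIV" "g \<in> L2 UNIV"
  shows "integrable lebesgue (\<lambda>x. f x * g x)"
proof (rule Bochner_Integration.integrable_bound[where f="\<lambda>x. (cmod (f x))\<^sup>2 + (cmod (g x))\<^sup>2"])
  have [measurable]: "f \<in> borel_measurable lebesgue" "g \<in> borel_measurable lebesgue" using assms L2_measurable by auto
  show "integrable lebesgue (\<lambda>x. (cmod (f x))\<^sup>2 + (cmod (g x))\<^sup>2)"
    using assms unfolding L2_def lebesgue_on_UNIV_eq by auto
  show "(\<lambda>x. f x * g x) \<in> borel_measurable lebesgue" by measurable
  have "cmod a * cmod b \<le> (cmod a)\<^sup>2 + (cmod b)\<^sup>2" for a b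
    using sum_squares_bound[of "cmod a" "cmod b"] zero_le_mult_iff[of "cmod a" "cmod b"] norm_ge_zero[of a] norm_ge_zero[of b] by linarith
  then show "AE x in lebesgue. norm (f x * g x) \<le> norm ((cmod (f x))\<^sup>2 + (cmod (g x))\<^sup>2)"
    by (intro AE_I2) (simp add: norm_mult)
qed

lemma L2_Cauchy_Schwarz:
  assumes "f \<in> L2 UNIV" "g \<in> L2 UNIV"
  shows "(ennreal (cmod (LINT x|lebesgue. f x * g x)))\<^sup>2 \<le> N2 f * N2 g"
proof -
  have [measurable]: "f \<in> borel_measurable lebesgue" "g \<in> borel_measurable lebesgue" using assms L2_measurable by auto
  have "ennreal (cmod (LINT x|lebesgue. f x * g x)) \<le> (\<integral>\<^sup>+x. ennreal (cmod (f x)) * ennreal (cmod (g x)) \<partial>lebesgue)"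
    using integral_norm_bound_ennreal[OF L2_integrable_mult[OF assms]] by (simp add: norm_mult ennreal_mult)
  from power_mono[OF this, of 2]
  have "(ennreal (cmod (LINT x|lebesgue. f x * g x)))\<^sup>2 \<le> (\<integral>\<^sup>+x. ennreal (cmod (f x)) * ennreal (cmod (g x)) \<partial>lebesgue)\<^sup>2"
    by simp
  also have "\<dots> \<le> N2 f * N2 g"
    using Cauchy_Schwarz_nn_integral[of "\<lambda>x. ennreal (cmod (f x))" lebesgue "\<lambda>x. ennreal (cmod (g x))"]
    unfolding N2_def by (simp add: ennreal_power)
  finally show ?thesis .
qed

text \<open>By the Cauchy-Schwarz inequality, pairing with a fixed \<open>L\<^sup>2\<close> function is continuous for
  convergence in mean square.\<close>

lemma L2_tendsto_integral_mult:
  assumes u: "\<forall>\<^sub>F n in F. u n \<in> L2 UNIV" and "u0 \<in> L2 UNIV" "a \<in> L2 UNIV"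
    and lim: "((\<lambda>n. N2 (\<lambda>x. u n x - u0 x)) \<longlongrightarrow> 0) F"
  shows "((\<lambda>n. LINT x|lebesgue. u n x * a x) \<longlongrightarrow> (LINT x|lebesgue. u0 x * a x)) F"
proof -
  let ?d = "\<lambda>n. cmod ((LINT x|lebesgue. u n x * a x) - (LINT x|lebesgue. u0 x * a x))"
  have "((\<lambda>n. N2 (\<lambda>x. u n x - u0 x) * N2 a) \<longlongrightarrow> 0 * N2 a) F"
    using assms by (intro tendsto_mult_ennreal lim tendsto_const) (auto simp: L2_UNIV_iff)
  then have 1: "((\<lambda>n. N2 (\<lambda>x. u n x - u0 x) * N2 a) \<longlongrightarrow> 0) F" by simp
  have "((\<lambda>n. ennreal ((?d n)\<^sup>2)) \<longlongrightarrow> 0) F"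
  proof (rule tendsto_sandwich[OF _ _ tendsto_const 1])
    show "\<forall>\<^sub>F n in F. ennreal ((?d n)\<^sup>2) \<le> N2 (\<lambda>x. u n x - u0 x) * N2 a"
      using u
    proof eventually_elim
      case (elim n)
      have "(LINT x|lebesgue. u n x * a x) - (LINT x|lebesgue. u0 x * a x) = (LINT x|lebesgue. (u n x - u0 x) * a x)"
        using assms elim by (subst Bochner_Integration.integral_diff[symmetric]) (auto intro!: L2_integrable_mult simp: algebra_simps)
      then show ?case using L2_Cauchy_Schwarz[OF L2_diff[OF elim assms(2)] assms(3)] by (simp add: ennreal_power)
    qed
  qed auto
  then have "((\<lambda>n. (?d n)\<^sup>2) \<longlongrightarrow> 0) F"
    by (subst (asm) ennreal_0[symmetric], subst (asm) tendsto_ennreal_iff) auto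
  then have "((\<lambda>n. sqrt ((?d n)\<^sup>2)) \<longlongrightarrow> sqrt 0) F" by (intro tendsto_intros)
  then have "(?d \<longlongrightarrow> 0) F" by simp
  then show ?thesis using tendsto_norm_zero_iff[of "\<lambda>n. (LINT x|lebesgue. u n x * a x) - (LINT x|lebesgue. u0 x * a x)" F] LIM_zero_iff by blast
qed

section \<open>Completeness\<close>

lemma N2_le_of_tendsto:
  assumes [measurable]: "\<And>k. f k \<in> borel_measurable lebesgue"
    and lim: "AE x in lebesgue. (\<lambda>k. f k x) \<longlonglongrightarrow> g x"
    and ev: "\<forall>\<^sub>F k in sequentially. N2 (f k) \<le> C"
  shows "N2 g \<le> C"
proof -
  have "N2 g = (\<integral>\<^sup>+x. liminf (\<lambda>k. ennreal ((cmod (f k x))\<^sup>2)) \<partial>lebesgue)"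
    unfolding N2_def
  proof (rule nn_integral_cong_AE, use lim in eventually_elim)
    case (elim x)
    have "(\<lambda>k. ennreal ((cmod (f k x))\<^sup>2)) \<longlonglongrightarrow> ennreal ((cmod (g x))\<^sup>2)"
      by (intro tendsto_ennrealI tendsto_power tendsto_norm elim)
    then show ?case using lim_imp_Liminf by force
  qed
  also have "\<dots> \<le> liminf (\<lambda>k. N2 (f k))"
    unfolding N2_def by (rule nn_integral_liminf) measurable
  also have "\<dots> \<le> C"
    using Liminf_mono[OF ev] by (simp add: Liminf_const)
  finally show ?thesis .
qed

lemma tendsto_0_ennrealI:
  fixes f :: "'a \<Rightarrow> ennreal"
  assumes "\<And>e. e > 0 \<Longrightarrow> \<forall>\<^sub>F n in F. f n \<le> ennreal e"
  shows "(f \<longlongrightarrow> 0) F"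
proof (rule order_tendstoI)
  fix a :: ennreal assume a: "0 < a"
  obtain e where e: "e > 0" "ennreal e < a"
  proof (cases a)
    case (real r)
    then have "r > 0" using a by (simp add: ennreal_less_zero_iff)
    with real that[of "r/2"] show ?thesis by (auto simp: ennreal_less_iff)
  next
    case top then show ?thesis using that[of 1] by simp
  qed
  show "\<forall>\<^sub>F x in F. f x < a" using assms[OF e(1)] by eventually_elim (use e in auto)
qed auto

text \<open>The theorem of Riesz and Fischer. A subsequence with increments of size \<open>4\<^sup>-\<^sup>k\<close> has almost
  everywhere summable increments, hence a pointwise limit, and Fatou's lemma identifies this limit
  as the limit in mean square of the whole sequence.\<close>

lemma L2_complete:
  assumes u: "\<And>n. u n \<in> L2 UNIV"
    and cauchy: "\<And>e. 0 < e \<Longrightarrow> \<exists>N. \<forall>m\<ge>N. \<forall>n\<ge>N. N2 (\<lambda>x. u m x - u n x) \<le> ennreal e"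
  obtains v where "v \<in> L2 UNIV" "(\<lambda>n. N2 (\<lambda>x. u n x - v x)) \<longlonglongrightarrow> 0"
proof -
  have [measurable]: "u n \<in> borel_measurable lebesgue" for n using u L2_measurable by auto
  have "\<forall>k::nat. \<exists>N. \<forall>m\<ge>N. \<forall>n\<ge>N. N2 (\<lambda>x. u m x - u n x) \<le> ennreal ((1/4)^k)"
    using cauchy by simp
  then obtain N where N: "\<And>k m n. N k \<le> m \<Longrightarrow> N k \<le> n \<Longrightarrow> N2 (\<lambda>x. u m x - u n x) \<le> ennreal ((1/4)^k)"
    by metis
  define r where "r k = (\<Sum>i\<le>k. N i) + k" for k :: nat
  have rN: "N k \<le> r k" "N k \<le> r (Suc k)" "k \<le> r k" for k
    unfolding r_def using member_le_sum[of k "{..k}" N] by auto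
  define d where "d k x = u (r (Suc k)) x - u (r k) x" for k x
  have [measurable]: "d k \<in> borel_measurable lebesgue" for k unfolding d_def by measurable
  \<comment> \<open>The weight \<open>2^k\<close> leaves a convergent sum of integrals, as \<open>N2 (d k) \<le> 4\<^sup>-\<^sup>k\<close>, and finiteness of
    \<open>S x\<close> forces geometric decay of \<open>d k x\<close>.\<close>
  define S where "S x = (\<Sum>k. ennreal (2^k * (cmod (d k x))\<^sup>2))" for x
  have "(\<integral>\<^sup>+x. S x \<partial>lebesgue) = (\<Sum>k. \<integral>\<^sup>+x. ennreal (2^k * (cmod (d k x))\<^sup>2) \<partial>lebesgue)"
    unfolding S_def by (rule nn_integral_suminf) measurable
  also have "\<dots> \<le> (\<Sum>k. ennreal ((1/2)^k))"
  proof (intro suminf_le summableI)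
    fix k
    have "(\<integral>\<^sup>+x. ennreal (2^k * (cmod (d k x))\<^sup>2) \<partial>lebesgue) = ennreal (2^k) * N2 (d k)"
      unfolding N2_def by (subst nn_integral_cmult[symmetric]) (auto simp: ennreal_mult)
    also have "\<dots> \<le> ennreal (2^k) * ennreal ((1/4)^k)"
      using N[OF rN(2) rN(1)] by (intro mult_left_mono) (auto simp: d_def[abs_def])
    also have "\<dots> = ennreal ((1/2)^k)"
      by (simp add: ennreal_mult[symmetric] power_mult_distrib[symmetric])
    finally show "(\<integral>\<^sup>+x. ennreal (2^k * (cmod (d k x))\<^sup>2) \<partial>lebesgue) \<le> ennreal ((1/2)^k)" .
  qed
  also have "\<dots> = ennreal (1 / (1 - 1/2))"
    by (rule suminf_ennreal_eq, simp, rule geometric_sums, simp)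
  also have "\<dots> < \<infinity>" by (simp only: infinity_ennreal_def ennreal_less_top)
  finally have "(\<integral>\<^sup>+x. S x \<partial>lebesgue) \<noteq> \<infinity>" by simp
  then have "AE x in lebesgue. S x \<noteq> \<infinity>"
    unfolding S_def by (intro nn_integral_noteq_infinite) measurable
  then have conv: "AE x in lebesgue. convergent (\<lambda>k. u (r k) x)"
  proof eventually_elim
    case (elim x)
    define C where "C = enn2real (S x)"
    have SC: "S x = ennreal C" "C \<ge> 0" using elim by (auto simp: C_def ennreal_enn2real_if)
    have bound: "norm (d k x) \<le> sqrt C * (sqrt (1/2)) ^ k" for k
    proof -
      have "ennreal (2^k * (cmod (d k x))\<^sup>2) = (\<Sum>i\<in>{k}. ennreal (2^i * (cmod (d i x))\<^sup>2))" by simp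
      also have "\<dots> \<le> S x" unfolding S_def by (rule sum_le_suminf) auto
      finally have "2^k * (cmod (d k x))\<^sup>2 \<le> C" using SC by (simp add: ennreal_le_iff)
      then have "(cmod (d k x))\<^sup>2 \<le> C * (1/2)^k" by (simp add: field_simps power_divide)
      then have "sqrt ((cmod (d k x))\<^sup>2) \<le> sqrt (C * (1/2)^k)" by (rule real_sqrt_le_mono)
      then show ?thesis by (simp add: real_sqrt_mult real_sqrt_power real_sqrt_divide power_divide)
    qed
    have "summable (\<lambda>k. sqrt C * (sqrt (1/2)) ^ k)"
      by (intro summable_mult summable_geometric) (simp add: real_sqrt_divide)
    then have "summable (\<lambda>k. d k x)" by (rule summable_comparison_test'[where N=0]) (use bound in auto)
    then have "convergent (\<lambda>n. u (r 0) x + (\<Sum>k<n. d k x))"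
      by (intro convergent_add convergent_const) (simp add: summable_iff_convergent)
    moreover have "u (r 0) x + (\<Sum>k<n. d k x) = u (r n) x" for n
      unfolding d_def by (subst sum_lessThan_telescope) simp
    ultimately show ?case by simp
  qed
  define v where "v x = lim (\<lambda>k. u (r k) x)" for x
  have [measurable]: "v \<in> borel_measurable lebesgue"
    unfolding v_def by measurable
  have lim: "AE x in lebesgue. (\<lambda>k. u (r k) x) \<longlonglongrightarrow> v x"
    using conv by eventually_elim (simp add: v_def convergent_LIMSEQ_iff)
  have near: "\<exists>N. \<forall>n\<ge>N. N2 (\<lambda>x. u n x - v x) \<le> ennreal e" if e: "e > 0" for e
  proof -
    obtain M where M: "\<And>m n. M \<le> m \<Longrightarrow> M \<le> n \<Longrightarrow> N2 (\<lambda>x. u m x - u n x) \<le> ennreal e"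
      using cauchy[OF e] by metis
    have "N2 (\<lambda>x. u n x - v x) \<le> ennreal e" if "n \<ge> M" for n
    proof (rule N2_le_of_tendsto[where f="\<lambda>k x. u n x - u (r k) x"])
      show "AE x in lebesgue. (\<lambda>k. u n x - u (r k) x) \<longlonglongrightarrow> u n x - v x"
        using lim by eventually_elim (intro tendsto_intros)
      show "\<forall>\<^sub>F k in sequentially. N2 (\<lambda>x. u n x - u (r k) x) \<le> ennreal e"
        using eventually_ge_at_top[of M] by eventually_elim (use rN(3) that in \<open>intro M, auto intro: order_trans\<close>)
    qed measurable
    then show ?thesis by blast
  qed
  have "(\<lambda>n. N2 (\<lambda>x. u n x - v x)) \<longlonglongrightarrow> 0"
  proof (rule tendsto_0_ennrealI)
    show "\<forall>\<^sub>F n in sequentially. N2 (\<lambda>x. u n x - v x) \<le> ennreal e" if "e > 0" for e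
      using near[OF that] by (simp add: eventually_sequentially)
  qed
  moreover have "v \<in> L2 UNIV"
  proof -
    obtain n where "N2 (\<lambda>x. u n x - v x) \<le> ennreal 1" using near[of 1] by auto
    then have "(\<lambda>x. u n x - v x) \<in> L2 UNIV" unfolding L2_UNIV_iff by (auto intro: order_le_less_trans)
    from L2_diff[OF u[of n] this] show ?thesis by simp
  qed
  ultimately show ?thesis using that by blast
qed

section \<open>Abel and Poisson kernels\<close>

text \<open>The Poisson kernel of the upper half-plane at height \<open>e\<close>, up to the factor \<open>1 / \<pi>\<close>.\<close>

definition poisson :: "real \<Rightarrow> real \<Rightarrow> real" where
  "poisson e v = e / (e\<^sup>2 + v\<^sup>2)"

text \<open>The one-sided exponential is the building block of the Abel kernels below: its integral is
  elementary for complex exponents with positive real part.\<close>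

lemma has_bochner_integral_exp_half_line:
  fixes c :: complex
  assumes "Re c > 0"
  shows "has_bochner_integral lebesgue (\<lambda>s. indicator {0<..} s *\<^sub>R exp (- c * of_real s)) (1 / c)"
proof -
  note [measurable del] = borel_measurable_ident_lebesgue
  have meas: "(\<lambda>s. indicator {0<..} s *\<^sub>R exp (- c * of_real s)) \<in> borel_measurable lborel"
    by measurable
  have "(\<lambda>x. exp (- Re c * x)) absolutely_integrable_on {0..}"
    using integrable_on_exp_minus_to_infinity[OF assms, of 0]
    by (intro nonnegative_absolutely_integrable_1) auto
  then have "integrable lebesgue (\<lambda>x. indicator {0..} x *\<^sub>R exp (- Re c * x))"
    unfolding set_integrable_def .
  then have "integrable lebesgue (\<lambda>s. indicator {0<..} s *\<^sub>R exp (- c * of_real s))"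
  proof (rule Bochner_Integration.integrable_bound)
    show "(\<lambda>s. indicator {0<..} s *\<^sub>R exp (- c * of_real s)) \<in> borel_measurable lebesgue"
      using meas by (rule measurable_completion)
  qed (auto simp: indicator_def)
  then have int: "set_integrable lborel {0<..} (\<lambda>s. exp (- c * of_real s))"
    unfolding set_integrable_def using meas by (subst (asm) integrable_completion) auto
  have [simp]: "einterval 0 \<infinity> = {0<..}" by (auto simp: einterval_def)
  have "(LBINT s=0..\<infinity>. exp (- c * of_real s)) = 0 - (- 1 / c)"
  proof (rule interval_integral_FTC_integrable[where F="\<lambda>s. - exp (- c * of_real s) / c"])
    have [simp]: "c \<noteq> 0" using assms by auto
    show "((\<lambda>s. - exp (- c * of_real s) / c) has_vector_derivative exp (- c * of_real x)) (at x)" for x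
      by (rule has_vector_derivative_real_field) (auto intro!: derivative_eq_intros)
    show "(((\<lambda>s. - exp (- c * of_real s) / c) \<circ> real_of_ereal) \<longlongrightarrow> - 1 / c) (at_right 0)"
      unfolding zero_ereal_def ereal_tendsto_simps
      by (rule tendsto_eq_intros refl | simp)+
    have "((\<lambda>s. exp (- Re c * s)) \<longlongrightarrow> 0) at_top" using assms by real_asymp
    then have "((\<lambda>s. - exp (- c * of_real s) / c) \<longlongrightarrow> 0) at_top"
      by (intro tendsto_norm_zero_cancel[of "\<lambda>s. - exp (- c * of_real s) / c"])
        (auto simp: norm_divide intro!: tendsto_divide_zero)
    then show "(((\<lambda>s. - exp (- c * of_real s) / c) \<circ> real_of_ereal) \<longlongrightarrow> 0) (at_left \<infinity>)"
      unfolding ereal_tendsto_simps .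
  qed (use int in auto)
  then have "(LBINT s:{0<..}. exp (- c * of_real s)) = 1 / c"
    by (simp add: interval_lebesgue_integral_def)
  then have "has_bochner_integral lborel (\<lambda>s. indicator {0<..} s *\<^sub>R exp (- c * of_real s)) (1 / c)"
    using int unfolding has_bochner_integral_iff set_integrable_def set_lebesgue_integral_def by simp
  then show ?thesis
    unfolding has_bochner_integral_iff
    using meas by (simp add: integrable_completion integral_completion)
qed

lemma has_bochner_integral_lebesgue_reflect:
  fixes f :: "real \<Rightarrow> complex"
  assumes "has_bochner_integral lebesgue f I"
  shows "has_bochner_integral lebesgue (\<lambda>x. f (- x)) I"
  using assms lebesgue_integrable_real_affine_iff[of "-1" f 0] lebesgue_integral_real_affine[of "-1" f 0]
  unfolding has_bochner_integral_iff by simp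

lemma AE_lebesgue_neq: "AE x in lebesgue. x \<noteq> (a::real)"
  using AE_completion[OF AE_lborel_singleton[of a]] .

text \<open>The two halves of the line contribute \<open>1 / (e - \<i> v)\<close> and \<open>1 / (e + \<i> v)\<close>. Their sum is the
  Poisson kernel and their difference the conjugate Poisson kernel.\<close>

lemma
  assumes e: "e > 0"
  shows abel_kernel_even: "has_bochner_integral lebesgue (\<lambda>s. of_real (exp (- e * \<bar>s\<bar>)) * exp (\<i> * of_real (s * v))) (of_real (2 * poisson e v))"
    and abel_kernel_odd: "has_bochner_integral lebesgue (\<lambda>s. of_real (sgn s * exp (- e * \<bar>s\<bar>)) * exp (\<i> * of_real (s * v))) (\<i> * of_real (2 * v / (e\<^sup>2 + v\<^sup>2)))"
proof -
  let ?p = "\<lambda>s. indicator {0<..} s *\<^sub>R exp (- (of_real e - \<i> * of_real v) * of_real s) :: complex"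
  let ?q = "\<lambda>s. indicator {0<..} (-s) *\<^sub>R exp (- (of_real e + \<i> * of_real v) * of_real (-s)) :: complex"
  have p: "has_bochner_integral lebesgue ?p (1 / (of_real e - \<i> * of_real v))"
    using e by (intro has_bochner_integral_exp_half_line) simp
  have q: "has_bochner_integral lebesgue ?q (1 / (of_real e + \<i> * of_real v))"
    using e has_bochner_integral_lebesgue_reflect[OF has_bochner_integral_exp_half_line[of "of_real e + \<i> * of_real v"]] by simp
  have nz: "of_real e - \<i> * of_real v \<noteq> 0" "of_real e + \<i> * of_real v \<noteq> 0" "of_real (e\<^sup>2 + v\<^sup>2) \<noteq> (0::complex)"
    using e by (auto simp: complex_eq_iff)
  have prod: "(of_real e - \<i> * of_real v) * (of_real e + \<i> * of_real v) = of_real (e\<^sup>2 + v\<^sup>2)"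
    by (simp add: algebra_simps power2_eq_square)
  have "1 / (of_real e - \<i> * of_real v) + 1 / (of_real e + \<i> * of_real v) = of_real (2 * poisson e v)"
    using nz prod by (simp add: add_frac_eq poisson_def)
  moreover have "1 / (of_real e - \<i> * of_real v) - 1 / (of_real e + \<i> * of_real v) = \<i> * of_real (2 * v / (e\<^sup>2 + v\<^sup>2))"
    using nz prod by (simp add: diff_frac_eq)
  ultimately have P: "has_bochner_integral lebesgue (\<lambda>s. ?p s + ?q s) (of_real (2 * poisson e v))"
    and Q: "has_bochner_integral lebesgue (\<lambda>s. ?p s - ?q s) (\<i> * of_real (2 * v / (e\<^sup>2 + v\<^sup>2)))"
    using has_bochner_integral_add[OF p q] has_bochner_integral_diff[OF p q] by auto
  have E: "of_real (exp (- e * \<bar>s\<bar>)) * exp (\<i> * of_real (s * v)) = (if s > 0 then exp (- (of_real e - \<i> * of_real v) * of_real s) else exp (- (of_real e + \<i> * of_real v) * of_real (-s)) :: complex)" for s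
    unfolding exp_of_real[symmetric] mult_exp_exp by (auto simp: algebra_simps intro!: arg_cong[where f=exp])
  have PE: "?p s + ?q s = of_real (exp (- e * \<bar>s\<bar>)) * exp (\<i> * of_real (s * v))" if "s \<noteq> 0" for s
    using that unfolding E by (auto simp: indicator_def)
  have QE: "?p s - ?q s = of_real (sgn s * exp (- e * \<bar>s\<bar>)) * exp (\<i> * of_real (s * v))" if "s \<noteq> 0" for s
  proof -
    have "of_real (sgn s * exp (- e * \<bar>s\<bar>)) * exp (\<i> * of_real (s * v)) = of_real (sgn s) * (of_real (exp (- e * \<bar>s\<bar>)) * exp (\<i> * of_real (s * v)))" by simp
    then show ?thesis using that unfolding E by (auto simp: indicator_def sgn_if)
  qed
  have "(\<lambda>s. of_real (exp (- e * \<bar>s\<bar>)) * exp (\<i> * of_real (s * v)) :: complex) \<in> borel_measurable lebesgue"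
    "(\<lambda>s. of_real (sgn s * exp (- e * \<bar>s\<bar>)) * exp (\<i> * of_real (s * v)) :: complex) \<in> borel_measurable lebesgue"
    by measurable
  note meas = this
  show "has_bochner_integral lebesgue (\<lambda>s. of_real (exp (- e * \<bar>s\<bar>)) * exp (\<i> * of_real (s * v))) (of_real (2 * poisson e v))"
  proof (subst has_bochner_integral_cong_AE)
    show "AE s in lebesgue. of_real (exp (- e * \<bar>s\<bar>)) * exp (\<i> * of_real (s * v)) = ?p s + ?q s"
      using AE_lebesgue_neq[of 0] by eventually_elim (rule PE[symmetric])
  qed (use P meas borel_measurable_has_bochner_integral[OF P] in auto)
  show "has_bochner_integral lebesgue (\<lambda>s. of_real (sgn s * exp (- e * \<bar>s\<bar>)) * exp (\<i> * of_real (s * v))) (\<i> * of_real (2 * v / (e\<^sup>2 + v\<^sup>2)))"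
  proof (subst has_bochner_integral_cong_AE)
    show "AE s in lebesgue. of_real (sgn s * exp (- e * \<bar>s\<bar>)) * exp (\<i> * of_real (s * v)) = ?p s - ?q s"
      using AE_lebesgue_neq[of 0] by eventually_elim (rule QE[symmetric])
  qed (use Q meas borel_measurable_has_bochner_integral[OF Q] in auto)
qed

lemma has_bochner_integral_poisson:
  assumes e: "e > 0"
  shows "has_bochner_integral lebesgue (\<lambda>t. poisson e (t - s)) pi"
proof -
  note [measurable del] = borel_measurable_ident_lebesgue
  have nz: "e\<^sup>2 + (x - s)\<^sup>2 \<noteq> 0" for x using e by (simp add: sum_power2_eq_zero_iff)
  have 1: "set_integrable lborel (einterval (-\<infinity>) \<infinity>) (\<lambda>t. poisson e (t - s))"
    and 2: "(LBINT t=-\<infinity>..\<infinity>. poisson e (t - s)) = pi/2 - (- (pi/2))"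
  proof -
    note * = interval_integral_FTC_nonneg[where F="\<lambda>t. arctan ((t - s) / e)" and f="\<lambda>t. poisson e (t - s)" and a="-\<infinity>" and b="\<infinity>" and A="-(pi/2)" and B="pi/2", unfolded ereal_tendsto_simps]
    have a: "((\<lambda>t. arctan ((t - s) / e)) has_real_derivative poisson e (x - s)) (at x)" for x
      using e nz[of x] unfolding poisson_def by (auto intro!: derivative_eq_intros simp: field_simps power2_eq_square)
    have b: "isCont (\<lambda>t. poisson e (t - s)) x" for x unfolding poisson_def using nz[of x] by (intro continuous_intros) auto
    have c: "AE x in lborel. - \<infinity> < ereal x \<longrightarrow> ereal x < \<infinity> \<longrightarrow> 0 \<le> poisson e (x - s)"
      using e by (auto simp: poisson_def)
    have d: "((\<lambda>t. arctan ((t - s) / e)) \<longlongrightarrow> - (pi/2)) at_bot" using e by real_asymp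
    have f: "((\<lambda>t. arctan ((t - s) / e)) \<longlongrightarrow> pi/2) at_top" using e by real_asymp
    show "set_integrable lborel (einterval (-\<infinity>) \<infinity>) (\<lambda>t. poisson e (t - s))"
      by (rule *(1)) (use a b c d f in auto)
    show "(LBINT t=-\<infinity>..\<infinity>. poisson e (t - s)) = pi/2 - (- (pi/2))"
      by (rule *(2)) (use a b c d f in auto)
  qed

  have [simp]: "einterval (-\<infinity>) \<infinity> = UNIV" by (auto simp: einterval_def)
  have "has_bochner_integral lborel (\<lambda>t. poisson e (t - s)) pi"
    using 1 2 by (auto simp: has_bochner_integral_iff interval_lebesgue_integral_def set_integrable_def set_lebesgue_integral_def)
  moreover have "(\<lambda>t. poisson e (t - s)) \<in> borel_measurable lborel" unfolding poisson_def by measurable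
  ultimately show ?thesis
    unfolding has_bochner_integral_iff by (simp add: integrable_completion integral_completion)
qed

section \<open>The Fourier transform on square-integrable functions\<close>

definition trunc :: "real \<Rightarrow> (real \<Rightarrow> complex) \<Rightarrow> real \<Rightarrow> complex" where
  "trunc R h t = indicator {-R..R} t *\<^sub>R h t"

lemma integral_cnj_eq: "(LINT x|M. cnj (f x)) = cnj (LINT x|M. f x)"
proof (cases "integrable M f")
  case True
  then show ?thesis by (rule integral_bounded_linear[OF bounded_linear_cnj])
next
  case False
  then have "\<not> integrable M (\<lambda>x. cnj (f x))"
    using integrable_bounded_linear[OF bounded_linear_cnj, of M "\<lambda>x. cnj (f x)"] by auto
  with False show ?thesis by (simp add: not_integrable_integral_eq)
qed

lemma ft_diff:
  assumes "integrable lebesgue h" "integrable lebesgue k"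
  shows "ft (\<lambda>x. h x - k x) s = ft h s - ft k s"
  unfolding ft_def Bochner_Integration.integral_diff[OF integrable_ft_integrand[OF assms(1)] integrable_ft_integrand[OF assms(2)], symmetric]
  by (simp only: left_diff_distrib)

lemma ft_add:
  assumes "integrable lebesgue h" "integrable lebesgue k"
  shows "ft (\<lambda>x. h x + k x) s = ft h s + ft k s"
  unfolding ft_def Bochner_Integration.integral_add[OF integrable_ft_integrand[OF assms(1)] integrable_ft_integrand[OF assms(2)], symmetric]
  by (simp only: distrib_right)

lemma ft_cmult: "ft (\<lambda>x. c * h x) s = c * ft h s"
  unfolding ft_def by (subst integral_mult_right_zero[symmetric]) (simp add: mult_ac)

lemma ft_abel:
  assumes "e > 0"
  shows "ft (\<lambda>s. of_real (exp (- e * \<bar>s\<bar>)) * exp (\<i> * of_real (s * - t))) t' = of_real (2 * poisson e (t' - t))"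
proof -
  have "exp (\<i> * of_real (s * - t)) * exp (\<i> * of_real (t' * s)) = exp (\<i> * of_real (s * (t' - t)))" for s
    unfolding mult_exp_exp by (simp add: algebra_simps)
  then show ?thesis
    unfolding ft_def using has_bochner_integral_integral_eq[OF abel_kernel_even[OF assms, of "t' - t"]]
    by (simp add: mult.assoc)
qed

lemma integrable_abel:
  assumes "e > 0"
  shows "integrable lebesgue (\<lambda>s. complex_of_real (exp (- e * \<bar>s\<bar>)) * exp (\<i> * of_real (s * t)))"
  using abel_kernel_even[OF assms] by (auto simp: has_bochner_integral_iff)

lemma poisson_nonneg: "e > 0 \<Longrightarrow> 0 \<le> poisson e v" by (simp add: poisson_def)

lemma poisson_le: "e > 0 \<Longrightarrow> poisson e v \<le> 1 / e"
  by (simp add: poisson_def power2_eq_square divide_simps add_pos_nonneg)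

lemma poisson_commute: "poisson e (a - b) = poisson e (b - a)"
  by (simp add: poisson_def power2_commute)

lemma borel_measurable_poisson [measurable]:
  "f \<in> borel_measurable M \<Longrightarrow> (\<lambda>x. poisson e (f x)) \<in> borel_measurable M"
  unfolding poisson_def
  supply [measurable del] = borel_measurable_ident_lebesgue by measurable

lemma nn_integral_poisson:
  assumes "e > 0" shows "(\<integral>\<^sup>+t. ennreal (poisson e (t - s)) \<partial>lebesgue) = ennreal pi"
  using has_bochner_integral_poisson[OF assms, of s] poisson_nonneg[OF assms]
  by (subst nn_integral_eq_integral) (auto simp: has_bochner_integral_iff)

text \<open>Schur's test for the symmetric kernel: \<open>2 |h t| |h t'| \<le> |h t|\<^sup>2 + |h t'|\<^sup>2\<close>, and each of the two
  resulting integrals reduces to the mass \<open>\<pi>\<close> of the Poisson kernel.\<close>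

lemma poisson_schur:
  assumes [measurable]: "h \<in> borel_measurable lebesgue" and e: "e > 0"
  shows "(\<integral>\<^sup>+t. \<integral>\<^sup>+t'. ennreal (cmod (h t) * cmod (h t') * (2 * poisson e (t' - t))) \<partial>lebesgue \<partial>lebesgue) \<le> ennreal (2 * pi) * N2 h"
proof -
  let ?P = "\<lambda>t t'. ennreal ((cmod (h t))\<^sup>2 * poisson e (t' - t))"
  have p1: "(\<integral>\<^sup>+t. \<integral>\<^sup>+t'. ?P t t' \<partial>lebesgue \<partial>lebesgue) = ennreal pi * N2 h"
    using poisson_nonneg[OF e]
    by (simp add: ennreal_mult nn_integral_cmult nn_integral_poisson[OF e] nn_integral_multc N2_def mult.commute)
  have [measurable]: "case_prod ?P \<in> borel_measurable (lebesgue \<Otimes>\<^sub>M lebesgue)" by measurable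
  have "(\<integral>\<^sup>+t. \<integral>\<^sup>+t'. ?P t' t \<partial>lebesgue \<partial>lebesgue) = (\<integral>\<^sup>+t'. \<integral>\<^sup>+t. ?P t' t \<partial>lebesgue \<partial>lebesgue)"
    by (rule lebesgue_pair.Fubini') measurable
  then have p2: "(\<integral>\<^sup>+t. \<integral>\<^sup>+t'. ?P t' t \<partial>lebesgue \<partial>lebesgue) = ennreal pi * N2 h" using p1 by simp
  have le: "cmod a * cmod b * (2 * poisson e v) \<le> (cmod a)\<^sup>2 * poisson e v + (cmod b)\<^sup>2 * poisson e v" for a b v
    using mult_right_mono[OF sum_squares_bound[of "cmod a" "cmod b"] poisson_nonneg[OF e, of v]] by (simp add: algebra_simps)
  have "(\<integral>\<^sup>+t. \<integral>\<^sup>+t'. ennreal (cmod (h t) * cmod (h t') * (2 * poisson e (t' - t))) \<partial>lebesgue \<partial>lebesgue)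
      \<le> (\<integral>\<^sup>+t. \<integral>\<^sup>+t'. ?P t t' + ?P t' t \<partial>lebesgue \<partial>lebesgue)"
    using le poisson_nonneg[OF e] by (intro nn_integral_mono) (simp add: ennreal_plus[symmetric] poisson_commute ennreal_leI del: ennreal_plus)
  also have "\<dots> = (\<integral>\<^sup>+t. (\<integral>\<^sup>+t'. ?P t t' \<partial>lebesgue) + (\<integral>\<^sup>+t'. ?P t' t \<partial>lebesgue) \<partial>lebesgue)"
    by (intro nn_integral_cong nn_integral_add) measurable
  also have "\<dots> = (\<integral>\<^sup>+t. \<integral>\<^sup>+t'. ?P t t' \<partial>lebesgue \<partial>lebesgue) + (\<integral>\<^sup>+t. \<integral>\<^sup>+t'. ?P t' t \<partial>lebesgue \<partial>lebesgue)"
    by (intro nn_integral_add) measurable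
  also have "\<dots> = ennreal (2 * pi) * N2 h"
  proof -
    have "ennreal (2 * pi) = ennreal pi + ennreal pi" by (subst ennreal_plus[symmetric]) auto
    then show ?thesis unfolding p1 p2 by (simp only: distrib_right)
  qed
  finally show ?thesis .
qed

text \<open>The inequality half of Plancherel's theorem. With the weight \<open>exp (-e |s|)\<close> the integral of
  \<open>|ft h|\<^sup>2\<close> becomes the quadratic form of \<open>h\<close> with the Poisson kernel, which Schur's test bounds
  uniformly in \<open>e\<close>; Fatou's lemma removes the weight.\<close>

lemma N2_ft_le:
  assumes h: "integrable lebesgue h"
  shows "N2 (ft h) \<le> ennreal (2 * pi) * N2 h"
proof -
  have [measurable]: "h \<in> borel_measurable lebesgue" using h by auto
  have bound: "(\<integral>\<^sup>+s. ennreal (exp (- e * \<bar>s\<bar>) * (cmod (ft h s))\<^sup>2) \<partial>lebesgue) \<le> ennreal (2 * pi) * N2 h" if e: "e > 0" for e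
  proof -
    \<comment> \<open>The weighted integral of \<open>|ft h|\<^sup>2\<close> is the pairing of \<open>ft h\<close> with \<open>a\<close>; the multiplication formula turns it
      into the pairing of \<open>h\<close> with \<open>ft a\<close>, and, used once more with \<open>b t\<close>, it evaluates \<open>ft a\<close>.\<close>
    define b where "b t s = of_real (exp (- e * \<bar>s\<bar>)) * exp (\<i> * of_real (s * - t))" for t s
    define a where "a s = of_real (exp (- e * \<bar>s\<bar>)) * cnj (ft h s)" for s
    have bi: "integrable lebesgue (b t)" for t unfolding b_def by (rule integrable_abel[OF e])
    have cm[measurable]: "(\<lambda>s. cnj (ft h s)) \<in> borel_measurable lebesgue"
      using borel_measurable_continuous_onI[OF continuous_on_cnj[OF continuous_on_id], THEN measurable_compose[rotated], OF borel_measurable_ft[of h]] by simp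
    have ai: "integrable lebesgue a" unfolding a_def
      using integrable_abel[OF e, of 0] norm_ft_le[OF h] by (intro integrable_mult_bounded) auto
    have fta: "ft a t = cnj (LINT t'|lebesgue. h t' * of_real (2 * poisson e (t' - t)))" for t
    proof -
      have "a s * exp (\<i> * of_real (t * s)) = cnj (ft h s * b t s)" for s
        by (simp add: a_def b_def exp_cnj mult_ac)
      then have "ft a t = cnj (LINT s|lebesgue. ft h s * b t s)" unfolding ft_def[of a] by (simp only: integral_cnj_eq)
      also have "(LINT s|lebesgue. ft h s * b t s) = (LINT t'|lebesgue. h t' * ft (b t) t')"
        by (rule ft_multiplication_formula[OF h bi])
      finally show ?thesis unfolding b_def ft_abel[OF e] .
    qed
    have "(\<integral>\<^sup>+s. ennreal (exp (- e * \<bar>s\<bar>) * (cmod (ft h s))\<^sup>2) \<partial>lebesgue) = (\<integral>\<^sup>+s. ennreal (cmod (ft h s * a s)) \<partial>lebesgue)"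
      by (intro nn_integral_cong) (simp add: a_def norm_mult power2_eq_square mult_ac)
    also have "\<dots> = ennreal (LINT s|lebesgue. cmod (ft h s * a s))"
      using integrable_mult_bounded[OF ai borel_measurable_ft[of h] norm_ft_le[OF h]]
      by (intro nn_integral_eq_integral) (auto simp: mult.commute)
    also have "(LINT s|lebesgue. cmod (ft h s * a s)) = cmod (LINT s|lebesgue. ft h s * a s)"
    proof -
      have "ft h s * a s = of_real (cmod (ft h s * a s))" for s
        by (simp add: a_def norm_mult mult.left_commute[of "ft h s"] complex_norm_square[symmetric] power2_eq_square flip: of_real_mult)
      then have "(LINT s|lebesgue. ft h s * a s) = of_real (LINT s|lebesgue. cmod (ft h s * a s))"
        by (metis (no_types, lifting) Bochner_Integration.integral_cong integral_complex_of_real)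
      then show ?thesis by (simp add: integral_nonneg_AE)
    qed
    also have "(LINT s|lebesgue. ft h s * a s) = (LINT t|lebesgue. h t * ft a t)"
      by (rule ft_multiplication_formula[OF h ai])
    also have "ennreal (cmod \<dots>) \<le> (\<integral>\<^sup>+t. ennreal (cmod (h t * ft a t)) \<partial>lebesgue)"
      by (rule integral_norm_bound_ennreal, rule integrable_mult_bounded[OF h _ norm_ft_le[OF ai]]) (use ai in auto)
    also have "\<dots> \<le> (\<integral>\<^sup>+t. \<integral>\<^sup>+t'. ennreal (cmod (h t) * cmod (h t') * (2 * poisson e (t' - t))) \<partial>lebesgue \<partial>lebesgue)"
    proof (rule nn_integral_mono)
      fix t
      have "ennreal (cmod (h t * ft a t)) = ennreal (cmod (h t)) * ennreal (cmod (LINT t'|lebesgue. h t' * of_real (2 * poisson e (t' - t))))"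
        by (simp add: fta norm_mult ennreal_mult)
      also have "\<dots> \<le> ennreal (cmod (h t)) * (\<integral>\<^sup>+t'. ennreal (cmod (h t' * of_real (2 * poisson e (t' - t)))) \<partial>lebesgue)"
      proof (intro mult_left_mono integral_norm_bound_ennreal integrable_mult_bounded[OF h, where C="2/e"])
        show "cmod (complex_of_real (2 * poisson e (t' - t))) \<le> 2 / e" for t'
          using poisson_le[OF e, of "t' - t"] poisson_nonneg[OF e, of "t' - t"] unfolding norm_of_real by simp
      qed auto
      also have "\<dots> = (\<integral>\<^sup>+t'. ennreal (cmod (h t) * cmod (h t') * (2 * poisson e (t' - t))) \<partial>lebesgue)"
        using poisson_nonneg[OF e]
        by (subst nn_integral_cmult[symmetric]) (auto simp: norm_mult ennreal_mult[symmetric] mult.assoc)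
      finally show "ennreal (cmod (h t * ft a t)) \<le> (\<integral>\<^sup>+t'. ennreal (cmod (h t) * cmod (h t') * (2 * poisson e (t' - t))) \<partial>lebesgue)" .
    qed
    also have "\<dots> \<le> ennreal (2 * pi) * N2 h" by (rule poisson_schur[OF _ e]) measurable
    finally show ?thesis .
  qed
  show ?thesis
  proof (rule N2_le_of_tendsto[where f="\<lambda>k s. of_real (sqrt (exp (- (1 / real (Suc k)) * \<bar>s\<bar>))) * ft h s"])
    show "AE s in lebesgue. (\<lambda>k. of_real (sqrt (exp (- (1 / real (Suc k)) * \<bar>s\<bar>))) * ft h s) \<longlonglongrightarrow> ft h s"
    proof (rule AE_I2)
      fix s
      have "(\<lambda>k. sqrt (exp (- (1 / real (Suc k)) * \<bar>s\<bar>))) \<longlonglongrightarrow> sqrt (exp (- 0 * \<bar>s\<bar>))"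
        by (intro tendsto_intros LIMSEQ_Suc[OF lim_1_over_n])
      then have "(\<lambda>k. of_real (sqrt (exp (- (1 / real (Suc k)) * \<bar>s\<bar>))) * ft h s) \<longlonglongrightarrow> of_real (sqrt (exp (- 0 * \<bar>s\<bar>))) * ft h s"
        by (intro tendsto_mult tendsto_of_real tendsto_const)
      then show "(\<lambda>k. of_real (sqrt (exp (- (1 / real (Suc k)) * \<bar>s\<bar>))) * ft h s) \<longlonglongrightarrow> ft h s" by simp
    qed
    show "\<forall>\<^sub>F k in sequentially. N2 (\<lambda>s. of_real (sqrt (exp (- (1 / real (Suc k)) * \<bar>s\<bar>))) * ft h s) \<le> ennreal (2 * pi) * N2 h"
      using bound[of "1 / real (Suc k)" for k]
      by (intro always_eventually allI) (simp add: N2_def norm_mult power_mult_distrib)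
  qed measurable
qed

lemma trunc_measurable [measurable]: "h \<in> borel_measurable lebesgue \<Longrightarrow> trunc R h \<in> borel_measurable lebesgue"
  unfolding trunc_def[abs_def] by measurable

lemma L2_trunc:
  assumes h: "h \<in> L2 UNIV" shows "trunc R h \<in> L2 UNIV"
  by (rule L2_dominated[OF h trunc_measurable[OF L2_measurable[OF h]]]) (simp add: trunc_def indicator_def)

lemma L2_indicator: "(\<lambda>t. complex_of_real (indicator {a..b} t)) \<in> L2 UNIV"
proof -
  have "(\<integral>\<^sup>+t. ennreal ((cmod (complex_of_real (indicator {a..b} t)))\<^sup>2) \<partial>lebesgue) = (\<integral>\<^sup>+t. indicator {a..b} t \<partial>lebesgue)"
  proof (rule nn_integral_cong)
    show "ennreal ((cmod (complex_of_real (indicator {a..b} t)))\<^sup>2) = indicator {a..b} t" for t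
      by (cases "t \<in> {a..b}") auto
  qed
  then show ?thesis by (auto simp: L2_UNIV_iff N2_def emeasure_lborel_Icc_eq)
qed

lemma integrable_trunc: "h \<in> L2 UNIV \<Longrightarrow> integrable lebesgue (trunc R h)"
  using L2_integrable_mult[OF L2_indicator[of "-R" R], of h] by (simp add: trunc_def[abs_def] scaleR_conv_of_real)

lemma is_L2_fourier_iff:
  "is_L2_fourier h u \<longleftrightarrow> u \<in> L2 UNIV \<and> ((\<lambda>R. N2 (\<lambda>s. u s - ft (trunc R h) s)) \<longlongrightarrow> 0) at_top"
  unfolding is_L2_fourier_def N2_def ft_def trunc_def set_lebesgue_integral_def by simp

lemma N2_mono: "(\<And>x. cmod (f x) \<le> cmod (g x)) \<Longrightarrow> N2 f \<le> N2 g"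
  unfolding N2_def by (intro nn_integral_mono ennreal_leI power_mono) auto

lemma N2_dominated_tendsto:
  assumes h: "h \<in> L2 UNIV" and [measurable]: "\<And>n. f n \<in> borel_measurable lebesgue"
    and b: "\<And>n x. cmod (f n x) \<le> cmod (h x)" and lim: "AE x in lebesgue. (\<lambda>n. f n x) \<longlonglongrightarrow> 0"
  shows "(\<lambda>n. N2 (f n)) \<longlonglongrightarrow> 0"
proof -
  have [measurable]: "h \<in> borel_measurable lebesgue" using h L2_measurable by auto
  have "(\<lambda>n. \<integral>\<^sup>+x. ennreal ((cmod (f n x))\<^sup>2) \<partial>lebesgue) \<longlonglongrightarrow> (\<integral>\<^sup>+x. 0 \<partial>(lebesgue::real measure))"
  proof (rule nn_integral_dominated_convergence[where w="\<lambda>x. ennreal ((cmod (h x))\<^sup>2)"])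
    show "AE x in lebesgue. (\<lambda>n. ennreal ((cmod (f n x))\<^sup>2)) \<longlonglongrightarrow> 0"
      using lim
    proof eventually_elim
      case (elim x)
      have "(\<lambda>n. ennreal ((cmod (f n x))\<^sup>2)) \<longlonglongrightarrow> ennreal ((cmod 0)\<^sup>2)"
        by (intro tendsto_ennrealI tendsto_power tendsto_norm elim)
      then show ?case by simp
    qed
  qed (use h b in \<open>auto simp: L2_UNIV_iff N2_def intro!: ennreal_leI power_mono AE_I2\<close>)
  then show ?thesis by (simp add: N2_def)
qed

lemma N2_tail_tendsto:
  assumes h: "h \<in> L2 UNIV"
  shows "((\<lambda>R. N2 (\<lambda>x. h x - trunc R h x)) \<longlongrightarrow> 0) at_top"
proof (rule tendsto_0_ennrealI)
  fix e :: real assume e: "e > 0"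
  have [measurable]: "h \<in> borel_measurable lebesgue" using h L2_measurable by auto
  have "(\<lambda>n. N2 (\<lambda>x. h x - trunc (real n) h x)) \<longlonglongrightarrow> 0"
  proof (rule N2_dominated_tendsto[OF h])
    show "AE x in lebesgue. (\<lambda>n. h x - trunc (real n) h x) \<longlonglongrightarrow> 0"
    proof (rule AE_I2)
      fix x
      have "\<forall>\<^sub>F n in sequentially. h x - trunc (real n) h x = 0"
        using eventually_ge_at_top[of "nat \<lceil>\<bar>x\<bar>\<rceil>"]
      proof eventually_elim
        case (elim n)
        then have "\<bar>x\<bar> \<le> real n" by linarith
        then show ?case by (simp add: trunc_def indicator_def abs_le_iff)
      qed
      then show "(\<lambda>n. h x - trunc (real n) h x) \<longlonglongrightarrow> 0" by (rule tendsto_eventually)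
    qed
  qed (auto simp: trunc_def indicator_def)
  then have "\<forall>\<^sub>F n in sequentially. N2 (\<lambda>x. h x - trunc (real n) h x) < ennreal e"
    using e by (intro order_tendstoD) auto
  then obtain n where n: "N2 (\<lambda>x. h x - trunc (real n) h x) < ennreal e" by (auto simp: eventually_sequentially)
  show "\<forall>\<^sub>F R in at_top. N2 (\<lambda>x. h x - trunc R h x) \<le> ennreal e"
    using eventually_ge_at_top[of "real n"]
  proof eventually_elim
    case (elim R)
    have "N2 (\<lambda>x. h x - trunc R h x) \<le> N2 (\<lambda>x. h x - trunc (real n) h x)"
      using elim by (intro N2_mono) (auto simp: trunc_def indicator_def)
    then show ?case using n by simp
  qed
qed

lemma N2_ft_trunc_diff_le:
  assumes h: "h \<in> L2 UNIV" and "T \<le> R" "T \<le> R'"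
  shows "N2 (\<lambda>s. ft (trunc R h) s - ft (trunc R' h) s) \<le> ennreal (2 * pi) * N2 (\<lambda>x. h x - trunc T h x)"
proof -
  have "N2 (\<lambda>s. ft (trunc R h) s - ft (trunc R' h) s) = N2 (ft (\<lambda>x. trunc R h x - trunc R' h x))"
    by (intro arg_cong[of _ _ N2] ext ft_diff[symmetric] integrable_trunc h)
  also have "\<dots> \<le> ennreal (2 * pi) * N2 (\<lambda>x. trunc R h x - trunc R' h x)"
    using h by (intro N2_ft_le Bochner_Integration.integrable_diff integrable_trunc)
  also have "\<dots> \<le> ennreal (2 * pi) * N2 (\<lambda>x. h x - trunc T h x)"
    using assms by (intro mult_left_mono N2_mono) (auto simp: trunc_def indicator_def)
  finally show ?thesis .
qed

text \<open>The transforms of the truncations form a Cauchy family by the bound on \<open>N2 (ft h)\<close>, so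
  completeness provides the limit.\<close>

lemma is_L2_fourier_exists:
  assumes h: "h \<in> L2 UNIV"
  obtains u where "is_L2_fourier h u"
proof -
  have [measurable]: "h \<in> borel_measurable lebesgue" using h L2_measurable by auto
  have tail: "\<exists>M. \<forall>R\<ge>M. \<forall>R'\<ge>M. N2 (\<lambda>s. ft (trunc R h) s - ft (trunc R' h) s) \<le> ennreal e" if "e > 0" for e :: real
  proof -
    have "((\<lambda>R. ennreal (2 * pi) * N2 (\<lambda>x. h x - trunc R h x)) \<longlongrightarrow> ennreal (2 * pi) * 0) at_top"
      by (intro tendsto_mult_ennreal tendsto_const N2_tail_tendsto[OF h]) auto
    then have "\<forall>\<^sub>F R in at_top. ennreal (2 * pi) * N2 (\<lambda>x. h x - trunc R h x) < ennreal e"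
      using that by (intro order_tendstoD) auto
    then obtain M where "ennreal (2 * pi) * N2 (\<lambda>x. h x - trunc M h x) < ennreal e"
      by (auto simp: eventually_at_top_linorder)
    then show ?thesis using N2_ft_trunc_diff_le[OF h, of M] by (meson order.strict_implies_order order_trans)
  qed
  have L2ft: "ft (trunc R h) \<in> L2 UNIV" for R
    using N2_ft_le[OF integrable_trunc[OF h], of R] L2_trunc[OF h, of R]
    by (auto simp: L2_UNIV_iff ennreal_mult_less_top intro: order_le_less_trans)
  obtain v where v: "v \<in> L2 UNIV" "(\<lambda>n. N2 (\<lambda>x. ft (trunc (real n) h) x - v x)) \<longlonglongrightarrow> 0"
  proof (rule L2_complete[of "\<lambda>n. ft (trunc (real n) h)"])
    fix e :: real assume "e > 0"
    from tail[OF this] obtain M where M: "\<forall>R\<ge>M. \<forall>R'\<ge>M. N2 (\<lambda>s. ft (trunc R h) s - ft (trunc R' h) s) \<le> ennreal e" by blast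
    have "real n \<ge> M" if "n \<ge> nat \<lceil>M\<rceil>" for n using that by linarith
    then show "\<exists>N. \<forall>m\<ge>N. \<forall>n\<ge>N. N2 (\<lambda>x. ft (trunc (real m) h) x - ft (trunc (real n) h) x) \<le> ennreal e"
      using M by blast
  qed (use L2ft in auto)
  have [measurable]: "v \<in> borel_measurable lebesgue" using v L2_measurable by auto
  have "((\<lambda>R. N2 (\<lambda>s. v s - ft (trunc R h) s)) \<longlongrightarrow> 0) at_top"
  proof (rule tendsto_0_ennrealI)
    fix e :: real assume e: "e > 0"
    from tail[of "e/4"] e obtain M where M: "\<forall>R\<ge>M. \<forall>R'\<ge>M. N2 (\<lambda>s. ft (trunc R h) s - ft (trunc R' h) s) \<le> ennreal (e/4)" by auto
    have "\<forall>\<^sub>F n in sequentially. N2 (\<lambda>x. ft (trunc (real n) h) x - v x) < ennreal (e/4)"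
      using e by (intro order_tendstoD[OF v(2)]) auto
    moreover have "\<forall>\<^sub>F n in sequentially. real n \<ge> M"
      using eventually_ge_at_top[of "nat \<lceil>M\<rceil>"] by eventually_elim linarith
    ultimately have "\<forall>\<^sub>F n in sequentially. N2 (\<lambda>x. ft (trunc (real n) h) x - v x) < ennreal (e/4) \<and> real n \<ge> M" by eventually_elim auto
    then obtain n where n: "N2 (\<lambda>x. ft (trunc (real n) h) x - v x) < ennreal (e/4)" "real n \<ge> M"
      by (auto simp: eventually_sequentially)
    show "\<forall>\<^sub>F R in at_top. N2 (\<lambda>s. v s - ft (trunc R h) s) \<le> ennreal e"
      using eventually_ge_at_top[of M]
    proof eventually_elim
      case (elim R)
      have "N2 (\<lambda>s. v s - ft (trunc R h) s) \<le> 2 * N2 (\<lambda>s. v s - ft (trunc (real n) h) s) + 2 * N2 (\<lambda>s. ft (trunc (real n) h) s - ft (trunc R h) s)"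
        by (rule N2_triangle) measurable
      also have "\<dots> \<le> 2 * ennreal (e/4) + 2 * ennreal (e/4)"
        using n M elim by (intro add_mono mult_left_mono) (auto simp: N2_diff_commute[of v])
      also have "\<dots> = ennreal e" using e by (simp add: ennreal_plus[symmetric] ennreal_mult'[symmetric] flip: ennreal_numeral del: ennreal_plus)
      finally show ?case .
    qed
  qed
  then show ?thesis using that v by (auto simp: is_L2_fourier_iff)
qed

lemma L2_fourier:
  assumes "h \<in> L2 UNIV" shows "is_L2_fourier h (L2_fourier h)"
proof -
  obtain u where "is_L2_fourier h u" using is_L2_fourier_exists[OF assms] .
  then show ?thesis unfolding L2_fourier_def by (rule someI[of "is_L2_fourier h"])
qed

lemma is_L2_fourier_L2: "is_L2_fourier h u \<Longrightarrow> u \<in> L2 UNIV" by (simp add: is_L2_fourier_iff)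

lemma N2_eq_0_iff: "f \<in> borel_measurable lebesgue \<Longrightarrow> N2 f = 0 \<longleftrightarrow> (AE x in lebesgue. f x = 0)"
  unfolding N2_def by (subst nn_integral_0_iff_AE) auto

lemma is_L2_fourier_add:
  assumes "h \<in> L2 UNIV" "k \<in> L2 UNIV" "is_L2_fourier h u" "is_L2_fourier k v"
  shows "is_L2_fourier (\<lambda>x. h x + k x) (\<lambda>x. u x + v x)"
  unfolding is_L2_fourier_iff
proof
  have L: "u \<in> L2 UNIV" "v \<in> L2 UNIV" using assms by (auto intro: is_L2_fourier_L2)
  show "(\<lambda>x. u x + v x) \<in> L2 UNIV" by (intro L2_add L)
  have [measurable]: "u \<in> borel_measurable lebesgue" "v \<in> borel_measurable lebesgue"
    "h \<in> borel_measurable lebesgue" "k \<in> borel_measurable lebesgue" using assms L L2_measurable by auto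
  have eq: "(\<lambda>s. u s + v s - ft (trunc R (\<lambda>x. h x + k x)) s) = (\<lambda>s. (u s - ft (trunc R h) s) + (v s - ft (trunc R k) s))" for R
  proof
    fix s
    have "trunc R (\<lambda>x. h x + k x) = (\<lambda>x. trunc R h x + trunc R k x)" by (auto simp: trunc_def scaleR_add_right)
    then show "u s + v s - ft (trunc R (\<lambda>x. h x + k x)) s = (u s - ft (trunc R h) s) + (v s - ft (trunc R k) s)"
      using ft_add[OF integrable_trunc[OF assms(1)] integrable_trunc[OF assms(2)]] by simp
  qed
  have l: "((\<lambda>R. 2 * N2 (\<lambda>s. u s - ft (trunc R h) s) + 2 * N2 (\<lambda>s. v s - ft (trunc R k) s)) \<longlongrightarrow> 2 * 0 + 2 * 0) at_top"
    using assms unfolding is_L2_fourier_iff by (intro tendsto_add tendsto_mult_ennreal tendsto_const) auto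
  show "((\<lambda>R. N2 (\<lambda>s. u s + v s - ft (trunc R (\<lambda>x. h x + k x)) s)) \<longlongrightarrow> 0) at_top"
    unfolding eq
    by (rule tendsto_sandwich[OF _ _ tendsto_const l[simplified]], simp, rule always_eventually, rule allI, rule N2_add_le) measurable
qed

lemma N2_cmult: "f \<in> borel_measurable lebesgue \<Longrightarrow> N2 (\<lambda>x. c * f x) = ennreal ((cmod c)\<^sup>2) * N2 f"
  unfolding N2_def by (subst nn_integral_cmult[symmetric]) (auto simp: norm_mult power_mult_distrib ennreal_mult)

lemma is_L2_fourier_cmult:
  assumes "h \<in> L2 UNIV" "is_L2_fourier h u"
  shows "is_L2_fourier (\<lambda>x. c * h x) (\<lambda>x. c * u x)"
  unfolding is_L2_fourier_iff
proof
  have L: "u \<in> L2 UNIV" using assms by (auto intro: is_L2_fourier_L2)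
  then show "(\<lambda>x. c * u x) \<in> L2 UNIV" by (intro L2_cmult)
  have [measurable]: "u \<in> borel_measurable lebesgue" "h \<in> borel_measurable lebesgue" using assms L L2_measurable by auto
  have "trunc R (\<lambda>x. c * h x) = (\<lambda>x. c * trunc R h x)" for R by (auto simp: trunc_def)
  then have eq: "N2 (\<lambda>s. c * u s - ft (trunc R (\<lambda>x. c * h x)) s) = ennreal ((cmod c)\<^sup>2) * N2 (\<lambda>s. u s - ft (trunc R h) s)" for R
    by (subst N2_cmult[symmetric]) (auto simp: ft_cmult algebra_simps)
  have "((\<lambda>R. ennreal ((cmod c)\<^sup>2) * N2 (\<lambda>s. u s - ft (trunc R h) s)) \<longlongrightarrow> ennreal ((cmod c)\<^sup>2) * 0) at_top"
    using assms unfolding is_L2_fourier_iff by (intro tendsto_mult_ennreal tendsto_const) auto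
  then show "((\<lambda>R. N2 (\<lambda>s. c * u s - ft (trunc R (\<lambda>x. c * h x)) s)) \<longlongrightarrow> 0) at_top"
    unfolding eq by simp
qed

lemma is_L2_fourier_diff:
  assumes "h \<in> L2 UNIV" "k \<in> L2 UNIV" "is_L2_fourier h u" "is_L2_fourier k v"
  shows "is_L2_fourier (\<lambda>x. h x - k x) (\<lambda>x. u x - v x)"
  using is_L2_fourier_add[OF assms(1) L2_cmult[OF assms(2), of "-1"] assms(3) is_L2_fourier_cmult[OF assms(2,4), of "-1"]] by simp

text \<open>The bound for truncations passes to the limit. The constant is twice the sharp one, from
  \<open>(a + b)\<^sup>2 \<le> 2 a\<^sup>2 + 2 b\<^sup>2\<close>; the estimate serves as continuity of the transform.\<close>

lemma N2_L2_fourier_le: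
  assumes h: "h \<in> L2 UNIV" and u: "is_L2_fourier h u"
  shows "N2 u \<le> ennreal (4 * pi) * N2 h"
proof -
  have [measurable]: "u \<in> borel_measurable lebesgue" "h \<in> borel_measurable lebesgue"
    using h is_L2_fourier_L2[OF u] L2_measurable by auto
  have "((\<lambda>R. 2 * N2 (\<lambda>s. u s - ft (trunc R h) s) + ennreal (4 * pi) * N2 h) \<longlongrightarrow> 2 * 0 + ennreal (4 * pi) * N2 h) at_top"
    using u unfolding is_L2_fourier_iff by (intro tendsto_add tendsto_mult_ennreal tendsto_const) auto
  then have l: "((\<lambda>R. 2 * N2 (\<lambda>s. u s - ft (trunc R h) s) + ennreal (4 * pi) * N2 h) \<longlongrightarrow> ennreal (4 * pi) * N2 h) at_top" by simp
  show ?thesis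
  proof (rule tendsto_lowerbound[OF l])
    show "\<forall>\<^sub>F R in at_top. N2 u \<le> 2 * N2 (\<lambda>s. u s - ft (trunc R h) s) + ennreal (4 * pi) * N2 h"
    proof (rule always_eventually, rule allI)
      fix R
      have "N2 u \<le> 2 * N2 (\<lambda>s. u s - ft (trunc R h) s) + 2 * N2 (ft (trunc R h))"
        using N2_add_le[of "\<lambda>s. u s - ft (trunc R h) s" "ft (trunc R h)"] by simp
      also have "2 * N2 (ft (trunc R h)) \<le> 2 * (ennreal (2 * pi) * N2 h)"
        by (intro mult_left_mono order_trans[OF N2_ft_le[OF integrable_trunc[OF h]]] N2_mono) (auto simp: trunc_def indicator_def)
      also have "2 * (ennreal (2 * pi) * N2 h) = ennreal (4 * pi) * N2 h"
        by (simp add: mult.assoc[symmetric] ennreal_mult'[symmetric] flip: ennreal_numeral)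
      finally show "N2 u \<le> 2 * N2 (\<lambda>s. u s - ft (trunc R h) s) + ennreal (4 * pi) * N2 h" by simp
    qed
  qed simp
qed

lemma is_L2_fourier_cong_AE:
  assumes h: "h \<in> L2 UNIV" and "is_L2_fourier h u" "is_L2_fourier k v" "AE x in lebesgue. h x = k x"
  shows "AE x in lebesgue. u x = v x"
proof -
  have k: "k \<in> L2 UNIV" using L2_cong_AE assms by blast
  have [measurable]: "u \<in> borel_measurable lebesgue" "v \<in> borel_measurable lebesgue"
    using assms is_L2_fourier_L2 L2_measurable by auto
  have "N2 (\<lambda>x. h x - k x) = N2 (\<lambda>x. 0)" by (rule N2_cong_AE) (use assms(4) in auto)
  then have "N2 (\<lambda>x. u x - v x) = 0"
    using N2_L2_fourier_le[OF L2_diff[OF h k] is_L2_fourier_diff[OF h k assms(2,3)]] by (simp add: N2_def)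
  then have "AE x in lebesgue. u x - v x = 0" by (subst (asm) N2_eq_0_iff) measurable
  then show ?thesis by simp
qed

lemma is_L2_fourier_ft:
  assumes "integrable lebesgue h" and h: "h \<in> L2 UNIV"
  shows "is_L2_fourier h (ft h)"
  unfolding is_L2_fourier_iff
proof
  show "ft h \<in> L2 UNIV" using N2_ft_le[OF assms(1)] h
    by (auto simp: L2_UNIV_iff ennreal_mult_less_top intro: order_le_less_trans)
  have l: "((\<lambda>R. ennreal (2 * pi) * N2 (\<lambda>x. h x - trunc R h x)) \<longlongrightarrow> ennreal (2 * pi) * 0) at_top"
    by (intro tendsto_mult_ennreal tendsto_const N2_tail_tendsto[OF h]) auto
  show "((\<lambda>R. N2 (\<lambda>s. ft h s - ft (trunc R h) s)) \<longlongrightarrow> 0) at_top"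
  proof (rule tendsto_sandwich[OF _ _ tendsto_const l[simplified]])
    show "\<forall>\<^sub>F R in at_top. N2 (\<lambda>s. ft h s - ft (trunc R h) s) \<le> ennreal (2 * pi) * N2 (\<lambda>x. h x - trunc R h x)"
      using N2_ft_le[OF Bochner_Integration.integrable_diff[OF assms(1) integrable_trunc[OF h]]]
      by (intro always_eventually allI) (simp add: ft_diff[OF assms(1) integrable_trunc[OF h], abs_def])
  qed simp
qed

text \<open>The multiplication formula for truncations passes to the limit on both sides by continuity of
  the pairing.\<close>

lemma L2_fourier_multiplication_formula:
  assumes h: "h \<in> L2 UNIV" and u: "is_L2_fourier h u" and a: "integrable lebesgue a" "a \<in> L2 UNIV"
  shows "(LINT s|lebesgue. u s * a s) = (LINT t|lebesgue. h t * ft a t)"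
proof (rule tendsto_unique[of at_top])
  have fa: "ft a \<in> L2 UNIV" using is_L2_fourier_ft[OF a] is_L2_fourier_L2 by blast
  show "((\<lambda>R. LINT s|lebesgue. ft (trunc R h) s * a s) \<longlongrightarrow> (LINT s|lebesgue. u s * a s)) at_top"
    using u h a is_L2_fourier_ft[OF integrable_trunc[OF h] L2_trunc[OF h], THEN is_L2_fourier_L2]
    by (intro L2_tendsto_integral_mult) (auto simp: is_L2_fourier_iff N2_diff_commute[of "ft _"])
  have "((\<lambda>R. LINT t|lebesgue. trunc R h t * ft a t) \<longlongrightarrow> (LINT t|lebesgue. h t * ft a t)) at_top"
    using L2_trunc[OF h] N2_tail_tendsto[OF h]
    by (intro L2_tendsto_integral_mult fa h) (auto simp: N2_diff_commute[of "trunc _ _"])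
  then show "((\<lambda>R. LINT s|lebesgue. ft (trunc R h) s * a s) \<longlongrightarrow> (LINT t|lebesgue. h t * ft a t)) at_top"
    by (simp add: ft_multiplication_formula[OF integrable_trunc[OF h] a(1)])
qed simp

section \<open>Lebesgue points and approximate identities\<close>

text \<open>Stated with the unsigned integral over symmetric intervals, which is the form in which the
  layer-cake argument consumes it.\<close>

definition lebesgue_point :: "(real \<Rightarrow> complex) \<Rightarrow> real \<Rightarrow> bool" where
  "lebesgue_point f s \<longleftrightarrow> (\<forall>\<eta>>0. \<exists>\<delta>>0. \<forall>r. 0 < r \<and> r < \<delta> \<longrightarrow>
     (\<integral>\<^sup>+t. ennreal (indicator {s - r..s + r} t * cmod (f t - f s)) \<partial>lebesgue) \<le> ennreal (\<eta> * r))"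

lemma L2_set_integrable:
  assumes f: "f \<in> L2 UNIV"
  shows "set_integrable lebesgue {a..b} (\<lambda>t. cmod (f t - q))"
proof -
  have "integrable lebesgue (\<lambda>t. of_real (indicator {a..b} t) * f t - q * (of_real (indicator {a..b} t) * of_real (indicator {a..b} t)))"
    by (intro Bochner_Integration.integrable_diff integrable_mult_right L2_integrable_mult L2_indicator f)
  from integrable_norm[OF this]
  show ?thesis unfolding set_integrable_def
    by (rule Bochner_Integration.integrable_cong[THEN iffD1, rotated -1]) (auto simp: indicator_def)
qed

text \<open>Differentiation of the indefinite integral of \<open>|f - q|\<close>, to the right. The left-hand version is
  obtained by reflection.\<close>

lemma AE_one_sided:
  assumes f: "f \<in> L2 UNIV"
  shows "AE s in lebesgue. \<forall>e>0. \<exists>d>0. \<forall>h. 0 < h \<and> h < d \<longrightarrow>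
    \<bar>integral {s..s+h} (\<lambda>t. cmod (f t - q)) / h - cmod (f s - q)\<bar> < e"
proof -
  have "(\<lambda>t. cmod (f t - q)) integrable_on cbox a b" for a b
    using set_lebesgue_integral_eq_integral(1)[OF L2_set_integrable[OF f, of a b q]] by simp
  then obtain N where "negligible N" and N: "\<And>x e. x \<notin> N \<Longrightarrow> 0 < e \<Longrightarrow>
      \<exists>d>0. \<forall>h. 0 < h \<and> h < d \<longrightarrow> norm (integral (cbox x (x + h *\<^sub>R One)) (\<lambda>t. cmod (f t - q)) /\<^sub>R h ^ DIM(real) - cmod (f x - q)) < e"
    using integrable_ccontinuous_explicit[of "\<lambda>t. cmod (f t - q)"] by metis
  have "AE s in lebesgue. s \<notin> N"
    using \<open>negligible N\<close> by (simp add: negligible_iff_null_sets AE_not_in)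
  then show ?thesis
  proof eventually_elim
    case (elim s)
    show ?case using N[OF elim] by (simp add: divide_inverse mult.commute)
  qed
qed

lemma AE_lebesgue_iff_negligible: "(AE x in lebesgue. P (x::real)) \<longleftrightarrow> negligible {x. \<not> P x}"
proof
  assume "AE x in lebesgue. P x"
  then obtain N where "N \<in> null_sets lebesgue" "{x. \<not> P x} \<subseteq> N"
    by (auto simp: eventually_ae_filter)
  then show "negligible {x. \<not> P x}" using negligible_subset by (metis negligible_iff_null_sets)
next
  assume "negligible {x. \<not> P x}"
  then show "AE x in lebesgue. P x" by (auto simp: negligible_iff_null_sets intro: AE_I')
qed

lemma AE_lebesgue_reflect:
  assumes "AE x in lebesgue. P (x::real)"
  shows "AE x in lebesgue. P (- x)"
proof -
  have "negligible (uminus ` {x. \<not> P x})"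
    using assms unfolding AE_lebesgue_iff_negligible
    by (intro negligible_differentiable_image_negligible) (auto intro!: differentiable_on_minus differentiable_on_ident)
  moreover have "uminus ` {x. \<not> P x} = {x. \<not> P (- x)}"
    by (auto simp: image_iff) (metis minus_minus)
  ultimately show ?thesis unfolding AE_lebesgue_iff_negligible by simp
qed

lemma L2_reflect: "f \<in> L2 UNIV \<Longrightarrow> (\<lambda>x. f (- x)) \<in> L2 UNIV"
  using lebesgue_integrable_real_affine[of "\<lambda>x. (cmod (f x))\<^sup>2" "-1" 0] borel_measurable_affine[of f "-1" 0]
  unfolding L2_def lebesgue_on_UNIV_eq by auto

text \<open>Differentiation holds simultaneously for all \<open>|f - q|\<close> with \<open>q\<close> in a countable dense set. At
  such a point choose \<open>q\<close> close to \<open>f s\<close>.\<close>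

theorem AE_lebesgue_point:
  assumes f: "f \<in> L2 UNIV"
  shows "AE s in lebesgue. lebesgue_point f s"
proof -
  obtain D :: "complex set" where D: "countable D" "\<And>X. open X \<Longrightarrow> X \<noteq> {} \<Longrightarrow> \<exists>d\<in>D. d \<in> X"
    using countable_dense_setE by blast
  have R: "AE s in lebesgue. \<forall>q\<in>D. \<forall>e>0. \<exists>d>0. \<forall>h. 0 < h \<and> h < d \<longrightarrow>
    \<bar>integral {s..s+h} (\<lambda>t. cmod (f t - q)) / h - cmod (f s - q)\<bar> < e"
    using D(1) AE_one_sided[OF f] by (intro AE_ball_countable') auto
  have "AE s in lebesgue. \<forall>e>0. \<exists>d>0. \<forall>h. 0 < h \<and> h < d \<longrightarrow>
    \<bar>integral {s-h..s} (\<lambda>t. cmod (f t - q)) / h - cmod (f s - q)\<bar> < e" for q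
  proof -
    have "integral {-s..-s+h} (\<lambda>t. cmod (f (- t) - q)) = integral {s-h..s} (\<lambda>t. cmod (f t - q))" for s h
      using Henstock_Kurzweil_Integration.integral_reflect_real[of s "s-h" "\<lambda>t. cmod (f t - q)"] by (simp add: algebra_simps)
    then show ?thesis using AE_lebesgue_reflect[OF AE_one_sided[OF L2_reflect[OF f], of q]] by simp
  qed
  then have L: "AE s in lebesgue. \<forall>q\<in>D. \<forall>e>0. \<exists>d>0. \<forall>h. 0 < h \<and> h < d \<longrightarrow>
    \<bar>integral {s-h..s} (\<lambda>t. cmod (f t - q)) / h - cmod (f s - q)\<bar> < e"
    using D(1) by (intro AE_ball_countable') auto
  from R L show ?thesis
  proof eventually_elim
    case (elim s)
    show ?case unfolding lebesgue_point_def
    proof (intro allI impI)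
      fix \<eta> :: real assume \<eta>: "\<eta> > 0"
      \<comment> \<open>Both one-sided averages of \<open>|f - q|\<close> are then below \<open>\<eta> / 4\<close>; replacing \<open>q\<close> by \<open>f s\<close> costs \<open>\<eta> / 8\<close> on an
        interval of length \<open>2 r\<close>.\<close>
      obtain q where q: "q \<in> D" "cmod (f s - q) < \<eta> / 8"
        using D(2)[of "ball (f s) (\<eta>/8)"] \<eta> by (auto simp: dist_norm)
      obtain d1 where d1: "d1 > 0" "\<And>h. 0 < h \<Longrightarrow> h < d1 \<Longrightarrow> \<bar>integral {s..s+h} (\<lambda>t. cmod (f t - q)) / h - cmod (f s - q)\<bar> < \<eta>/8"
        using elim(1) q(1) \<eta> by (metis divide_pos_pos zero_less_numeral)
      obtain d2 where d2: "d2 > 0" "\<And>h. 0 < h \<Longrightarrow> h < d2 \<Longrightarrow> \<bar>integral {s-h..s} (\<lambda>t. cmod (f t - q)) / h - cmod (f s - q)\<bar> < \<eta>/8"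
        using elim(2) q(1) \<eta> by (metis divide_pos_pos zero_less_numeral)
      show "\<exists>\<delta>>0. \<forall>r. 0 < r \<and> r < \<delta> \<longrightarrow>
         (\<integral>\<^sup>+t. ennreal (indicator {s - r..s + r} t * cmod (f t - f s)) \<partial>lebesgue) \<le> ennreal (\<eta> * r)"
      proof (intro exI[of _ "min d1 d2"] conjI allI impI)
        fix r assume r: "0 < r \<and> r < min d1 d2"
        let ?g = "\<lambda>t. cmod (f t - q)"
        note int = set_lebesgue_integral_eq_integral[OF L2_set_integrable[OF f, of _ _ q]]
        have i1: "integral {s..s+r} ?g \<le> r * (\<eta>/4)"
        proof -
          have "integral {s..s+r} ?g / r \<le> \<eta>/4" using d1(2)[of r] r q(2) by linarith
          then show ?thesis using r by (simp add: field_simps)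
        qed
        have i2: "integral {s-r..s} ?g \<le> r * (\<eta>/4)"
        proof -
          have "integral {s-r..s} ?g / r \<le> \<eta>/4" using d2(2)[of r] r q(2) by linarith
          then show ?thesis using r by (simp add: field_simps)
        qed
        have i0: "integral {s-r..s} ?g + integral {s..s+r} ?g = integral {s-r..s+r} ?g"
          using r int(1)[of "s-r" "s+r"] by (intro Henstock_Kurzweil_Integration.integral_combine) auto
        have i3: "integral {s-r..s+r} ?g \<le> \<eta> / 2 * r"
        proof -
          have "r * (\<eta>/4) + r * (\<eta>/4) = \<eta> / 2 * r" by simp
          then show ?thesis using i0 i1 i2 by linarith
        qed
        have nn: "(\<integral>\<^sup>+t. ennreal (indicator {s - r..s + r} t * ?g t) \<partial>lebesgue) = ennreal (integral {s-r..s+r} ?g)"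
          using L2_set_integrable[OF f, of "s-r" "s+r" q] int(2)[of "s-r" "s+r", symmetric]
          unfolding set_integrable_def set_lebesgue_integral_def by (subst nn_integral_eq_integral) auto
        have "(\<integral>\<^sup>+t. ennreal (indicator {s - r..s + r} t * cmod (f t - f s)) \<partial>lebesgue) \<le>
           (\<integral>\<^sup>+t. ennreal (indicator {s - r..s + r} t * ?g t) + ennreal (\<eta>/8) * indicator {s-r..s+r} t \<partial>lebesgue)"
        proof (rule nn_integral_mono)
          fix t
          have "cmod (f t - f s) \<le> ?g t + \<eta>/8"
            using norm_triangle_ineq4[of "f t - q" "f s - q"] q(2) by simp
          then show "ennreal (indicator {s - r..s + r} t * cmod (f t - f s)) \<le> ennreal (indicator {s - r..s + r} t * ?g t) + ennreal (\<eta>/8) * indicator {s-r..s+r} t"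
            using \<eta> by (auto simp: indicator_def ennreal_plus[symmetric] intro!: ennreal_leI simp del: ennreal_plus)
        qed
        also have "\<dots> = ennreal (integral {s-r..s+r} ?g) + ennreal (\<eta>/8) * ennreal (2 * r)"
          unfolding nn[symmetric] using r f[THEN L2_measurable] by (subst nn_integral_add) (auto simp: nn_integral_cmult)
        also have "\<dots> \<le> ennreal (\<eta> * r)"
        proof -
          have "0 < \<eta> * r" using r \<eta> by simp
          moreover have "\<eta>/8 * (2 * r) = (\<eta> * r) / 4" "\<eta> / 2 * r = (\<eta> * r) / 2" by simp_all
          ultimately have "integral {s-r..s+r} ?g + \<eta>/8 * (2 * r) \<le> \<eta> * r" using i3 by linarith
          moreover have "0 \<le> integral {s-r..s+r} ?g"
            by (rule Henstock_Kurzweil_Integration.integral_nonneg[OF int(1)]) auto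
          ultimately show ?thesis using r \<eta>
            by (simp add: ennreal_mult[symmetric] ennreal_plus[symmetric] ennreal_leI del: ennreal_plus)
        qed
        finally show "(\<integral>\<^sup>+t. ennreal (indicator {s - r..s + r} t * cmod (f t - f s)) \<partial>lebesgue) \<le> ennreal (\<eta> * r)" .
      qed (use d1 d2 in auto)
    qed
  qed
qed

text \<open>The Poisson kernel is decreasing in \<open>|v|\<close>, hence a superposition of indicators of symmetric
  intervals; the weight is minus its derivative.\<close>

lemma poisson_layer_cake:
  assumes e: "e > 0"
  shows "ennreal (poisson e v) = (\<integral>\<^sup>+y. ennreal (2 * e * y / (e\<^sup>2 + y\<^sup>2)\<^sup>2) * indicator {\<bar>v\<bar>..} y \<partial>lebesgue)"
proof -
  have pos: "e\<^sup>2 + x\<^sup>2 > 0" for x using e by (intro add_pos_nonneg) auto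
  have nz: "e\<^sup>2 + x\<^sup>2 \<noteq> 0" for x using pos[of x] by linarith
  have "(\<integral>\<^sup>+y. ennreal (2 * e * y / (e\<^sup>2 + y\<^sup>2)\<^sup>2) * indicator {\<bar>v\<bar>..} y \<partial>lborel) = ennreal (0 - (- e / (e\<^sup>2 + \<bar>v\<bar>\<^sup>2)))"
  proof (rule nn_integral_FTC_atLeast[where F="\<lambda>y. - e / (e\<^sup>2 + y\<^sup>2)"])
    show "((\<lambda>y. - e / (e\<^sup>2 + y\<^sup>2)) has_real_derivative 2 * e * x / (e\<^sup>2 + x\<^sup>2)\<^sup>2) (at x)" for x
      using nz[of x] by (auto intro!: derivative_eq_intros simp: field_simps power2_eq_square)
    show "((\<lambda>y. - e / (e\<^sup>2 + y\<^sup>2)) \<longlongrightarrow> 0) at_top" by real_asymp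
  qed (use e in auto)
  then show ?thesis by (simp add: nn_integral_completion poisson_def)
qed

text \<open>By the layer-cake formula, a function whose integrals over all centred intervals are at most
  those of the constant \<open>\<eta> / 2\<close> has a smaller integral against the Poisson kernel than that constant.\<close>

lemma poisson_near:
  assumes [measurable]: "G \<in> borel_measurable lebesgue" and \<eta>: "\<eta> \<ge> 0" and e: "e > 0"
    and G: "\<And>y. y > 0 \<Longrightarrow> (\<integral>\<^sup>+t. G t * indicator {s-y..s+y} t \<partial>lebesgue) \<le> ennreal (\<eta> * y)"
  shows "(\<integral>\<^sup>+t. G t * ennreal (poisson e (t - s)) \<partial>lebesgue) \<le> ennreal (\<eta> / 2 * pi)"
proof -
  let ?k = "\<lambda>y. ennreal (2 * e * y / (e\<^sup>2 + y\<^sup>2)\<^sup>2)"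
  have layer: "(\<integral>\<^sup>+t. H t * ennreal (poisson e (t - s)) \<partial>lebesgue) = (\<integral>\<^sup>+y. ?k y * (\<integral>\<^sup>+t. H t * indicator {s-y..s+y} t \<partial>lebesgue) \<partial>lebesgue)"
    if [measurable]: "H \<in> borel_measurable lebesgue" for H :: "real \<Rightarrow> ennreal"
  proof -
    have "(\<integral>\<^sup>+t. H t * ennreal (poisson e (t - s)) \<partial>lebesgue) = (\<integral>\<^sup>+t. \<integral>\<^sup>+y. H t * (?k y * indicator {\<bar>t - s\<bar>..} y) \<partial>lebesgue \<partial>lebesgue)"
      unfolding poisson_layer_cake[OF e] by (intro nn_integral_cong nn_integral_cmult[symmetric]) measurable
    also have "\<dots> = (\<integral>\<^sup>+y. \<integral>\<^sup>+t. H t * (?k y * indicator {\<bar>t - s\<bar>..} y) \<partial>lebesgue \<partial>lebesgue)"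
    proof (rule lebesgue_pair.Fubini')
      have "(\<lambda>(y, t). H t * (?k y * (if \<bar>t - s\<bar> \<le> y then 1 else 0))) \<in> borel_measurable (lebesgue \<Otimes>\<^sub>M lebesgue)"
        by measurable
      then show "(\<lambda>(y, t). H t * (?k y * indicator {\<bar>t - s\<bar>..} y)) \<in> borel_measurable (lebesgue \<Otimes>\<^sub>M lebesgue)"
        by (simp add: indicator_def of_bool_def)
    qed
    also have "\<dots> = (\<integral>\<^sup>+y. \<integral>\<^sup>+t. ?k y * (H t * indicator {s-y..s+y} t) \<partial>lebesgue \<partial>lebesgue)"
      by (intro nn_integral_cong) (auto simp: indicator_def abs_le_iff mult.commute)
    also have "\<dots> = (\<integral>\<^sup>+y. ?k y * (\<integral>\<^sup>+t. H t * indicator {s-y..s+y} t \<partial>lebesgue) \<partial>lebesgue)"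
      by (intro nn_integral_cong nn_integral_cmult) measurable
    finally show ?thesis .
  qed
  have "(\<integral>\<^sup>+t. G t * ennreal (poisson e (t - s)) \<partial>lebesgue) \<le> (\<integral>\<^sup>+t. ennreal (\<eta>/2) * ennreal (poisson e (t - s)) \<partial>lebesgue)"
    unfolding layer[OF assms(1)] layer[OF borel_measurable_const]
  proof (rule nn_integral_mono)
    fix y
    show "?k y * (\<integral>\<^sup>+t. G t * indicator {s-y..s+y} t \<partial>lebesgue) \<le> ?k y * (\<integral>\<^sup>+t. ennreal (\<eta>/2) * indicator {s-y..s+y} t \<partial>lebesgue)"
    proof (cases "y > 0")
      case True
      then have "(\<integral>\<^sup>+t. ennreal (\<eta>/2) * indicator {s-y..s+y} t \<partial>lebesgue) = ennreal (\<eta> * y)"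
        using \<eta> by (simp add: nn_integral_cmult_indicator ennreal_mult[symmetric])
      then show ?thesis using G[OF True] by (intro mult_left_mono) auto
    next
      case False
      then have "2 * e * y / (e\<^sup>2 + y\<^sup>2)\<^sup>2 \<le> 0" using e by (intro divide_nonpos_nonneg mult_nonneg_nonpos) auto
      then show ?thesis by (simp add: ennreal_neg)
    qed
  qed
  also have "\<dots> = ennreal (\<eta> / 2 * pi)"
    using \<eta> ennreal_mult[of "\<eta> / 2" pi] by (subst nn_integral_cmult) (auto simp: nn_integral_poisson[OF e])
  finally show ?thesis .
qed

lemma poisson_far:
  assumes "e > 0" "d > 0" "\<bar>v\<bar> \<ge> d"
  shows "poisson e v \<le> e * (1 + 1 / d\<^sup>2) * poisson 1 v"
proof -
  have dv: "d\<^sup>2 \<le> v\<^sup>2" using assms by (metis abs_le_square_iff abs_of_pos)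
  have v: "v\<^sup>2 > 0" using assms by auto
  have "poisson e v \<le> e / v\<^sup>2" unfolding poisson_def using assms v by (intro divide_left_mono mult_pos_pos add_pos_nonneg) auto
  also have "\<dots> \<le> e * ((1 + 1 / d\<^sup>2) / (1 + v\<^sup>2))"
  proof -
    have "1 + v\<^sup>2 \<le> (1 + 1/d\<^sup>2) * v\<^sup>2" using dv assms by (simp add: field_simps)
    then have "1 / v\<^sup>2 \<le> (1 + 1 / d\<^sup>2) / (1 + v\<^sup>2)" using v by (simp add: divide_simps add_pos_pos)
    then have "e * (1 / v\<^sup>2) \<le> e * ((1 + 1 / d\<^sup>2) / (1 + v\<^sup>2))" using assms by (intro mult_left_mono) auto
    then show ?thesis by simp
  qed
  finally show ?thesis by (simp add: poisson_def)
qed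

text \<open>Near \<open>s\<close> the Lebesgue point property controls all centred integrals; at distance \<open>d\<close> from
  \<open>s\<close> the kernel is at most \<open>e\<close> times a fixed multiple of the kernel at height \<open>1\<close>.\<close>

lemma poisson_lebesgue_point:
  assumes f: "f \<in> L2 UNIV" and s: "lebesgue_point f s"
  shows "((\<lambda>e. \<integral>\<^sup>+t. ennreal (cmod (f t - f s) * poisson e (t - s)) \<partial>lebesgue) \<longlongrightarrow> 0) (at_right 0)"
proof (rule tendsto_0_ennrealI)
  fix E :: real assume E: "E > 0"
  have [measurable]: "f \<in> borel_measurable lebesgue" using f L2_measurable by auto
  \<comment> \<open>As \<open>\<pi> < 4\<close>, the near part \<open>\<eta> \<pi> / 2\<close> is then at most \<open>E / 2\<close>.\<close>
  define \<eta> where "\<eta> = E / 4"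
  have \<eta>: "\<eta> > 0" using E by (simp add: \<eta>_def)
  obtain \<delta> where \<delta>: "\<delta> > 0" "\<And>r. 0 < r \<Longrightarrow> r < \<delta> \<Longrightarrow>
     (\<integral>\<^sup>+t. ennreal (indicator {s - r..s + r} t * cmod (f t - f s)) \<partial>lebesgue) \<le> ennreal (\<eta> * r)"
    using s \<eta> unfolding lebesgue_point_def by metis
  define d where "d = \<delta> / 2"
  have d: "d > 0" "d < \<delta>" using \<delta>(1) by (auto simp: d_def)
  define A where "A = (\<integral>\<^sup>+t. ennreal (cmod (f t - f s) * poisson 1 (t - s)) \<partial>lebesgue)"
  have "A \<le> (\<integral>\<^sup>+t. ennreal ((cmod (f t))\<^sup>2) + ennreal ((1 + cmod (f s)) * poisson 1 (t - s)) \<partial>lebesgue)"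
    unfolding A_def
  proof (rule nn_integral_mono)
    fix t
    have p: "0 \<le> poisson 1 (t - s)" "poisson 1 (t - s) \<le> 1" using poisson_nonneg[of 1] poisson_le[of 1] by auto
    have "cmod (f t) \<le> 1 + (cmod (f t))\<^sup>2"
      using zero_le_power2[of "cmod (f t) - 1 / 2"] unfolding power2_diff by (simp add: power_divide)
    then have "cmod (f t - f s) \<le> (cmod (f t))\<^sup>2 + (1 + cmod (f s))"
      using norm_triangle_ineq4[of "f t" "f s"] by linarith
    then have "cmod (f t - f s) * poisson 1 (t - s) \<le> ((cmod (f t))\<^sup>2 + (1 + cmod (f s))) * poisson 1 (t - s)"
      using p by (intro mult_right_mono) auto
    also have "\<dots> \<le> (cmod (f t))\<^sup>2 + (1 + cmod (f s)) * poisson 1 (t - s)"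
      using mult_left_mono[OF p(2), of "(cmod (f t))\<^sup>2"] by (simp add: algebra_simps)
    finally show "ennreal (cmod (f t - f s) * poisson 1 (t - s)) \<le> ennreal ((cmod (f t))\<^sup>2) + ennreal ((1 + cmod (f s)) * poisson 1 (t - s))"
      using p by (simp add: ennreal_plus[symmetric] ennreal_leI del: ennreal_plus)
  qed
  also have "\<dots> = N2 f + ennreal (1 + cmod (f s)) * ennreal pi"
    using poisson_nonneg[of 1]
    by (subst nn_integral_add) (auto simp: N2_def ennreal_mult nn_integral_cmult nn_integral_poisson)
  also have "\<dots> < \<infinity>" using f by (auto simp: L2_UNIV_iff ennreal_mult_less_top)
  finally have A: "A < \<infinity>" .
  define C where "C = enn2real A * (1 + 1/d\<^sup>2)"
  have AC: "A = ennreal (enn2real A)" using A by (simp add: ennreal_enn2real_if)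
  have C0: "C \<ge> 0" by (simp add: C_def)
  have bound: "(\<integral>\<^sup>+t. ennreal (cmod (f t - f s) * poisson e (t - s)) \<partial>lebesgue) \<le> ennreal (\<eta> / 2 * pi) + ennreal (e * C)" if e: "e > 0" for e
  proof -
    let ?G = "\<lambda>t. ennreal (indicator {s-d..s+d} t * cmod (f t - f s))"
    have near: "(\<integral>\<^sup>+t. ?G t * ennreal (poisson e (t - s)) \<partial>lebesgue) \<le> ennreal (\<eta> / 2 * pi)"
    proof (rule poisson_near)
      fix y :: real assume y: "y > 0"
      have "(\<integral>\<^sup>+t. ?G t * indicator {s-y..s+y} t \<partial>lebesgue) \<le> (\<integral>\<^sup>+t. ennreal (indicator {s - min y d..s + min y d} t * cmod (f t - f s)) \<partial>lebesgue)"
        by (intro nn_integral_mono) (auto simp: indicator_def)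
      also have "\<dots> \<le> ennreal (\<eta> * min y d)" using y d by (intro \<delta>(2)) auto
      also have "\<dots> \<le> ennreal (\<eta> * y)" using \<eta> by (intro ennreal_leI mult_left_mono) auto
      finally show "(\<integral>\<^sup>+t. ?G t * indicator {s-y..s+y} t \<partial>lebesgue) \<le> ennreal (\<eta> * y)" .
    qed (use \<eta> e in auto)
    have "(\<integral>\<^sup>+t. ennreal (cmod (f t - f s) * poisson e (t - s)) \<partial>lebesgue) \<le>
      (\<integral>\<^sup>+t. ?G t * ennreal (poisson e (t - s)) + ennreal (e * (1 + 1/d\<^sup>2)) * ennreal (cmod (f t - f s) * poisson 1 (t - s)) \<partial>lebesgue)"
    proof (rule nn_integral_mono)
      fix t
      show "ennreal (cmod (f t - f s) * poisson e (t - s)) \<le> ?G t * ennreal (poisson e (t - s)) + ennreal (e * (1 + 1/d\<^sup>2)) * ennreal (cmod (f t - f s) * poisson 1 (t - s))"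
      proof (cases "t \<in> {s-d..s+d}")
        case True then show ?thesis using poisson_nonneg[OF e] by (simp add: ennreal_mult)
      next
        case False
        then have "\<bar>t - s\<bar> \<ge> d" by auto
        from mult_left_mono[OF poisson_far[OF e d(1) this], of "cmod (f t - f s)"]
        have "cmod (f t - f s) * poisson e (t - s) \<le> (e * (1 + 1/d\<^sup>2)) * (cmod (f t - f s) * poisson 1 (t - s))"
          by (simp add: algebra_simps)
        then have "ennreal (cmod (f t - f s) * poisson e (t - s)) \<le> ennreal (e * (1 + 1/d\<^sup>2)) * ennreal (cmod (f t - f s) * poisson 1 (t - s))"
          using e poisson_nonneg[of 1] by (subst ennreal_mult[symmetric]) (auto intro!: ennreal_leI)
        then show ?thesis by (simp add: add_increasing)
      qed
    qed
    also have "\<dots> = (\<integral>\<^sup>+t. ?G t * ennreal (poisson e (t - s)) \<partial>lebesgue) + ennreal (e * (1 + 1/d\<^sup>2)) * A"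
      unfolding A_def by (subst nn_integral_add) (auto simp: nn_integral_cmult)
    also have "\<dots> \<le> ennreal (\<eta> / 2 * pi) + ennreal (e * (1 + 1/d\<^sup>2)) * A" by (intro add_right_mono near)
    also have "ennreal (e * (1 + 1/d\<^sup>2)) * A = ennreal (e * C)"
      using e by (subst AC, subst ennreal_mult[symmetric]) (auto simp: C_def mult_ac)
    finally show ?thesis .
  qed
  have "\<forall>\<^sub>F e in at_right 0. e < E / (2 * (C + 1))"
    using E C0 by (intro order_tendstoD[OF tendsto_ident_at]) auto
  moreover have "\<forall>\<^sub>F e::real in at_right 0. e > 0" by (simp add: eventually_at_filter)
  ultimately show "\<forall>\<^sub>F e in at_right 0. (\<integral>\<^sup>+t. ennreal (cmod (f t - f s) * poisson e (t - s)) \<partial>lebesgue) \<le> ennreal E"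
  proof eventually_elim
    case (elim e)
    have "e * C \<le> e * (C + 1)" using elim by simp
    also have "\<dots> \<le> E / 2" using elim C0 by (simp add: field_simps)
    finally have "e * C \<le> E / 2" .
    moreover have "\<eta> / 2 * pi \<le> E / 2" using E pi_less_4 by (simp add: \<eta>_def field_simps)
    ultimately have "\<eta> / 2 * pi + e * C \<le> E" by linarith
    moreover have "0 \<le> \<eta> / 2 * pi" "0 \<le> e * C" using \<eta> elim C0 by auto
    ultimately have "ennreal (\<eta> / 2 * pi) + ennreal (e * C) \<le> ennreal E"
      by (metis ennreal_plus ennreal_leI)
    then show ?case using bound[OF elim(2)] by (rule order_trans[rotated])
  qed
qed

lemma L2_poisson:
  assumes "e > 0"
  shows "(\<lambda>t. complex_of_real (poisson e (t - s))) \<in> L2 UNIV"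
proof -
  have "N2 (\<lambda>t. complex_of_real (poisson e (t - s))) \<le> (\<integral>\<^sup>+t. ennreal (1/e) * ennreal (poisson e (t - s)) \<partial>lebesgue)"
    unfolding N2_def
  proof (rule nn_integral_mono)
    fix t
    have "(cmod (complex_of_real (poisson e (t - s))))\<^sup>2 \<le> (1/e) * poisson e (t - s)"
      using poisson_le[OF assms] poisson_nonneg[OF assms] by (simp only: norm_of_real power2_abs power2_eq_square abs_of_nonneg) (intro mult_right_mono, auto)
    then show "ennreal ((cmod (complex_of_real (poisson e (t - s))))\<^sup>2) \<le> ennreal (1/e) * ennreal (poisson e (t - s))"
      using assms poisson_nonneg[OF assms] by (subst ennreal_mult[symmetric]) (auto intro!: ennreal_leI)
  qed
  also have "\<dots> = ennreal (1/e) * ennreal pi" by (subst nn_integral_cmult) (auto simp: nn_integral_poisson[OF assms])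
  also have "\<dots> < \<infinity>" by (simp add: ennreal_mult_less_top)
  finally show ?thesis by (simp add: L2_UNIV_iff)
qed

text \<open>Any kernel dominated by the Poisson kernel acts as an approximate identity at Lebesgue points.
  The case \<open>c = 0\<close> compares two truncations of the same singular kernel.\<close>

lemma approximate_identity_at_lebesgue_point:
  assumes f: "f \<in> L2 UNIV" and s: "lebesgue_point f s"
    and D [measurable]: "\<And>e. D e \<in> borel_measurable lebesgue"
    and bound: "\<And>e t. e > 0 \<Longrightarrow> cmod (D e t) \<le> C * poisson e (t - s)"
    and int: "\<And>e. e > 0 \<Longrightarrow> (LINT t|lebesgue. D e t) = c"
  shows "((\<lambda>e. LINT t|lebesgue. f t * D e t) \<longlongrightarrow> f s * c) (at_right 0)"
proof -
  have [measurable]: "f \<in> borel_measurable lebesgue" using f L2_measurable by auto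
  have C0: "C \<ge> 0"
  proof -
    have "0 \<le> C * poisson 1 0" using order_trans[OF norm_ge_zero bound[of 1 s]] by simp
    then show ?thesis by (simp add: poisson_def)
  qed
  have pos: "\<forall>\<^sub>F e::real in at_right 0. e > 0" by (simp add: eventually_at_filter)
  have P: "((\<lambda>e. ennreal C * (\<integral>\<^sup>+t. ennreal (cmod (f t - f s) * poisson e (t - s)) \<partial>lebesgue)) \<longlongrightarrow> ennreal C * 0) (at_right 0)"
    by (intro tendsto_mult_ennreal tendsto_const poisson_lebesgue_point[OF f s]) auto
  have "((\<lambda>e. ennreal (cmod ((LINT t|lebesgue. f t * D e t) - f s * c))) \<longlongrightarrow> 0) (at_right 0)"
  proof (rule tendsto_sandwich[OF _ _ tendsto_const P[simplified]])
    show "\<forall>\<^sub>F e in at_right 0. ennreal (cmod ((LINT t|lebesgue. f t * D e t) - f s * c)) \<le> ennreal C * (\<integral>\<^sup>+t. ennreal (cmod (f t - f s) * poisson e (t - s)) \<partial>lebesgue)"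
      using pos
    proof eventually_elim
      case (elim e)
      have DL2: "D e \<in> L2 UNIV"
        by (rule L2_dominated[OF L2_cmult[OF L2_poisson[OF elim, of s], of "of_real C"]])
          (use bound[OF elim] poisson_nonneg[OF elim] C0 in \<open>auto simp: norm_mult\<close>)
      have DI: "integrable lebesgue (D e)"
      proof (rule Bochner_Integration.integrable_bound[where f="\<lambda>t. C * poisson e (t - s)"])
        show "integrable lebesgue (\<lambda>t. C * poisson e (t - s))"
          using has_bochner_integral_poisson[OF elim, of s] by (auto simp: has_bochner_integral_iff)
      qed (use bound[OF elim] poisson_nonneg[OF elim] C0 in auto)
      have i1: "integrable lebesgue (\<lambda>t. f t * D e t)" by (rule L2_integrable_mult[OF f DL2])
      have i2: "integrable lebesgue (\<lambda>t. f s * D e t)" using DI by simp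
      have "(LINT t|lebesgue. f t * D e t) - f s * c = (LINT t|lebesgue. f t * D e t) - (LINT t|lebesgue. f s * D e t)"
        using int[OF elim] by simp
      also have "\<dots> = (LINT t|lebesgue. (f t - f s) * D e t)"
        using i1 i2 by (subst Bochner_Integration.integral_diff[symmetric]) (auto simp: algebra_simps)
      also have "ennreal (cmod \<dots>) \<le> (\<integral>\<^sup>+t. ennreal (cmod ((f t - f s) * D e t)) \<partial>lebesgue)"
        using Bochner_Integration.integrable_diff[OF i1 i2] by (intro integral_norm_bound_ennreal) (simp add: algebra_simps)
      also have "\<dots> \<le> (\<integral>\<^sup>+t. ennreal C * ennreal (cmod (f t - f s) * poisson e (t - s)) \<partial>lebesgue)"
      proof (rule nn_integral_mono)
        fix t
        have "cmod ((f t - f s) * D e t) \<le> C * (cmod (f t - f s) * poisson e (t - s))"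
          using mult_left_mono[OF bound[OF elim, of t], of "cmod (f t - f s)"] by (simp add: norm_mult mult_ac)
        then show "ennreal (cmod ((f t - f s) * D e t)) \<le> ennreal C * ennreal (cmod (f t - f s) * poisson e (t - s))"
          using C0 poisson_nonneg[OF elim] by (subst ennreal_mult[symmetric]) (auto intro!: ennreal_leI)
      qed
      also have "\<dots> = ennreal C * (\<integral>\<^sup>+t. ennreal (cmod (f t - f s) * poisson e (t - s)) \<partial>lebesgue)"
        by (rule nn_integral_cmult) measurable
      finally show ?case .
    qed
  qed simp
  then have "((\<lambda>e. cmod ((LINT t|lebesgue. f t * D e t) - f s * c)) \<longlongrightarrow> 0) (at_right 0)"
    by (subst (asm) ennreal_0[symmetric], subst (asm) tendsto_ennreal_iff) auto
  then show ?thesis by (simp add: tendsto_norm_zero_iff LIM_zero_iff)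
qed

section \<open>Fourier inversion\<close>

lemma L2_abel:
  assumes "e > 0"
  shows "(\<lambda>s. complex_of_real (exp (- e * \<bar>s\<bar>)) * exp (\<i> * of_real (s * v))) \<in> L2 UNIV"
proof -
  have "integrable lebesgue (\<lambda>s. cmod (complex_of_real (exp (- (2 * e) * \<bar>s\<bar>)) * exp (\<i> * of_real (s * 0))))"
    using assms by (intro integrable_norm integrable_abel) auto
  moreover have "cmod (complex_of_real (exp (- (2 * e) * \<bar>s\<bar>)) * exp (\<i> * of_real (s * 0))) =
      (cmod (complex_of_real (exp (- e * \<bar>s\<bar>)) * exp (\<i> * of_real (s * v))))\<^sup>2" for s
    by (simp add: norm_mult exp_double[symmetric] mult_ac)
  ultimately show ?thesis using integrable_abel[OF assms, of v] unfolding L2_def lebesgue_on_UNIV_eq by auto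
qed

lemma eventually_at_right_0: "\<forall>\<^sub>F e::real in at_right 0. e > 0" by (simp add: eventually_at_filter)

text \<open>Fourier inversion by Abel means, pointwise almost everywhere: the Abel weight turns the inverse
  transform into a Poisson integral of \<open>h\<close>. This pointwise form is what later gives existence of
  principal values almost everywhere.\<close>

theorem abel_inversion:
  assumes h: "h \<in> L2 UNIV" and u: "is_L2_fourier h u"
  shows "AE s in lebesgue. ((\<lambda>e. LINT l|lebesgue. u l * (of_real (exp (- e * \<bar>l\<bar>)) * exp (\<i> * of_real (l * - s)))) \<longlongrightarrow> of_real (2 * pi) * h s) (at_right 0)"
  using AE_lebesgue_point[OF h]
proof eventually_elim
  case (elim s)
  have "((\<lambda>e. LINT t|lebesgue. h t * of_real (2 * poisson e (t - s))) \<longlongrightarrow> h s * of_real (2 * pi)) (at_right 0)"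
  proof (rule approximate_identity_at_lebesgue_point[OF h elim, where C=2])
    fix e :: real assume e: "e > 0"
    show "cmod (of_real (2 * poisson e (t - s))) \<le> 2 * poisson e (t - s)" for t
      unfolding norm_of_real using poisson_nonneg[OF e] by simp
    have "has_bochner_integral lebesgue (\<lambda>t. 2 * poisson e (t - s)) (2 * pi)"
      using has_bochner_integral_poisson[OF e] by (intro has_bochner_integral_mult_right) auto
    then show "(LINT t|lebesgue. complex_of_real (2 * poisson e (t - s))) = of_real (2 * pi)"
      unfolding integral_complex_of_real by (simp only: has_bochner_integral_integral_eq)
  qed auto
  moreover have "\<forall>\<^sub>F e in at_right 0. (LINT t|lebesgue. h t * of_real (2 * poisson e (t - s))) = (LINT l|lebesgue. u l * (of_real (exp (- e * \<bar>l\<bar>)) * exp (\<i> * of_real (l * - s))))"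
    using eventually_at_right_0
  proof eventually_elim
    case (elim e)
    show ?case
      unfolding L2_fourier_multiplication_formula[OF h u integrable_abel[OF elim] L2_abel[OF elim]] ft_abel[OF elim] ..
  qed
  ultimately show ?case by (simp add: filterlim_cong mult.commute Lim_transform_eventually)
qed

lemma is_L2_fourier_cong_right:
  assumes "is_L2_fourier h u" "AE x in lebesgue. u x = v x"
  shows "is_L2_fourier h v"
proof -
  have "N2 (\<lambda>s. u s - ft (trunc R h) s) = N2 (\<lambda>s. v s - ft (trunc R h) s)" for R
    by (rule N2_cong_AE) (use assms(2) in auto)
  then show ?thesis using assms L2_cong_AE[OF assms(2)] unfolding is_L2_fourier_iff by simp
qed

text \<open>By Abel inversion the transform determines the function almost everywhere.\<close>

lemma L2_fourier_inj:
  assumes h: "h \<in> L2 UNIV" and k: "k \<in> L2 UNIV" and u: "is_L2_fourier h u" "is_L2_fourier k v"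
    and "AE x in lebesgue. u x = v x"
  shows "AE x in lebesgue. h x = k x"
proof -
  have "AE x in lebesgue. u x - v x = 0" using assms(5) by auto
  then have "(LINT l|lebesgue. (u l - v l) * a l) = 0" for a
    by (intro integral_eq_zero_AE) auto
  then show ?thesis
    using abel_inversion[OF L2_diff[OF h k] is_L2_fourier_diff[OF h k u]] by (simp add: tendsto_const_iff)
qed

text \<open>The candidate is the conjugate transform of the conjugate, divided by \<open>2 \<pi>\<close>. Its damped versions
  have transforms that converge to \<open>w\<close> almost everywhere by Abel inversion and in mean square
  to the transform of the candidate, so the two limits agree.\<close>

theorem L2_fourier_surj:
  assumes w: "w \<in> L2 UNIV"
  obtains h where "h \<in> L2 UNIV" "is_L2_fourier h w"
proof -
  have cw: "(\<lambda>s. cnj (w s)) \<in> L2 UNIV" by (rule L2_cnj[OF w])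
  obtain v where v: "is_L2_fourier (\<lambda>s. cnj (w s)) v" using is_L2_fourier_exists[OF cw] .
  have vL: "v \<in> L2 UNIV" by (rule is_L2_fourier_L2[OF v])
  define h where "h s = of_real (1 / (2 * pi)) * cnj (v s)" for s
  have hL: "h \<in> L2 UNIV" unfolding h_def by (intro L2_cmult L2_cnj vL)
  obtain w' where w': "is_L2_fourier h w'" using is_L2_fourier_exists[OF hL] .
  have [measurable]: "w \<in> borel_measurable lebesgue" "w' \<in> borel_measurable lebesgue" "h \<in> borel_measurable lebesgue"
    using w hL is_L2_fourier_L2[OF w'] L2_measurable by auto
  define ee where "ee k = 1 / real (Suc k)" for k
  have ee: "ee k > 0" for k by (simp add: ee_def)
  have ee0: "ee \<longlonglongrightarrow> 0" unfolding ee_def[abs_def] by (rule LIMSEQ_Suc[OF lim_1_over_n])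
  define he where "he k l = h l * of_real (exp (- ee k * \<bar>l\<bar>))" for k l
  have ab: "(\<lambda>l. complex_of_real (exp (- ee k * \<bar>l\<bar>))) \<in> L2 UNIV" for k using L2_abel[OF ee, of k 0] by simp
  have heI: "integrable lebesgue (he k)" for k unfolding he_def by (rule L2_integrable_mult[OF hL ab])
  have he_le: "cmod (he k l) \<le> cmod (h l)" for k l
    unfolding he_def norm_mult using ee[of k] by (simp add: mult_left_le)
  have heL: "he k \<in> L2 UNIV" for k
    using heI[of k] he_le by (intro L2_dominated[OF hL] borel_measurable_integrable AE_I2) auto
  have [measurable]: "he k \<in> borel_measurable lebesgue" for k using heL L2_measurable by auto
  have exp_lim: "(\<lambda>k. exp (- ee k * \<bar>l\<bar>)) \<longlonglongrightarrow> exp (- 0 * \<bar>l\<bar>)" for l by (intro tendsto_intros ee0)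
  have "(\<lambda>k. N2 (\<lambda>l. h l - he k l)) \<longlonglongrightarrow> 0"
  proof (rule N2_dominated_tendsto[OF hL])
    show "cmod (h l - he k l) \<le> cmod (h l)" for k l
    proof -
      have "h l - he k l = h l * of_real (1 - exp (- ee k * \<bar>l\<bar>))" by (simp add: he_def algebra_simps)
      also have "cmod \<dots> = cmod (h l) * \<bar>1 - exp (- ee k * \<bar>l\<bar>)\<bar>" by (simp only: norm_mult norm_of_real)
      also have "\<dots> \<le> cmod (h l) * 1" using ee[of k] by (intro mult_left_mono) auto
      finally show ?thesis by simp
    qed
    show "AE l in lebesgue. (\<lambda>k. h l - he k l) \<longlonglongrightarrow> 0"
    proof (rule AE_I2)
      fix l
      have "(\<lambda>k. h l - h l * of_real (exp (- ee k * \<bar>l\<bar>))) \<longlonglongrightarrow> h l - h l * of_real (exp (- 0 * \<bar>l\<bar>))"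
        by (intro tendsto_diff tendsto_mult tendsto_of_real tendsto_const exp_lim)
      then show "(\<lambda>k. h l - he k l) \<longlonglongrightarrow> 0" by (simp add: he_def)
    qed
  qed measurable
  then have "(\<lambda>k. ennreal (4 * pi) * N2 (\<lambda>l. h l - he k l)) \<longlonglongrightarrow> ennreal (4 * pi) * 0"
    by (intro tendsto_mult_ennreal tendsto_const) auto
  then have lim0: "(\<lambda>k. ennreal (4 * pi) * N2 (\<lambda>l. h l - he k l)) \<longlonglongrightarrow> 0" by simp
  have N2b: "N2 (\<lambda>s. w' s - ft (he k) s) \<le> ennreal (4 * pi) * N2 (\<lambda>l. h l - he k l)" for k
    by (rule N2_L2_fourier_le[OF L2_diff[OF hL heL] is_L2_fourier_diff[OF hL heL w' is_L2_fourier_ft[OF heI heL]]])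
  have lim: "AE s in lebesgue. (\<lambda>k. ft (he k) s) \<longlonglongrightarrow> w s"
    using abel_inversion[OF cw v]
  proof eventually_elim
    case (elim s)
    have "filterlim ee (at_right 0) sequentially"
      using ee ee0 by (intro filterlim_at_withinI) auto
    from filterlim_compose[OF elim this]
    have "(\<lambda>k. of_real (1 / (2 * pi)) * cnj (LINT l|lebesgue. v l * (of_real (exp (- ee k * \<bar>l\<bar>)) * exp (\<i> * of_real (l * - s)))))
       \<longlonglongrightarrow> of_real (1 / (2 * pi)) * cnj (of_real (2 * pi) * cnj (w s))"
      by (intro tendsto_mult tendsto_const tendsto_cnj)
    moreover have "of_real (1 / (2 * pi)) * cnj (LINT l|lebesgue. v l * (of_real (exp (- ee k * \<bar>l\<bar>)) * exp (\<i> * of_real (l * - s)))) = ft (he k) s" for k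
      unfolding ft_def integral_cnj_eq[symmetric] integral_mult_right_zero[symmetric]
      by (intro Bochner_Integration.integral_cong refl) (simp add: he_def h_def exp_cnj mult_ac)
    ultimately show ?case by simp
  qed
  have close: "N2 (\<lambda>s. w' s - w s) \<le> ennreal e" if e: "e > 0" for e
  proof (rule N2_le_of_tendsto[where f="\<lambda>k s. w' s - ft (he k) s"])
    show "AE s in lebesgue. (\<lambda>k. w' s - ft (he k) s) \<longlonglongrightarrow> w' s - w s"
      using lim by eventually_elim (intro tendsto_intros)
    have "\<forall>\<^sub>F k in sequentially. ennreal (4 * pi) * N2 (\<lambda>l. h l - he k l) < ennreal e"
      using e by (intro order_tendstoD[OF lim0]) auto
    then show "\<forall>\<^sub>F k in sequentially. N2 (\<lambda>s. w' s - ft (he k) s) \<le> ennreal e"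
      by eventually_elim (rule order_trans[OF N2b order.strict_implies_order])
  qed measurable
  have "N2 (\<lambda>s. w' s - w s) \<le> 0"
  proof (rule ennreal_le_epsilon)
    fix e :: real assume "e > 0"
    then show "N2 (\<lambda>s. w' s - w s) \<le> 0 + ennreal e" using close by simp
  qed
  then have "N2 (\<lambda>s. w' s - w s) = 0" by simp
  then have "AE x in lebesgue. w' x - w x = 0" by (subst (asm) N2_eq_0_iff) measurable
  then have "AE x in lebesgue. w' x = w x" by (rule eventually_mono) simp
  then have "is_L2_fourier h w" by (rule is_L2_fourier_cong_right[OF w'])
  then show ?thesis using that hL by blast
qed

section \<open>Partial fractions of the hyperbolic cosecant\<close>

lemma sin_i_of_real: "sin (\<i> * of_real v) = \<i> * of_real (sinh v)"
  by (simp add: sin_i_times sinh_field_def exp_of_real exp_minus)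

text \<open>Logarithmic derivative of the reflection formula of the Gamma function. The reciprocal Gamma
  function is differentiated, as it is entire.\<close>

lemma Digamma_reflection:
  fixes z :: complex
  assumes "z \<notin> \<int>"
  shows "Digamma (1 - z) - Digamma z = of_real pi * cos (of_real pi * z) / sin (of_real pi * z)"
proof -
  have z1: "z \<notin> \<int>\<^sub>\<le>\<^sub>0" "1 - z \<notin> \<int>\<^sub>\<le>\<^sub>0"
    using assms by (auto elim!: nonpos_Ints_cases) (metis Ints_1 Ints_diff Ints_of_int diff_diff_eq2 add_diff_cancel_left')
  have s: "sin (of_real pi * z) \<noteq> 0"
    using rGamma_reflection_complex[of z] z1 by (auto simp: rGamma_eq_zero_iff)
  have "((\<lambda>z. rGamma z * rGamma (1 - z)) has_field_derivative (rGamma z * rGamma (1 - z) * (Digamma (1 - z) - Digamma z))) (at z)"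
    using z1 by (auto intro!: derivative_eq_intros simp: algebra_simps)
  moreover have "((\<lambda>z. sin (of_real pi * z) / of_real pi) has_field_derivative cos (of_real pi * z)) (at z)"
    by (auto intro!: derivative_eq_intros)
  ultimately have "rGamma z * rGamma (1 - z) * (Digamma (1 - z) - Digamma z) = cos (of_real pi * z)"
    unfolding rGamma_reflection_complex by (rule DERIV_unique)
  then show ?thesis using s unfolding rGamma_reflection_complex by (simp add: field_simps)
qed

text \<open>The difference of the series of the Digamma function at \<open>1 - z\<close> and at \<open>z\<close>.\<close>

lemma cot_partial_fractions:
  fixes z :: complex
  assumes "z \<notin> \<int>"
  shows "(\<lambda>N. \<Sum>k<N. 1 / (z + of_nat k) - 1 / (1 - z + of_nat k)) \<longlonglongrightarrow> of_real pi * cos (of_real pi * z) / sin (of_real pi * z)"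
proof -
  have z: "z \<noteq> 0" "1 - z \<noteq> 0" using assms by auto
  let ?a = "\<lambda>z k. inverse (of_nat (Suc k)) - inverse (z + of_nat k) :: complex"
  have "(\<lambda>k. ?a (1 - z) k - ?a z k) sums (suminf (?a (1 - z)) - suminf (?a z))"
    using summable_Digamma[OF z(1)] summable_Digamma[OF z(2)] by (intro sums_diff summable_sums) auto
  also have "suminf (?a (1 - z)) - suminf (?a z) = of_real pi * cos (of_real pi * z) / sin (of_real pi * z)"
    unfolding Digamma_reflection[OF assms, symmetric] Digamma_def by simp
  finally show ?thesis unfolding sums_def by (simp add: divide_inverse)
qed

lemma two_poles_eq:
  fixes a z :: complex
  assumes "a - z \<noteq> 0" "a + z \<noteq> 0"
  shows "2 * z / (a\<^sup>2 - z\<^sup>2) = 1 / (a - z) - 1 / (a + z)"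
proof -
  have "a\<^sup>2 - z\<^sup>2 = (a - z) * (a + z)" by (simp add: power2_eq_square algebra_simps)
  then show ?thesis using assms by (subst diff_frac_eq) auto
qed

text \<open>The identity \<open>cot (w / 2) - cot w = 1 / sin w\<close> at the level of partial sums. Taking \<open>N\<close> terms
  of the first series against \<open>2 N\<close> terms of the second makes the poles at even and odd
  integers pair up with opposite signs.\<close>

lemma pairing_identity:
  fixes z :: complex
  assumes "z \<notin> \<int>"
  shows "(\<Sum>k<N. 1 / (z/2 + of_nat k) - 1 / (1 - z/2 + of_nat k)) - (\<Sum>k<2*N. 1 / (z + of_nat k) - 1 / (1 - z + of_nat k))
    = 1 / z - (1 / (of_nat (2 * N) + z)) + (\<Sum>m<2*N. (-1)^m * 2 * z / ((of_nat (Suc m))\<^sup>2 - z\<^sup>2))"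
proof (induction N)
  case 0 show ?case by simp
next
  case (Suc N)
  have nz: "of_int j + z \<noteq> 0" "of_int j - z \<noteq> 0" for j
  proof -
    show "of_int j + z \<noteq> 0"
    proof
      assume "of_int j + z = 0"
      then have "z = of_int (- j)" by (simp add: eq_neg_iff_add_eq_0 add.commute)
      then show False using assms by (metis Ints_of_int)
    qed
    show "of_int j - z \<noteq> 0" using assms by (metis Ints_of_int eq_iff_diff_eq_0)
  qed
  define n where "n = (of_nat (2 * N) :: complex)"
  have n': "of_nat N = n / 2" by (simp add: n_def)
  have a: "n + z \<noteq> 0" "n + 1 + z \<noteq> 0" "n + 2 + z \<noteq> 0" "n + 1 - z \<noteq> 0" "n + 2 - z \<noteq> 0"
    using nz[of "int (2 * N)"] nz[of "int (2 * N) + 1"] nz[of "int (2 * N) + 2"] by (auto simp: n_def add_ac)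
  have q1: "2 * z / ((n + 1)\<^sup>2 - z\<^sup>2) = 1 / (n + 1 - z) - 1 / (n + 1 + z)"
    by (rule two_poles_eq) (use a in auto)
  have q2: "2 * z / ((n + 2)\<^sup>2 - z\<^sup>2) = 1 / (n + 2 - z) - 1 / (n + 2 + z)"
    by (rule two_poles_eq) (use a in auto)
  have h1: "1 / (z/2 + of_nat N) = 2 / (n + z)" "1 / (1 - z/2 + of_nat N) = 2 / (n + 2 - z)"
  proof -
    have "z/2 + of_nat N = (n + z) / 2" "1 - z/2 + of_nat N = (n + 2 - z) / 2"
      by (simp_all add: n' add_divide_distrib diff_divide_distrib)
    note q = this
    show "1 / (z/2 + of_nat N) = 2 / (n + z)" "1 / (1 - z/2 + of_nat N) = 2 / (n + 2 - z)" unfolding q by simp_all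
  qed
  have sq: "(of_nat (Suc (2 * N)))\<^sup>2 = (n + 1)\<^sup>2" "(of_nat (Suc (Suc (2 * N))))\<^sup>2 = (n + 2)\<^sup>2"
    by (auto simp: n_def add_ac)
  have e: "2 * Suc N = Suc (Suc (2 * N))" by simp
  have L: "(\<Sum>k<Suc N. 1 / (z/2 + of_nat k) - 1 / (1 - z/2 + of_nat k)) - (\<Sum>k<2*Suc N. 1 / (z + of_nat k) - 1 / (1 - z + of_nat k))
    = ((\<Sum>k<N. 1 / (z/2 + of_nat k) - 1 / (1 - z/2 + of_nat k)) - (\<Sum>k<2*N. 1 / (z + of_nat k) - 1 / (1 - z + of_nat k)))
      + (2 / (n + z) - 2 / (n + 2 - z)) - (1 / (n + z) - 1 / (n + 1 - z)) - (1 / (n + 1 + z) - 1 / (n + 2 - z))"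
  proof -
    have "z + of_nat (2 * N) = n + z" "1 - z + of_nat (2 * N) = n + 1 - z"
      "z + of_nat (Suc (2 * N)) = n + 1 + z" "1 - z + of_nat (Suc (2 * N)) = n + 2 - z" by (simp_all add: n_def)
    then show ?thesis unfolding e sum.lessThan_Suc h1 by (simp only:) simp
  qed
  have R: "(\<Sum>m<2*Suc N. (-1)^m * 2 * z / ((of_nat (Suc m))\<^sup>2 - z\<^sup>2)) = (\<Sum>m<2*N. (-1)^m * 2 * z / ((of_nat (Suc m))\<^sup>2 - z\<^sup>2))
      + (1 / (n + 1 - z) - 1 / (n + 1 + z)) - (1 / (n + 2 - z) - 1 / (n + 2 + z))"
    unfolding e sum.lessThan_Suc sq q1[symmetric] q2[symmetric] by simp
  have two: "(of_nat (2 * Suc N) :: complex) + z = n + 2 + z" by (simp add: n_def)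
  show ?case unfolding L R Suc.IH two n_def[symmetric] by simp
qed

text \<open>The expansion of \<open>\<pi> / sin (\<pi> z)\<close> on the imaginary axis, \<open>z = \<i> v / \<pi>\<close>.\<close>

lemma csch_partial_fractions:
  fixes v :: real
  assumes v: "v \<noteq> 0"
  shows "(\<lambda>N. \<Sum>m<2*N. (-1)^m * (2 * v / ((real (Suc m) * pi)\<^sup>2 + v\<^sup>2))) \<longlonglongrightarrow> 1 / v - 1 / sinh v"
proof -
  define z where "z = \<i> * of_real (v / pi)"
  have zi: "z \<notin> \<int>" "z / 2 \<notin> \<int>" using v by (auto simp: z_def complex_eq_iff elim!: Ints_cases)
  have pz: "of_real pi * z = \<i> * of_real v" by (simp add: z_def)
  let ?c = "\<lambda>w. of_real pi * cos (of_real pi * w) / sin (of_real pi * w) :: complex"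
  have sub: "filterlim (\<lambda>N::nat. 2 * N) at_top sequentially" by (rule mult_nat_left_at_top) simp
  have "(\<lambda>N. (\<Sum>k<N. 1 / (z/2 + of_nat k) - 1 / (1 - z/2 + of_nat k)) - (\<Sum>k<2*N. 1 / (z + of_nat k) - 1 / (1 - z + of_nat k))) \<longlonglongrightarrow> ?c (z/2) - ?c z"
    by (intro tendsto_diff cot_partial_fractions zi filterlim_compose[OF cot_partial_fractions sub])
  then have 1: "(\<lambda>N. 1 / z - (1 / (of_nat (2 * N) + z)) + (\<Sum>m<2*N. (-1)^m * 2 * z / ((of_nat (Suc m))\<^sup>2 - z\<^sup>2))) \<longlonglongrightarrow> ?c (z/2) - ?c z"
    unfolding pairing_identity[OF zi(1)] .
  have 2: "(\<lambda>N. 1 / (of_nat (2 * N) + z)) \<longlonglongrightarrow> 0"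
  proof -
    have "filterlim (\<lambda>N. of_nat (2 * N) + z) at_infinity sequentially"
      by (rule tendsto_add_filterlim_at_infinity'[OF _ tendsto_const] filterlim_compose[OF tendsto_of_nat sub])+
    then show ?thesis by (rule tendsto_divide_0[OF tendsto_const])
  qed
  have "?c (z/2) - ?c z = of_real pi / sin (of_real pi * z)"
  proof -
    define w where "w = of_real pi * (z / 2)"
    have w2: "of_real pi * z = 2 * w" by (simp add: w_def)
    have "sin (2 * w) \<noteq> 0" unfolding w2[symmetric] pz using v sinh_real_zero_iff[of v] by (simp add: sin_i_of_real)
    then have s: "sin w \<noteq> 0" "cos w \<noteq> 0" by (auto simp: sin_double)
    have c: "cos w * cos w + sin w * sin w = 1" using sin_cos_squared_add2[of w] by (simp add: power2_eq_square)
    then show ?thesis unfolding w2 w_def[symmetric] sin_double cos_double using s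
      by (simp add: field_simps power2_eq_square) (metis c distrib_left mult.assoc mult.right_neutral)
  qed
  with tendsto_add[OF tendsto_diff[OF 1 tendsto_const[of "1 / z"]] 2]
  have 3: "(\<lambda>N. \<Sum>m<2*N. (-1)^m * 2 * z / ((of_nat (Suc m))\<^sup>2 - z\<^sup>2)) \<longlonglongrightarrow> of_real pi / sin (of_real pi * z) - 1 / z"
    by simp
  have 4: "(\<lambda>N. (- \<i> / of_real pi) * (\<Sum>m<2*N. (-1)^m * 2 * z / ((of_nat (Suc m))\<^sup>2 - z\<^sup>2))) \<longlonglongrightarrow> (- \<i> / of_real pi) * (of_real pi / sin (of_real pi * z) - 1 / z)"
    by (intro tendsto_mult tendsto_const 3)
  have 5: "(- \<i> / of_real pi) * (\<Sum>m<2*N. (-1)^m * 2 * z / ((of_nat (Suc m))\<^sup>2 - z\<^sup>2)) = of_real (\<Sum>m<2*N. (-1)^m * (2 * v / ((real (Suc m) * pi)\<^sup>2 + v\<^sup>2)))" for N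
    unfolding sum_distrib_left of_real_sum
  proof (rule sum.cong[OF refl])
    fix m
    have z2: "z\<^sup>2 = - of_real (v\<^sup>2 / pi\<^sup>2)" by (simp add: z_def power_mult_distrib power_divide)
    have "(of_nat (Suc m))\<^sup>2 - z\<^sup>2 = of_real (((real (Suc m) * pi)\<^sup>2 + v\<^sup>2) / pi\<^sup>2)"
      unfolding z2 by (simp add: field_simps) (simp add: power2_eq_square algebra_simps)
    then have "(- \<i> / of_real pi) * ((-1)^m * 2 * z / ((of_nat (Suc m))\<^sup>2 - z\<^sup>2)) = (- \<i> / of_real pi) * ((-1)^m * 2 * z / of_real (((real (Suc m) * pi)\<^sup>2 + v\<^sup>2) / pi\<^sup>2))"
      by simp
    also have "\<dots> = of_real ((-1)^m * (2 * v / ((real (Suc m) * pi)\<^sup>2 + v\<^sup>2)))"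
      by (simp add: z_def field_simps power2_eq_square)
    finally show "(- \<i> / of_real pi) * ((-1)^m * 2 * z / ((of_nat (Suc m))\<^sup>2 - z\<^sup>2)) = of_real ((-1)^m * (2 * v / ((real (Suc m) * pi)\<^sup>2 + v\<^sup>2)))" .
  qed
  have 6: "(- \<i> / of_real pi) * (of_real pi / sin (of_real pi * z) - 1 / z) = complex_of_real (1 / v - 1 / sinh v)"
  proof -
    have "sin (of_real pi * z) = \<i> * of_real (sinh v)" unfolding pz by (rule sin_i_of_real)
    then show ?thesis using v by (simp add: z_def field_simps)
  qed
  show ?thesis using 4 unfolding 5 6 tendsto_of_real_iff .
qed

section \<open>Convolution with the hyperbolic cosecant\<close>

lemma integral_dominated_at_right:
  fixes f :: "real \<Rightarrow> 'a \<Rightarrow> complex"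
  assumes "g \<in> borel_measurable M" "\<And>e. e > 0 \<Longrightarrow> f e \<in> borel_measurable M" "integrable M w"
    and lim: "AE x in M. ((\<lambda>e. f e x) \<longlongrightarrow> g x) (at_right 0)"
    and b: "b > 0" and bound: "\<And>e. e > 0 \<Longrightarrow> e < b \<Longrightarrow> AE x in M. norm (f e x) \<le> w x"
  shows "((\<lambda>e. integral\<^sup>L M (f e)) \<longlongrightarrow> integral\<^sup>L M g) (at_right 0)"
proof (rule tendsto_at_right_sequentially[of 0 b])
  fix S :: "nat \<Rightarrow> real"
  assume S: "\<And>n. 0 < S n" "\<And>n. S n < b" "decseq S" "S \<longlonglongrightarrow> 0"
  then have "filterlim S (at_right 0) sequentially" by (intro filterlim_at_withinI) auto
  then have "AE x in M. (\<lambda>n. f (S n) x) \<longlonglongrightarrow> g x"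
    using lim by (auto elim!: eventually_mono intro: filterlim_compose)
  then show "(\<lambda>n. integral\<^sup>L M (f (S n))) \<longlonglongrightarrow> integral\<^sup>L M g"
    using assms S by (intro integral_dominated_convergence[where w=w]) auto
qed (use b in auto)

text \<open>The multiplier \<open>tanh (l \<pi> / 2)\<close> is the sum of the multiplier \<open>sgn l\<close> of the Hilbert transform
  and of \<open>tau l\<close>, which decays exponentially.\<close>

definition tau :: "real \<Rightarrow> real" where
  "tau l = tanh (l * pi / 2) - sgn l"

text \<open>Partial sums of the geometric expansion of \<open>tau\<close>. The transform of each term is a conjugate
  Poisson kernel; the number of terms is even as in the partial fractions of the cosecant.\<close>

definition tau_sum :: "nat \<Rightarrow> real \<Rightarrow> real" where
  "tau_sum N l = - 2 * (\<Sum>m<2*N. (-1)^m * (sgn l * exp (- (real (Suc m) * pi) * \<bar>l\<bar>)))"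

lemma tau_sum_eq:
  fixes l :: real
  defines "q \<equiv> exp (- pi * \<bar>l\<bar>)"
  shows "tau_sum N l = - 2 * sgn l * (q * (1 - q ^ (2 * N)) / (1 + q))"
proof -
  have q: "q > 0" by (simp add: q_def)
  have "exp (- (real (Suc m) * pi) * \<bar>l\<bar>) = q ^ Suc m" for m
    unfolding q_def exp_of_nat_mult[symmetric] by (simp add: algebra_simps)
  then have "(\<Sum>m<2*N. (-1)^m * (sgn l * exp (- (real (Suc m) * pi) * \<bar>l\<bar>))) = (\<Sum>m<2*N. sgn l * q * (- q) ^ m)"
    by (intro sum.cong refl) (simp add: power_minus[of q] mult_ac)
  also have "\<dots> = sgn l * q * ((1 - (- q) ^ (2 * N)) / (1 + q))"
    using q sum_gp_strict[of "- q" "2 * N"] by (simp add: sum_distrib_left[symmetric])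
  finally show ?thesis unfolding tau_sum_def by simp
qed

lemma tau_eq:
  fixes l :: real
  assumes "l \<noteq> 0"
  defines "q \<equiv> exp (- pi * \<bar>l\<bar>)"
  shows "tau l = - 2 * sgn l * (q / (1 + q))"
proof -
  have *: "tanh (x * pi / 2) - 1 = - 2 * (exp (- pi * x) / (1 + exp (- pi * x)))" for x :: real
  proof -
    have "1 + exp (- pi * x) > 0" by (simp add: add_pos_pos)
    moreover have "- 2 * (x * pi / 2) = - pi * x" by simp
    ultimately show ?thesis unfolding tanh_real_altdef by (simp add: field_simps)
  qed
  show ?thesis
  proof (cases "l > 0")
    case True then show ?thesis using *[of l] by (simp add: tau_def q_def)
  next
    case False
    then have "l < 0" using assms by simp
    have "tanh (l * pi / 2) = - tanh ((- l) * pi / 2)" using tanh_minus[of "l * pi / 2"] by simp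
    then show ?thesis using \<open>l < 0\<close> *[of "- l"] by (simp add: tau_def q_def)
  qed
qed

lemma tau_sum_bound: "\<bar>tau_sum N l\<bar> \<le> 2 * exp (- pi * \<bar>l\<bar>)"
proof -
  define q where "q = exp (- pi * \<bar>l\<bar>)"
  have q: "0 < q" "q \<le> 1" by (auto simp: q_def)
  have q2: "0 \<le> q ^ (2 * N)" "q ^ (2 * N) \<le> 1" using q by (auto intro: power_le_one)
  have "\<bar>tau_sum N l\<bar> = 2 * \<bar>sgn l\<bar> * (q * ((1 - q ^ (2 * N)) / (1 + q)))"
    unfolding tau_sum_eq q_def[symmetric] using q q2 by (simp add: abs_mult)
  also have "\<dots> \<le> 2 * 1 * (q * 1)"
  proof -
    have "1 - q ^ (2 * N) \<le> 1 + q" using q q2 by linarith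
    then have "(1 - q ^ (2 * N)) / (1 + q) \<le> 1" using q by (subst divide_le_eq_1_pos) auto
    moreover have "0 \<le> (1 - q ^ (2 * N)) / (1 + q)" using q q2 by simp
    ultimately show ?thesis using q by (intro mult_mono mult_nonneg_nonneg) (auto simp: sgn_if)
  qed
  finally show ?thesis by (simp add: q_def)
qed

lemma tau_sum_tendsto:
  assumes "l \<noteq> 0" shows "(\<lambda>N. tau_sum N l) \<longlonglongrightarrow> tau l"
proof -
  define q where "q = exp (- pi * \<bar>l\<bar>)"
  have q: "0 < q" "q < 1" using assms by (auto simp: q_def)
  have "(\<lambda>N. (q\<^sup>2) ^ N) \<longlonglongrightarrow> 0" using q by (intro LIMSEQ_power_zero) (auto simp: power_less_one_iff abs_square_less_1)
  then have "(\<lambda>N. q ^ (2 * N)) \<longlonglongrightarrow> 0" by (simp add: power_mult)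
  then have "(\<lambda>N. - 2 * sgn l * (q * (1 - q ^ (2 * N)) / (1 + q))) \<longlonglongrightarrow> - 2 * sgn l * (q * (1 - 0) / (1 + q))"
    using q by (intro tendsto_intros) auto
  then show ?thesis unfolding tau_sum_eq tau_eq[OF assms] q_def by simp
qed

lemma tau_bound: "\<bar>tau l\<bar> \<le> 2 * exp (- pi * \<bar>l\<bar>)"
proof (cases "l = 0")
  case True then show ?thesis by (simp add: tau_def)
next
  case False
  show ?thesis by (rule tendsto_upperbound[OF tendsto_rabs[OF tau_sum_tendsto[OF False]] always_eventually[OF allI[OF tau_sum_bound]]]) simp
qed

lemma tanh_measurable [measurable]: "(\<lambda>l. tanh (l * pi / 2)) \<in> borel_measurable lebesgue"
  unfolding tanh_real_altdef by measurable

lemma tau_measurable [measurable]: "tau \<in> borel_measurable lebesgue"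
  unfolding tau_def[abs_def] by measurable

lemma integrable_exp_abs: "0 < (e::real) \<Longrightarrow> integrable lebesgue (\<lambda>l. exp (- e * \<bar>l\<bar>))"
  using integrable_norm[OF integrable_abel[of e 0]] by simp

text \<open>Term by term integration turns the geometric expansion of \<open>tau\<close> into the partial fractions of
  the hyperbolic cosecant.\<close>

lemma ft_tau:
  assumes v: "v \<noteq> 0"
  shows "(LINT l|lebesgue. of_real (tau l) * exp (\<i> * of_real (l * v))) = - 2 * \<i> * of_real (1 / v - 1 / sinh v)"
proof (rule LIMSEQ_unique)
  show "(\<lambda>N. LINT l|lebesgue. of_real (tau_sum N l) * exp (\<i> * of_real (l * v))) \<longlonglongrightarrow> (LINT l|lebesgue. of_real (tau l) * exp (\<i> * of_real (l * v)))"
  proof (rule integral_dominated_convergence[where w="\<lambda>l. 2 * exp (- pi * \<bar>l\<bar>)"])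
    show "integrable lebesgue (\<lambda>l. 2 * exp (- pi * \<bar>l\<bar>))" using integrable_exp_abs[of pi] by simp
    show "AE l in lebesgue. (\<lambda>N. of_real (tau_sum N l) * exp (\<i> * of_real (l * v))) \<longlonglongrightarrow> of_real (tau l) * exp (\<i> * of_real (l * v))"
      using AE_lebesgue_neq[of 0] by eventually_elim (intro tendsto_mult tendsto_of_real tau_sum_tendsto tendsto_const)
    show "AE l in lebesgue. norm (of_real (tau_sum N l) * exp (\<i> * of_real (l * v))) \<le> 2 * exp (- pi * \<bar>l\<bar>)" for N
      using tau_sum_bound[of N] by (simp add: norm_mult)
    show "(\<lambda>l. of_real (tau_sum N l) * exp (\<i> * of_real (l * v))) \<in> borel_measurable lebesgue" for N
      unfolding tau_sum_def by measurable
  qed measurable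
  have "(LINT l|lebesgue. of_real (tau_sum N l) * exp (\<i> * of_real (l * v))) =
      - 2 * \<i> * of_real (\<Sum>m<2*N. (-1)^m * (2 * v / ((real (Suc m) * pi)\<^sup>2 + v\<^sup>2)))" for N
  proof -
    have "has_bochner_integral lebesgue (\<lambda>l. \<Sum>m<2*N. (- 2 * (-1)^m) * (of_real (sgn l * exp (- (real (Suc m) * pi) * \<bar>l\<bar>)) * exp (\<i> * of_real (l * v))))
       (\<Sum>m<2*N. (- 2 * (-1)^m) * (\<i> * of_real (2 * v / ((real (Suc m) * pi)\<^sup>2 + v\<^sup>2))))"
      by (intro has_bochner_integral_sum has_bochner_integral_mult_right abel_kernel_odd) simp
    moreover have "(\<Sum>m<2*N. (- 2 * (-1)^m) * (of_real (sgn l * exp (- (real (Suc m) * pi) * \<bar>l\<bar>)) * exp (\<i> * of_real (l * v)))) = of_real (tau_sum N l) * exp (\<i> * of_real (l * v))" for l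
      unfolding tau_sum_def of_real_mult of_real_sum sum_distrib_left sum_distrib_right by (intro sum.cong refl) (simp add: mult_ac)
    moreover have "(\<Sum>m<2*N. (- 2 * (-1)^m) * (\<i> * of_real (2 * v / ((real (Suc m) * pi)\<^sup>2 + v\<^sup>2)))) = - 2 * \<i> * of_real (\<Sum>m<2*N. (-1)^m * (2 * v / ((real (Suc m) * pi)\<^sup>2 + v\<^sup>2)))"
      unfolding of_real_sum sum_distrib_left by (intro sum.cong refl) (simp add: mult_ac)
    ultimately show ?thesis by (simp only: has_bochner_integral_integral_eq)
  qed
  then show "(\<lambda>N. LINT l|lebesgue. of_real (tau_sum N l) * exp (\<i> * of_real (l * v))) \<longlonglongrightarrow> - 2 * \<i> * of_real (1 / v - 1 / sinh v)"
    by (simp only:) (intro tendsto_mult tendsto_const tendsto_of_real csch_partial_fractions v)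
qed

text \<open>A regularisation of \<open>1 / (\<pi> sinh u)\<close> in which only the pole part \<open>1 / u\<close> is replaced by the conjugate
  Poisson kernel. Its Fourier multiplier is \<open>\<i> (exp (-e |l|) sgn l + tau l)\<close>.\<close>

definition csch_reg :: "real \<Rightarrow> real \<Rightarrow> real" where
  "csch_reg e u = (u / (e\<^sup>2 + u\<^sup>2) + 1 / sinh u - 1 / u) / pi"

text \<open>Convolution with \<open>1 / (\<pi> sinh u)\<close> has the multiplier \<open>\<i> tanh (l \<pi> / 2)\<close>, and the regularised
  convolutions converge at almost every point. The multiplier of the regularisation differs from
  the Abel weight times \<open>\<i> tanh (l \<pi> / 2)\<close> by \<open>\<i> tau l (1 - exp (-e |l|))\<close>, which is dominated by an
  \<open>L\<^sup>2\<close> function and tends to \<open>0\<close>; the main part converges by Abel inversion of \<open>G\<close>.\<close>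

theorem csch_convolution:
  assumes h: "h \<in> L2 UNIV" and u: "is_L2_fourier h u"
    and G: "G \<in> L2 UNIV" and w: "is_L2_fourier G (\<lambda>l. \<i> * of_real (tanh (l * pi / 2)) * u l)"
  shows "AE s in lebesgue. ((\<lambda>e. LINT t|lebesgue. h t * of_real (csch_reg e (s - t))) \<longlongrightarrow> G s) (at_right 0)"
  using abel_inversion[OF G w]
proof eventually_elim
  case (elim s)
  have uL: "u \<in> L2 UNIV" by (rule is_L2_fourier_L2[OF u])
  have [measurable]: "u \<in> borel_measurable lebesgue" "h \<in> borel_measurable lebesgue" using uL h L2_measurable by auto
  let ?E = "\<lambda>l. exp (\<i> * of_real (l * - s))"
  have tauL: "(\<lambda>l. \<i> * of_real (tau l) * ?E l) \<in> L2 UNIV"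
    by (rule L2_dominated[OF L2_cmult[OF L2_abel[of pi 0], of 2]]) (use tau_bound in \<open>auto simp: norm_mult\<close>)
  have tauI: "integrable lebesgue (\<lambda>l. \<i> * of_real (tau l) * ?E l)"
    by (rule Bochner_Integration.integrable_bound[of _ "\<lambda>l. 2 * exp (- pi * \<bar>l\<bar>)"])
      (use tau_bound integrable_exp_abs[of pi] in \<open>auto simp: norm_mult\<close>)
  define b where "b e l = \<i> * of_real (tau l) * ?E l * of_real (1 - exp (- e * \<bar>l\<bar>))" for e l
  have [measurable]: "b e \<in> borel_measurable lebesgue" for e unfolding b_def[abs_def] by measurable
  have key: "(LINT t|lebesgue. h t * of_real (csch_reg e (s - t))) = of_real (1 / (2 * pi)) *
     ((LINT l|lebesgue. \<i> * of_real (tanh (l * pi / 2)) * u l * (of_real (exp (- e * \<bar>l\<bar>)) * ?E l)) + (LINT l|lebesgue. u l * b e l))"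
    if e: "e > 0" for e
  proof -
    define a where "a l = \<i> * (of_real (sgn l * exp (- e * \<bar>l\<bar>)) * ?E l) + \<i> * of_real (tau l) * ?E l" for l
    have i1: "integrable lebesgue (\<lambda>l. of_real (sgn l * exp (- e * \<bar>l\<bar>)) * ?E l)"
      using abel_kernel_odd[OF e, of "-s"] by (auto simp: has_bochner_integral_iff)
    have "(\<lambda>l. of_real (sgn l * exp (- e * \<bar>l\<bar>)) * ?E l) \<in> L2 UNIV"
      by (rule L2_dominated[OF L2_abel[OF e, of 0]]) (auto simp: norm_mult sgn_if)
    then have aL: "a \<in> L2 UNIV" unfolding a_def by (intro L2_add tauL L2_cmult)
    have aI: "integrable lebesgue a" unfolding a_def using i1 tauI by (intro Bochner_Integration.integrable_add integrable_mult_right)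
    \<comment> \<open>The sign part of \<open>a\<close> transforms to the conjugate Poisson kernel, the \<open>tau\<close> part to the cosecant
      without its pole. At \<open>t = s\<close> the formulas involve a division by zero.\<close>
    have fta: "ft a t = of_real (2 * pi * csch_reg e (s - t))" if "t \<noteq> s" for t
    proof -
      define v where "v = t - s"
      have v: "v \<noteq> 0" using that by (simp add: v_def)
      have "a l * exp (\<i> * of_real (t * l)) = \<i> * (of_real (sgn l * exp (- e * \<bar>l\<bar>)) * exp (\<i> * of_real (l * v))) + \<i> * (of_real (tau l) * exp (\<i> * of_real (l * v)))" for l
      proof -
        have "exp (\<i> * of_real (l * v)) = ?E l * exp (\<i> * of_real (t * l))"
          unfolding mult_exp_exp v_def by (simp add: algebra_simps)
        then show ?thesis by (simp add: a_def algebra_simps)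
      qed
      then have "ft a t = (LINT l|lebesgue. \<i> * (of_real (sgn l * exp (- e * \<bar>l\<bar>)) * exp (\<i> * of_real (l * v))) + \<i> * (of_real (tau l) * exp (\<i> * of_real (l * v))))"
        unfolding ft_def by simp
      also have "\<dots> = (LINT l|lebesgue. \<i> * (of_real (sgn l * exp (- e * \<bar>l\<bar>)) * exp (\<i> * of_real (l * v)))) + (LINT l|lebesgue. \<i> * (of_real (tau l) * exp (\<i> * of_real (l * v))))"
      proof (rule Bochner_Integration.integral_add)
        show "integrable lebesgue (\<lambda>l. \<i> * (of_real (sgn l * exp (- e * \<bar>l\<bar>)) * exp (\<i> * of_real (l * v))))"
          using abel_kernel_odd[OF e, of v] by (intro integrable_mult_right) (auto simp: has_bochner_integral_iff)
        show "integrable lebesgue (\<lambda>l. \<i> * (of_real (tau l) * exp (\<i> * of_real (l * v))))"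
          by (rule Bochner_Integration.integrable_bound[of _ "\<lambda>l. 2 * exp (- pi * \<bar>l\<bar>)"])
            (use tau_bound integrable_exp_abs[of pi] in \<open>auto simp: norm_mult\<close>)
      qed
      also have "\<dots> = \<i> * (\<i> * of_real (2 * v / (e\<^sup>2 + v\<^sup>2))) + \<i> * (- 2 * \<i> * of_real (1 / v - 1 / sinh v))"
        unfolding integral_mult_right_zero ft_tau[OF v] has_bochner_integral_integral_eq[OF abel_kernel_odd[OF e]] ..
      also have "\<dots> = of_real (- (2 * v / (e\<^sup>2 + v\<^sup>2)) + 2 * (1 / v - 1 / sinh v))"
        by (simp add: algebra_simps)
      also have "- (2 * v / (e\<^sup>2 + v\<^sup>2)) + 2 * (1 / v - 1 / sinh v) = 2 * pi * csch_reg e (s - t)"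
      proof -
        have st: "s - t = - v" by (simp add: v_def)
        have "2 * pi * csch_reg e (- v) = 2 * (- v / (e\<^sup>2 + v\<^sup>2) - 1 / sinh v + 1 / v)"
          by (simp add: csch_reg_def)
        then show ?thesis unfolding st by (simp add: algebra_simps)
      qed
      finally show ?thesis .
    qed
    have "(LINT t|lebesgue. h t * ft a t) = (LINT t|lebesgue. of_real (2 * pi) * (h t * of_real (csch_reg e (s - t))))"
    proof (rule integral_cong_AE)
      show "AE t in lebesgue. h t * ft a t = of_real (2 * pi) * (h t * of_real (csch_reg e (s - t)))"
        using AE_lebesgue_neq[of s] by eventually_elim (simp add: fta)
    qed (use aI in \<open>auto simp: csch_reg_def sinh_field_def\<close>)
    also have "\<dots> = of_real (2 * pi) * (LINT t|lebesgue. h t * of_real (csch_reg e (s - t)))" by simp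
    finally have "of_real (2 * pi) * (LINT t|lebesgue. h t * of_real (csch_reg e (s - t))) = (LINT l|lebesgue. u l * a l)"
      using L2_fourier_multiplication_formula[OF h u aI aL] by simp
    also have "\<dots> = (LINT l|lebesgue. \<i> * of_real (tanh (l * pi / 2)) * u l * (of_real (exp (- e * \<bar>l\<bar>)) * ?E l) + u l * b e l)"
    proof (rule Bochner_Integration.integral_cong[OF refl])
      fix l
      have "tanh (l * pi / 2) = tau l + sgn l" by (simp add: tau_def)
      then show "u l * a l = \<i> * of_real (tanh (l * pi / 2)) * u l * (of_real (exp (- e * \<bar>l\<bar>)) * ?E l) + u l * b e l"
        by (simp add: a_def b_def algebra_simps)
    qed
    also have "\<dots> = (LINT l|lebesgue. \<i> * of_real (tanh (l * pi / 2)) * u l * (of_real (exp (- e * \<bar>l\<bar>)) * ?E l)) + (LINT l|lebesgue. u l * b e l)"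
    proof (rule Bochner_Integration.integral_add)
      show "integrable lebesgue (\<lambda>l. \<i> * of_real (tanh (l * pi / 2)) * u l * (of_real (exp (- e * \<bar>l\<bar>)) * ?E l))"
        by (rule L2_integrable_mult[OF is_L2_fourier_L2[OF w] L2_abel[OF e]])
      have "b e \<in> L2 UNIV"
        by (rule L2_dominated[OF tauL]) (use e in \<open>auto simp: b_def norm_mult norm_of_real mult_left_le simp del: of_real_diff\<close>)
      then show "integrable lebesgue (\<lambda>l. u l * b e l)" by (rule L2_integrable_mult[OF uL])
    qed
    finally show ?thesis by (simp add: field_simps)
  qed
  have "((\<lambda>e. LINT l|lebesgue. u l * b e l) \<longlongrightarrow> (LINT l|(lebesgue :: real measure). (0::complex))) (at_right 0)"
  proof (rule integral_dominated_at_right[where f="\<lambda>e l. u l * b e l" and M=lebesgue and g="\<lambda>l. 0" and b=1 and w="\<lambda>l. cmod (u l * (\<i> * of_real (tau l) * ?E l))"])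
    show "integrable lebesgue (\<lambda>l. cmod (u l * (\<i> * of_real (tau l) * ?E l)))"
      by (intro integrable_norm L2_integrable_mult uL tauL)
    show "AE l in lebesgue. cmod (u l * b e l) \<le> cmod (u l * (\<i> * of_real (tau l) * ?E l))" if "e > 0" for e
      using that by (auto simp: b_def norm_mult mult_left_le mult_left_mono simp del: of_real_diff)
    show "AE l in lebesgue. ((\<lambda>e. u l * b e l) \<longlongrightarrow> 0) (at_right 0)"
    proof (rule AE_I2)
      fix l
      have "((\<lambda>e. u l * (\<i> * of_real (tau l) * ?E l * of_real (1 - exp (- e * \<bar>l\<bar>)))) \<longlongrightarrow> u l * (\<i> * of_real (tau l) * ?E l * of_real (1 - exp (- 0 * \<bar>l\<bar>)))) (at_right 0)"
        by (intro tendsto_intros)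
      then show "((\<lambda>e. u l * b e l) \<longlongrightarrow> 0) (at_right 0)" by (simp add: b_def)
    qed
    show "(\<lambda>l. u l * b e l) \<in> borel_measurable lebesgue" for e unfolding b_def by measurable
  qed auto
  then have "((\<lambda>e. of_real (1 / (2 * pi)) *
     ((LINT l|lebesgue. \<i> * of_real (tanh (l * pi / 2)) * u l * (of_real (exp (- e * \<bar>l\<bar>)) * ?E l)) + (LINT l|lebesgue. u l * b e l)))
     \<longlongrightarrow> of_real (1 / (2 * pi)) * (of_real (2 * pi) * G s + 0)) (at_right 0)"
    by (intro tendsto_mult tendsto_add tendsto_const elim) simp
  then have "((\<lambda>e. of_real (1 / (2 * pi)) *
     ((LINT l|lebesgue. \<i> * of_real (tanh (l * pi / 2)) * u l * (of_real (exp (- e * \<bar>l\<bar>)) * ?E l)) + (LINT l|lebesgue. u l * b e l)))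
     \<longlongrightarrow> G s) (at_right 0)" by simp
  then show ?case
    by (rule Lim_transform_eventually) (use key eventually_at_right_0 in \<open>auto elim!: eventually_mono\<close>)
qed

section \<open>The intervals and the logarithm of the quotient\<close>

text \<open>The mean value inequality, applied to \<open>f'\<close> and then to \<open>f - f' s * t\<close>. The constant is twice the
  one of Taylor's formula.\<close>

lemma second_order_bound:
  fixes f f' f'' :: "real \<Rightarrow> real"
  assumes f: "\<And>t. \<bar>t - s\<bar> \<le> 1 \<Longrightarrow> (f has_real_derivative f' t) (at t)"
    and f': "\<And>t. \<bar>t - s\<bar> \<le> 1 \<Longrightarrow> (f' has_real_derivative f'' t) (at t)"
    and B: "\<And>t. \<bar>t - s\<bar> \<le> 1 \<Longrightarrow> \<bar>f'' t\<bar> \<le> B" and t: "\<bar>t - s\<bar> \<le> 1"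
  shows "\<bar>f t - f s - f' s * (t - s)\<bar> \<le> B * (t - s)\<^sup>2"
proof -
  let ?S = "closed_segment s t"
  have S: "\<bar>r - s\<bar> \<le> \<bar>t - s\<bar>" if "r \<in> ?S" for r
    using that segment_bound1[of r s t] by simp
  have S1: "\<bar>r - s\<bar> \<le> 1" if "r \<in> ?S" for r using S[OF that] t by linarith
  have lip: "\<bar>f' r - f' s\<bar> \<le> B * \<bar>t - s\<bar>" if r: "r \<in> ?S" for r
  proof -
    have "norm (f' r - f' s) \<le> B * norm (r - s)"
      by (rule field_differentiable_bound[of ?S f' f'']) (use r f' B S1 in \<open>auto intro: has_field_derivative_at_within\<close>)
    also have "\<dots> \<le> B * \<bar>t - s\<bar>"
      using S[OF r] order_trans[OF abs_ge_zero B[of s]] by (intro mult_left_mono) auto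
    finally show ?thesis by simp
  qed
  have "norm ((f t - f' s * t) - (f s - f' s * s)) \<le> (B * \<bar>t - s\<bar>) * norm (t - s)"
  proof (rule field_differentiable_bound[of ?S "\<lambda>r. f r - f' s * r" "\<lambda>r. f' r - f' s"])
    show "((\<lambda>r. f r - f' s * r) has_real_derivative f' r - f' s) (at r within ?S)" if "r \<in> ?S" for r
      using DERIV_diff[OF f[OF S1[OF that]] DERIV_cmult[OF DERIV_ident, of "f' s"]]
      by (simp add: has_field_derivative_at_within)
  qed (use lip in auto)
  then show ?thesis by (simp add: algebra_simps power2_eq_square abs_mult)
qed

lemma poly_prod_linear:
  fixes a :: "nat \<Rightarrow> real" and x :: real
  shows "poly (\<Prod>j<n. [:- a j, 1:]) x = (\<Prod>j<n. x - a j)"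
  unfolding poly_prod by (intro prod.cong refl) simp

lemma pderiv_prod_linear:
  fixes a :: "nat \<Rightarrow> real"
  assumes "\<And>j. j < n \<Longrightarrow> x \<noteq> a j"
  shows "poly (pderiv (\<Prod>j<n. [:- a j, 1:])) x = poly (\<Prod>j<n. [:- a j, 1:]) x * (\<Sum>j<n. 1 / (x - a j))"
  using assms
proof (induction n)
  case (Suc n)
  define P L where "P = (\<Prod>j<n. [:- a j, 1:])" and "L = [:- a n, 1:]"
  have nz: "x - a n \<noteq> 0" using Suc.prems[of n] by simp
  have L: "poly L x = x - a n" "poly (pderiv L) x = 1" by (auto simp: L_def pderiv_pCons)
  have IH: "poly (pderiv P) x = poly P x * (\<Sum>j<n. 1 / (x - a j))"
    unfolding P_def by (rule Suc.IH) (use Suc.prems in auto)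
  have "poly (pderiv (P * L)) x = poly P x * ((x - a n) * ((\<Sum>j<n. 1 / (x - a j)) + 1 / (x - a n)))"
    using nz by (simp add: pderiv_mult L IH distrib_left)
  then show ?case unfolding prod.lessThan_Suc sum.lessThan_Suc P_def[symmetric] L_def[symmetric] poly_mult L
    by (simp only: mult.assoc)
qed simp

locale multi_intervals =
  fixes n :: nat and \<alpha> \<beta> :: "nat \<Rightarrow> real"
  assumes n_pos: "1 \<le> n"
    and ab: "\<And>j. j < n \<Longrightarrow> \<alpha> j < \<beta> j"
    and ba: "\<And>j. Suc j < n \<Longrightarrow> \<beta> j < \<alpha> (Suc j)"
begin

abbreviation "bev \<equiv> poly (beta_ev n \<beta>)"
abbreviation "bod \<equiv> poly (beta_od n \<alpha>)"
abbreviation "Q \<equiv> poly (Q_poly n \<alpha> \<beta>)"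
abbreviation "\<phi> \<equiv> phi n \<alpha> \<beta>"
abbreviation "J k \<equiv> {\<alpha> k<..<\<beta> k}"

text \<open>The logarithmic derivative of \<open>\<beta>\<^sub>e\<^sub>v / \<beta>\<^sub>o\<^sub>d\<close>, that is, the derivative of \<open>\<phi>\<close>.\<close>

definition dphi :: "real \<Rightarrow> real" where
  "dphi x = (\<Sum>j<n. 1 / (x - \<beta> j)) - (\<Sum>j<n. 1 / (x - \<alpha> j))"

definition ddphi :: "real \<Rightarrow> real" where
  "ddphi x = (\<Sum>j<n. - 1 / (x - \<beta> j)\<^sup>2) - (\<Sum>j<n. - 1 / (x - \<alpha> j)\<^sup>2)"

text \<open>The weight of the isometry: up to the factor \<open>sqrt 2\<close>, the function that multiplies \<open>f\<close>.\<close>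

definition weight :: "real \<Rightarrow> real" where
  "weight x = sgn (bod x) / sqrt \<bar>dphi x\<bar>"

definition X :: "nat \<Rightarrow> real \<Rightarrow> real" where "X k t = phi_inv n \<alpha> \<beta> k (2 * t)"

lemma bev_eq: "bev x = (\<Prod>j<n. x - \<beta> j)" by (simp add: beta_ev_def poly_prod_linear)
lemma bod_eq: "bod x = (\<Prod>j<n. x - \<alpha> j)" by (simp add: beta_od_def poly_prod_linear)

lemma intervals_ordered: "j < k \<Longrightarrow> k < n \<Longrightarrow> \<beta> j < \<alpha> k"
proof (induction k)
  case (Suc k)
  show ?case
  proof (cases "j = k")
    case True then show ?thesis using ba[of k] Suc.prems by simp
  next
    case False
    then have "\<beta> j < \<alpha> k" using Suc by auto
    also have "\<alpha> k < \<beta> k" using Suc.prems by (intro ab) auto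
    also have "\<beta> k < \<alpha> (Suc k)" using Suc.prems by (intro ba) auto
    finally show ?thesis .
  qed
qed simp

lemma other_factor_pos:
  assumes "k < n" "j < n" "j \<noteq> k" "x \<in> {\<alpha> k..\<beta> k}" "y \<in> {\<alpha> k..\<beta> k}"
  shows "(x - \<beta> j) * (y - \<alpha> j) > 0"
proof (cases "j < k")
  case True
  then show ?thesis using intervals_ordered[of j k] ab[of j] assms by (intro mult_pos_pos) auto
next
  case False
  then show ?thesis using intervals_ordered[of k j] ab[of j] assms by (intro mult_neg_neg) auto
qed

text \<open>Factors belonging to another interval have equal signs, the two factors of the interval
  itself have opposite signs. Each point may be the endpoint at which its factor does not vanish; this
  case gives the sign change that makes \<open>\<phi>\<close> surjective.\<close>

lemma bev_bod_cross_neg: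
  assumes k: "k < n" and x: "x \<in> {\<alpha> k..\<beta> k}" "y \<in> {\<alpha> k..\<beta> k}" "x < \<beta> k" "\<alpha> k < y"
  shows "bev x * bod y < 0"
proof -
  have "bev x * bod y = (\<Prod>j<n. (x - \<beta> j) * (y - \<alpha> j))"
    by (simp add: bev_eq bod_eq prod.distrib)
  also have "\<dots> = ((x - \<beta> k) * (y - \<alpha> k)) * (\<Prod>j\<in>{..<n} - {k}. (x - \<beta> j) * (y - \<alpha> j))"
    using k by (intro prod.remove) auto
  also have "\<dots> < 0"
  proof (rule mult_neg_pos)
    show "(x - \<beta> k) * (y - \<alpha> k) < 0" using x by (intro mult_neg_pos) auto
    show "0 < (\<Prod>j\<in>{..<n} - {k}. (x - \<beta> j) * (y - \<alpha> j))"
      using other_factor_pos[OF k] x by (intro prod_pos) auto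
  qed
  finally show ?thesis .
qed

lemma bev_bod_neg: "k < n \<Longrightarrow> x \<in> J k \<Longrightarrow> bev x * bod x < 0"
  by (rule bev_bod_cross_neg) auto

lemma ratio_neg: "k < n \<Longrightarrow> x \<in> J k \<Longrightarrow> bev x / bod x < 0"
  using bev_bod_neg[of k x] by (auto simp: mult_less_0_iff divide_less_0_iff)

lemma interior_not_endpoint:
  assumes "k < n" "x \<in> J k" "j < n" shows "x \<noteq> \<alpha> j" "x \<noteq> \<beta> j"
  using other_factor_pos[of k j x x] assms by (cases "j = k"; force)+

lemma bod_nonzero: "k < n \<Longrightarrow> x \<in> J k \<Longrightarrow> bod x \<noteq> 0"
  using bev_bod_neg[of k x] by auto

text \<open>Regrouped so that \<open>\<beta>\<^sub>j\<close> is paired with \<open>\<alpha>\<^sub>j\<^sub>+\<^sub>1\<close>, every summand is negative: the gap between two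
  neighbouring intervals lies on one side of \<open>x\<close>.\<close>

lemma dphi_neg:
  assumes k: "k < n" and x: "x \<in> J k"
  shows "dphi x < 0"
proof -
  obtain m where m: "n = Suc m" using n_pos by (cases n) auto
  have split: "dphi x = (1 / (x - \<beta> m) - 1 / (x - \<alpha> 0)) + (\<Sum>j<m. 1 / (x - \<beta> j) - 1 / (x - \<alpha> (Suc j)))"
  proof -
    have "dphi x = (\<Sum>j<Suc m. 1 / (x - \<beta> j)) - (\<Sum>j<Suc m. 1 / (x - \<alpha> j))"
      by (simp only: dphi_def m[symmetric])
    then show ?thesis by (subst (asm) sum.lessThan_Suc, subst (asm) sum.lessThan_Suc_shift) (simp add: sum_subtractf)
  qed
  have mono: "\<beta> i \<le> \<beta> j" "\<alpha> i \<le> \<alpha> j" if "i \<le> j" "j < n" for i j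
    using that intervals_ordered[of i j] ab[of i] ab[of j] by (cases "i = j"; force)+
  have "1 / (x - \<beta> j) - 1 / (x - \<alpha> (Suc j)) \<le> 0" if j: "j < m" for j
  proof -
    have lt: "x - \<alpha> (Suc j) < x - \<beta> j" using ba[of j] j m by simp
    have "0 < (x - \<beta> j) * (x - \<alpha> (Suc j))"
    proof (cases "j < k")
      case True
      then have "\<alpha> (Suc j) \<le> \<alpha> k" using mono[of "Suc j" k] k by simp
      then show ?thesis using x lt by (intro mult_pos_pos) auto
    next
      case False
      then have "\<beta> k \<le> \<beta> j" using mono[of k j] j m by simp
      then show ?thesis using x lt by (intro mult_neg_neg) auto
    qed
    then have "1 / (x - \<beta> j) < 1 / (x - \<alpha> (Suc j))" using lt by (intro divide_strict_left_mono) auto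
    then show ?thesis by simp
  qed
  then have "(\<Sum>j<m. 1 / (x - \<beta> j) - 1 / (x - \<alpha> (Suc j))) \<le> 0" by (intro sum_nonpos) auto
  moreover have "1 / (x - \<beta> m) < 0" "1 / (x - \<alpha> 0) > 0" using mono[of k m] mono[of 0 k] k m x by auto
  ultimately show ?thesis unfolding split by linarith
qed

lemma Q_eq:
  assumes k: "k < n" and x: "x \<in> J k"
  shows "Q x = dphi x * (bev x * bod x)"
proof -
  note ne = interior_not_endpoint[OF k x]
  show ?thesis
    unfolding Q_poly_def beta_ev_def beta_od_def dphi_def
    using pderiv_prod_linear[of n x \<beta>] pderiv_prod_linear[of n x \<alpha>] ne by (simp add: algebra_simps)
qed

lemma Q_pos: "k < n \<Longrightarrow> x \<in> J k \<Longrightarrow> Q x > 0"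
  using Q_eq[of k x] dphi_neg[of k x] bev_bod_neg[of k x] by (simp add: mult_neg_neg)

lemma exp_phi:
  assumes "k < n" "x \<in> J k" shows "bev x = - exp (\<phi> x) * bod x"
proof -
  have "exp (\<phi> x) = - (bev x / bod x)"
    unfolding phi_def abs_of_neg[OF ratio_neg[OF assms]] using ratio_neg[OF assms] by (subst exp_ln) auto
  then show ?thesis using bod_nonzero[OF assms] by simp
qed

lemma phi_deriv:
  assumes k: "k < n" and x: "x \<in> J k"
  shows "(\<phi> has_real_derivative dphi x) (at x)"
proof -
  have nz: "bod x \<noteq> 0" "bev x \<noteq> 0" using bev_bod_neg[OF k x] by auto
  have "((\<lambda>z. ln (- (bev z / bod z))) has_real_derivative
     (- ((poly (pderiv (beta_ev n \<beta>)) x * bod x - bev x * poly (pderiv (beta_od n \<alpha>)) x) / (bod x * bod x))) / (- (bev x / bod x))) (at x)"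
    using ratio_neg[OF k x] nz by (auto intro!: derivative_eq_intros)
  also have "(- ((poly (pderiv (beta_ev n \<beta>)) x * bod x - bev x * poly (pderiv (beta_od n \<alpha>)) x) / (bod x * bod x))) / (- (bev x / bod x)) = Q x / (bev x * bod x)"
    using nz by (simp add: Q_poly_def field_simps)
  also have "\<dots> = dphi x" unfolding Q_eq[OF k x] using nz by simp
  finally show ?thesis
  proof (rule has_field_derivative_transform_within_open)
    show "ln (- (bev z / bod z)) = \<phi> z" if "z \<in> J k" for z
      by (simp only: phi_def abs_of_neg[OF ratio_neg[OF k that]])
  qed (use x in auto)
qed

lemma deriv_phi: "k < n \<Longrightarrow> x \<in> J k \<Longrightarrow> deriv \<phi> x = dphi x"
  by (rule DERIV_imp_deriv[OF phi_deriv])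

lemma dphi_deriv:
  assumes "k < n" "x \<in> J k" shows "(dphi has_real_derivative ddphi x) (at x)"
proof -
  note ne = interior_not_endpoint[OF assms]
  have "((\<lambda>x. 1 / (x - a)) has_real_derivative - 1 / (x - a)\<^sup>2) (at x)" if "x \<noteq> a" for a
    using that by (auto intro!: derivative_eq_intros simp: power2_eq_square)
  then show ?thesis unfolding dphi_def[abs_def] ddphi_def using ne
    by (intro DERIV_diff DERIV_sum) auto
qed

lemma ddphi_continuous: "k < n \<Longrightarrow> continuous_on (J k) ddphi"
  unfolding ddphi_def using interior_not_endpoint[of k] by (intro continuous_intros) auto

lemma phi_strict_decreasing:
  assumes "k < n" "x \<in> J k" "y \<in> J k" "x < y" shows "\<phi> y < \<phi> x"
proof (rule DERIV_neg_imp_decreasing[OF \<open>x < y\<close>])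
  fix z assume "x \<le> z" "z \<le> y"
  then have "z \<in> J k" using assms by auto
  then show "\<exists>d. (\<phi> has_real_derivative d) (at z) \<and> d < 0" using phi_deriv dphi_neg assms(1) by blast
qed

lemma phi_inj: "k < n \<Longrightarrow> inj_on \<phi> (J k)"
  using phi_strict_decreasing[of k] by (intro inj_onI) (metis less_irrefl linorder_cases)

text \<open>The equation \<open>\<phi> x = y\<close> says \<open>\<beta>\<^sub>e\<^sub>v x + exp y \<beta>\<^sub>o\<^sub>d x = 0\<close>, and this polynomial changes sign between the
  endpoints of the interval.\<close>

lemma phi_surj:
  assumes k: "k < n" shows "\<phi> ` J k = UNIV"
proof -
  have "\<exists>x\<in>J k. \<phi> x = y" for y
  proof -
    define f where "f x = bev x + exp y * bod x" for x
    have bev_b: "bev (\<beta> k) = 0" "bod (\<alpha> k) = 0" using k by (auto simp: bev_eq bod_eq)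
    have "bev (\<alpha> k) * bod (\<beta> k) < 0" using ab[OF k] by (intro bev_bod_cross_neg[OF k]) auto
    then have "f (\<alpha> k) * f (\<beta> k) < 0"
      using mult_pos_neg[of "exp y" "bev (\<alpha> k) * bod (\<beta> k)"] by (simp add: f_def bev_b mult_ac)
    moreover have "continuous_on {\<alpha> k..\<beta> k} f" unfolding f_def by (intro continuous_intros)
    ultimately obtain x where x: "\<alpha> k \<le> x" "x \<le> \<beta> k" "f x = 0"
      using IVT'[of f "\<alpha> k" 0 "\<beta> k"] IVT2'[of f "\<beta> k" 0 "\<alpha> k"] ab[OF k]
      by (metis less_imp_le mult_less_0_iff)
    have "x \<noteq> \<alpha> k" "x \<noteq> \<beta> k" using x(3) \<open>f (\<alpha> k) * f (\<beta> k) < 0\<close> by auto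
    then have xJ: "x \<in> J k" using x by auto
    have "bev x / bod x = - exp y" using x(3) bod_nonzero[OF k xJ] by (simp add: f_def field_simps)
    then have "\<phi> x = y" by (simp add: phi_def)
    then show ?thesis using xJ by blast
  qed
  then have "y \<in> \<phi> ` J k" for y by (metis imageI)
  then show ?thesis by auto
qed

lemma X_in: "k < n \<Longrightarrow> X k t \<in> J k"
  unfolding X_def phi_inv_def by (rule inv_into_into) (simp add: phi_surj)

lemma phi_X: "k < n \<Longrightarrow> \<phi> (X k t) = 2 * t"
  unfolding X_def phi_inv_def by (rule f_inv_into_f) (simp add: phi_surj)

lemma X_phi: "k < n \<Longrightarrow> x \<in> J k \<Longrightarrow> X k (\<phi> x / 2) = x"
  unfolding X_def phi_inv_def by (simp add: inv_into_f_f phi_inj)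

lemma X_image: "k < n \<Longrightarrow> X k ` UNIV = J k"
  using X_in X_phi by (auto simp: image_iff) (metis greaterThanLessThan_iff)

lemma X_inj: "k < n \<Longrightarrow> inj (X k)"
  by (metis injI phi_X mult_left_cancel zero_neq_numeral)

lemma X_deriv:
  assumes k: "k < n" shows "(X k has_real_derivative 2 / dphi (X k t)) (at t)"
proof -
  let ?x = "X k t"
  have x: "?x \<in> J k" by (rule X_in[OF k])
  have cont: "isCont (X k) (\<phi> ?x / 2)"
  proof -
    define d where "d = min (?x - \<alpha> k) (\<beta> k - ?x) / 2"
    have d: "d > 0" using x by (auto simp: d_def)
    have in_J: "z \<in> J k" if "\<bar>z - ?x\<bar> \<le> d" for z
    proof -
      have "\<alpha> k < ?x" "?x < \<beta> k" using x by auto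
      then have "d < ?x - \<alpha> k" "d < \<beta> k - ?x" by (auto simp: d_def min_def)
      moreover have "z - ?x \<le> d" "- (z - ?x) \<le> d" using abs_le_D1[OF that] abs_le_D2[OF that] .
      ultimately show ?thesis by auto
    qed
    show ?thesis
    proof (rule isCont_inverse_function[of d ?x "X k" "\<lambda>z. \<phi> z / 2"])
      show "X k (\<phi> z / 2) = z" if "\<bar>z - ?x\<bar> \<le> d" for z by (rule X_phi[OF k in_J[OF that]])
      show "isCont (\<lambda>z. \<phi> z / 2) z" if "\<bar>z - ?x\<bar> \<le> d" for z
        using DERIV_isCont[OF phi_deriv[OF k in_J[OF that]]] by (intro continuous_intros) auto
    qed (rule d)
  qed
  have "(X k has_real_derivative inverse (dphi ?x / 2)) (at t)"
  proof (rule DERIV_inverse_function[where a="t - 1" and b="t + 1" and f="\<lambda>z. \<phi> z / 2"])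
    show "((\<lambda>z. \<phi> z / 2) has_real_derivative dphi ?x / 2) (at ?x)"
      by (intro DERIV_cdivide phi_deriv[OF k x])
    show "dphi ?x / 2 \<noteq> 0" using dphi_neg[OF k x] by simp
    show "\<phi> (X k y) / 2 = y" for y by (simp add: phi_X[OF k])
    show "isCont (X k) t" using cont by (simp add: phi_X[OF k])
  qed auto
  then show ?thesis by (simp add: inverse_eq_divide)
qed

lemma X_continuous: "k < n \<Longrightarrow> continuous_on A (X k)"
  using X_deriv by (meson DERIV_isCont continuous_at_imp_continuous_on)

text \<open>Smoothness of \<open>X k\<close> beyond the first derivative is needed to compare distances in \<open>x\<close> with distances in
  \<open>t\<close> up to a quadratic error.\<close>

lemma X_deriv2:
  assumes k: "k < n"
  shows "((\<lambda>t. 2 / dphi (X k t)) has_real_derivative - 4 * ddphi (X k t) / dphi (X k t) ^ 3) (at t)"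
proof -
  have "dphi (X k t) \<noteq> 0" using dphi_neg[OF k X_in[OF k]] by (metis less_irrefl)
  moreover have "((\<lambda>t. dphi (X k t)) has_real_derivative ddphi (X k t) * (2 / dphi (X k t))) (at t)"
    by (rule DERIV_chain2[OF dphi_deriv[OF k X_in[OF k]] X_deriv[OF k]])
  ultimately show ?thesis
    by (auto intro!: derivative_eq_intros simp: power3_eq_cube)
qed

lemma X_second_order:
  assumes k: "k < n"
  obtains B where "\<And>t. \<bar>t - s\<bar> \<le> 1 \<Longrightarrow> \<bar>X k t - X k s - 2 / dphi (X k s) * (t - s)\<bar> \<le> B * (t - s)\<^sup>2"
proof -
  let ?f = "\<lambda>t. - 4 * ddphi (X k t) / dphi (X k t) ^ 3"
  have nz: "dphi (X k t) \<noteq> 0" for t using dphi_neg[OF k X_in[OF k]] by (metis less_irrefl)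
  have "continuous_on UNIV (\<lambda>t. ddphi (X k t))"
    by (rule continuous_on_compose2[OF ddphi_continuous[OF k] X_continuous[OF k]]) (use X_in[OF k] in auto)
  moreover have "continuous_on (J k) dphi"
    using dphi_deriv[OF k] by (meson DERIV_isCont continuous_at_imp_continuous_on)
  then have "continuous_on UNIV (\<lambda>t. dphi (X k t))"
    by (rule continuous_on_compose2[OF _ X_continuous[OF k]]) (use X_in[OF k] in auto)
  ultimately have "continuous_on UNIV ?f" using nz by (intro continuous_intros) auto
  then have "continuous_on (cball s 1) ?f" by (rule continuous_on_subset) auto
  then have "bounded (?f ` cball s 1)" by (intro compact_imp_bounded compact_continuous_image) auto
  then obtain B where B: "\<And>t. t \<in> cball s 1 \<Longrightarrow> \<bar>?f t\<bar> \<le> B" unfolding bounded_iff by (auto simp del: mem_cball)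
  show ?thesis
  proof (rule that)
    fix t assume "\<bar>t - s\<bar> \<le> 1"
    then show "\<bar>X k t - X k s - 2 / dphi (X k s) * (t - s)\<bar> \<le> B * (t - s)\<^sup>2"
      by (intro second_order_bound[where f''="?f"] X_deriv X_deriv2 k B) (auto simp: dist_real_def)
  qed
qed

end

section \<open>The Bezout form and the factorisation of the Cauchy kernel\<close>

locale bezout_setting = multi_intervals +
  fixes \<rho> :: "nat \<Rightarrow> real" and B W :: "real mat"
  assumes bezout: "is_bezout_mat n (beta_ev n \<beta>) (beta_od n \<alpha>) B"
    and W: "W \<in> carrier_mat n n"
    and B_eq: "B = transpose_mat W * mat_diag n \<rho> * W"
begin

abbreviation "P j z \<equiv> P_fun n W j z"
abbreviation "M j k t \<equiv> M_fun n \<alpha> \<beta> W \<rho> j k t"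

abbreviation "\<omega> k t \<equiv> weight (X k t)"

text \<open>Entry \<open>(k, l)\<close> of the product of the transposed matrix function at \<open>t\<close> with the matrix function
  at \<open>s\<close>.\<close>

definition A :: "nat \<Rightarrow> nat \<Rightarrow> real \<Rightarrow> real \<Rightarrow> real" where
  "A k l t s = (\<Sum>j<n. M j k t * M j l s)"

lemma M_eq: "M j k t = P j (X k t) * sqrt (\<rho> j / Q (X k t))"
  unfolding M_fun_def X_def Let_def ..

lemma P_eq: "j < n \<Longrightarrow> P j z = (\<Sum>i<n. z ^ i * W $$ (j, i))"
  unfolding P_fun_def using W by (intro sum.cong refl) auto

lemma B_entry:
  assumes "i < n" "j < n" shows "B $$ (i, j) = (\<Sum>m<n. W $$ (m, i) * \<rho> m * W $$ (m, j))"
proof -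
  have "transpose_mat W * mat_diag n \<rho> = Matrix.mat n n (\<lambda>(i,j). transpose_mat W $$ (i,j) * \<rho> j)"
    using W by (intro mat_diag_mult_right) auto
  then show ?thesis unfolding B_eq using assms W
    by (auto simp: scalar_prod_def lessThan_atLeast0 intro!: sum.cong)
qed

text \<open>The Bezout form in the eigenvector coordinates.\<close>

lemma bezout_sum:
  assumes "x \<noteq> z"
  shows "(\<Sum>m<n. \<rho> m * (P m x * P m z)) = (bev x * bod z - bev z * bod x) / (x - z)"
proof -
  have "(\<Sum>i<n. \<Sum>j<n. B $$ (i, j) * z ^ i * x ^ j) = (bev x * bod z - bev z * bod x) / (x - z)"
    using bezout assms unfolding is_bezout_mat_def by blast
  moreover have "(\<Sum>i<n. \<Sum>j<n. B $$ (i, j) * z ^ i * x ^ j) = (\<Sum>i<n. \<Sum>j<n. \<Sum>m<n. \<rho> m * ((x ^ j * W $$ (m, j)) * (z ^ i * W $$ (m, i))))"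
    by (intro sum.cong refl) (simp add: B_entry sum_distrib_right sum_distrib_left mult_ac)
  also have "\<dots> = (\<Sum>i<n. \<Sum>m<n. \<Sum>j<n. \<rho> m * ((x ^ j * W $$ (m, j)) * (z ^ i * W $$ (m, i))))"
    by (rule sum.cong[OF refl], rule sum.swap)
  also have "\<dots> = (\<Sum>m<n. \<Sum>i<n. \<Sum>j<n. \<rho> m * ((x ^ j * W $$ (m, j)) * (z ^ i * W $$ (m, i))))"
    by (rule sum.swap)
  also have "\<dots> = (\<Sum>m<n. \<rho> m * (P m x * P m z))"
  proof (intro sum.cong refl)
    fix m assume "m \<in> {..<n}"
    then have m: "m < n" by simp
    have "P m x * P m z = (\<Sum>i<n. \<Sum>j<n. (x ^ j * W $$ (m, j)) * (z ^ i * W $$ (m, i)))"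
      unfolding P_eq[OF m] by (subst sum.swap) (simp add: sum_product)
    then show "(\<Sum>i<n. \<Sum>j<n. \<rho> m * ((x ^ j * W $$ (m, j)) * (z ^ i * W $$ (m, i)))) = \<rho> m * (P m x * P m z)"
      by (simp only: sum_distrib_left)
  qed
  ultimately show ?thesis by simp
qed

lemma P_isCont: "isCont (P j) x"
  unfolding P_fun_def by (intro continuous_intros)

text \<open>The limit of the Bezout form as \<open>x\<close> tends to \<open>z\<close>: the divided difference of the numerator tends to \<open>Q\<close>.\<close>

lemma bezout_diagonal: "(\<Sum>m<n. \<rho> m * (P m x * P m x)) = Q x"
proof (rule tendsto_unique[of "at x"])
  have "((\<lambda>z. \<Sum>m<n. \<rho> m * (P m x * P m z)) \<longlongrightarrow> (\<Sum>m<n. \<rho> m * (P m x * P m x))) (at x)"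
    using P_isCont by (intro tendsto_intros) (auto simp: isCont_def)
  then show "((\<lambda>z. (bev x * bod z - bev z * bod x) / (x - z)) \<longlongrightarrow> (\<Sum>m<n. \<rho> m * (P m x * P m x))) (at x)"
    by (rule Lim_transform_eventually) (auto simp: eventually_at_filter bezout_sum intro!: always_eventually)
  have "((\<lambda>z. bev x * bod z - bev z * bod x) has_real_derivative - Q x) (at x)"
    by (auto intro!: derivative_eq_intros simp: Q_poly_def)
  then have "((\<lambda>z. - ((bev x * bod z - bev z * bod x - (bev x * bod x - bev x * bod x)) / (z - x))) \<longlongrightarrow> - (- Q x)) (at x)"
    unfolding has_field_derivative_iff by (intro tendsto_minus)
  then show "((\<lambda>z. (bev x * bod z - bev z * bod x) / (x - z)) \<longlongrightarrow> Q x) (at x)"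
    by (simp add: minus_divide_right)
qed simp

text \<open>Points of different intervals with the same parameter have the same ratio \<open>\<beta>\<^sub>e\<^sub>v / \<beta>\<^sub>o\<^sub>d\<close>, so the Bezout form vanishes.\<close>

lemma bezout_off_diagonal:
  assumes "k < n" "l < n" "k \<noteq> l"
  shows "(\<Sum>m<n. \<rho> m * (P m (X k t) * P m (X l t))) = 0"
proof -
  have "X k t \<noteq> X l t"
    using X_in[OF assms(1), of t] X_in[OF assms(2), of t] intervals_ordered[of k l] intervals_ordered[of l k] assms
    by (cases "k < l") auto
  then have "(\<Sum>m<n. \<rho> m * (P m (X k t) * P m (X l t))) = (bev (X k t) * bod (X l t) - bev (X l t) * bod (X k t)) / (X k t - X l t)"
    by (rule bezout_sum)
  also have "\<dots> = 0"
    unfolding exp_phi[OF assms(1) X_in[OF assms(1)]] exp_phi[OF assms(2) X_in[OF assms(2)]] phi_X[OF assms(1)] phi_X[OF assms(2)] by simp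
  finally show ?thesis .
qed

lemma QX_pos: "k < n \<Longrightarrow> Q (X k t) > 0" by (rule Q_pos[OF _ X_in])

text \<open>The two preceding facts say that a square matrix has a right inverse; here the same matrix is used
  as a left inverse.\<close>

lemma dual_orthogonality:
  assumes i: "i < n" and j: "j < n"
  shows "(\<Sum>k<n. \<rho> i * (P i (X k t) * P j (X k t) / Q (X k t))) = (if i = j then 1 else 0)"
proof -
  \<comment> \<open>The signs of the \<open>\<rho> m\<close> are still unknown, so they enter one factor entirely instead of a square
    root entering both.\<close>
  define N where "N = Matrix.mat n n (\<lambda>(k,m). P m (X k t) / sqrt (Q (X k t)))"
  define N' where "N' = Matrix.mat n n (\<lambda>(m,k). \<rho> m * P m (X k t) / sqrt (Q (X k t)))"
  have NN: "N \<in> carrier_mat n n" "N' \<in> carrier_mat n n" by (auto simp: N_def N'_def)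
  have "N * N' = 1\<^sub>m n"
  proof (rule eq_matI)
    fix k l assume "k < dim_row (1\<^sub>m n :: real mat)" "l < dim_col (1\<^sub>m n :: real mat)"
    then have kl: "k < n" "l < n" by auto
    have "(N * N') $$ (k, l) = (\<Sum>m<n. P m (X k t) / sqrt (Q (X k t)) * (\<rho> m * P m (X l t) / sqrt (Q (X l t))))"
      using kl by (simp add: N_def N'_def scalar_prod_def lessThan_atLeast0)
    also have "\<dots> = (\<Sum>m<n. \<rho> m * (P m (X k t) * P m (X l t))) / (sqrt (Q (X k t)) * sqrt (Q (X l t)))"
      unfolding sum_divide_distrib by (intro sum.cong refl) (simp add: mult_ac)
    also have "\<dots> = (if k = l then 1 else 0)"
      using bezout_off_diagonal[OF kl] bezout_diagonal[of "X k t"] QX_pos[OF kl(1), of t] by auto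
    finally show "(N * N') $$ (k, l) = 1\<^sub>m n $$ (k, l)" using kl by simp
  qed (auto simp: N_def N'_def)
  from mat_mult_left_right_inverse[OF NN this]
  have "(N' * N) $$ (i, j) = (if i = j then 1 else 0)" using i j by simp
  also have "(N' * N) $$ (i, j) = (\<Sum>k<n. \<rho> i * P i (X k t) / sqrt (Q (X k t)) * (P j (X k t) / sqrt (Q (X k t))))"
    using i j by (simp add: N_def N'_def scalar_prod_def lessThan_atLeast0)
  also have "\<dots> = (\<Sum>k<n. \<rho> i * (P i (X k t) * P j (X k t) / Q (X k t)))"
  proof (intro sum.cong refl)
    fix k assume "k \<in> {..<n}"
    then have sq: "sqrt (Q (X k t)) * sqrt (Q (X k t)) = Q (X k t)" using QX_pos[of k t] by simp
    show "\<rho> i * P i (X k t) / sqrt (Q (X k t)) * (P j (X k t) / sqrt (Q (X k t))) = \<rho> i * (P i (X k t) * P j (X k t) / Q (X k t))"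
      unfolding times_divide_times_eq sq by simp
  qed
  finally show ?thesis .
qed

text \<open>Positivity of the eigenvalues follows from the diagonal case of the dual relation. It guarantees
  that the square roots of \<open>\<rho>\<^sub>j / Q\<close> in the matrix function are genuine.\<close>

lemma rho_pos:
  assumes j: "j < n" shows "\<rho> j > 0"
proof -
  have "\<rho> j * (\<Sum>k<n. P j (X k 0) * P j (X k 0) / Q (X k 0)) = 1"
    using dual_orthogonality[OF j j, of 0] by (simp add: sum_distrib_left)
  moreover have "0 \<le> (\<Sum>k<n. P j (X k 0) * P j (X k 0) / Q (X k 0))"
    using QX_pos by (intro sum_nonneg divide_nonneg_pos) auto
  ultimately show ?thesis by (metis mult_nonpos_nonneg not_less not_one_le_zero)
qed

lemma M_prod:
  assumes "i < n" "j < n" "k < n" "l < n"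
  shows "M i k t * M j l s = P i (X k t) * P j (X l s) * (sqrt (\<rho> i) * sqrt (\<rho> j)) / (sqrt (Q (X k t)) * sqrt (Q (X l s)))"
  unfolding M_eq real_sqrt_divide by simp

text \<open>The dual relation says that the matrix function has orthonormal rows at each \<open>t\<close>; the columns
  are orthonormal by the Bezout relations (\<open>A_diag\<close>).\<close>

lemma M_rows:
  assumes i: "i < n" and j: "j < n"
  shows "(\<Sum>k<n. M i k t * M j k t) = (if i = j then 1 else 0)"
proof -
  have "M i k t * M j k t = (sqrt (\<rho> j) / sqrt (\<rho> i)) * (\<rho> i * (P i (X k t) * P j (X k t) / Q (X k t)))" if k: "k < n" for k
  proof -
    have arith: "p * (a * b) / q = (b / a) * ((a * a) * (p / q))" if "a \<noteq> 0" for a b p q :: real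
      using that by simp
    have nz: "sqrt (\<rho> i) \<noteq> 0" using rho_pos[OF i] by simp
    have sq: "sqrt (\<rho> i) * sqrt (\<rho> i) = \<rho> i" "sqrt (Q (X k t)) * sqrt (Q (X k t)) = Q (X k t)"
      using rho_pos[OF i] QX_pos[OF k, of t] by auto
    show ?thesis unfolding M_prod[OF i j k k] arith[OF nz] unfolding sq ..
  qed
  then have "(\<Sum>k<n. M i k t * M j k t) = (\<Sum>k<n. (sqrt (\<rho> j) / sqrt (\<rho> i)) * (\<rho> i * (P i (X k t) * P j (X k t) / Q (X k t))))"
    by (intro sum.cong refl) auto
  also have "\<dots> = (sqrt (\<rho> j) / sqrt (\<rho> i)) * (if i = j then 1 else 0)"
    by (subst sum_distrib_left[symmetric], subst dual_orthogonality[OF i j], rule refl)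
  also have "\<dots> = (if i = j then 1 else 0)" using rho_pos[OF i] by auto
  finally show ?thesis .
qed

lemma A_eq:
  assumes k: "k < n" and l: "l < n"
  shows "A k l t s = (\<Sum>m<n. \<rho> m * (P m (X k t) * P m (X l s))) / (sqrt (Q (X k t)) * sqrt (Q (X l s)))"
  unfolding A_def sum_divide_distrib
proof (intro sum.cong refl)
  fix m assume "m \<in> {..<n}"
  then have m: "m < n" by simp
  have "sqrt (\<rho> m) * sqrt (\<rho> m) = \<rho> m" using rho_pos[OF m] by simp
  then show "M m k t * M m l s = \<rho> m * (P m (X k t) * P m (X l s)) / (sqrt (Q (X k t)) * sqrt (Q (X l s)))"
    unfolding M_prod[OF m m k l] by (simp add: mult.commute)
qed

lemma A_diag:
  assumes "k < n" "l < n" shows "A k l t t = (if k = l then 1 else 0)"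
  unfolding A_eq[OF assms] using bezout_off_diagonal[OF assms] bezout_diagonal[of "X k t"] QX_pos[OF assms(1), of t] by auto

text \<open>A scalar product of two unit vectors.\<close>

lemma A_bound:
  assumes "k < n" "l < n" shows "\<bar>A k l t s\<bar> \<le> 1"
proof -
  have "\<bar>A k l t s\<bar> \<le> (\<Sum>j<n. \<bar>M j k t * M j l s\<bar>)" unfolding A_def by (rule sum_abs)
  also have "\<dots> \<le> (\<Sum>j<n. (M j k t * M j k t + M j l s * M j l s) / 2)"
  proof (rule sum_mono)
    fix j
    show "\<bar>M j k t * M j l s\<bar> \<le> (M j k t * M j k t + M j l s * M j l s) / 2"
      using sum_squares_bound[of "\<bar>M j k t\<bar>" "\<bar>M j l s\<bar>"] by (simp add: abs_mult power2_eq_square)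
  qed
  also have "\<dots> = (A k k t t + A l l s s) / 2"
    unfolding A_def by (simp add: sum_divide_distrib[symmetric] sum.distrib)
  also have "\<dots> = 1" using A_diag assms by simp
  finally show ?thesis .
qed

text \<open>The heart of the matter. With \<open>\<beta>\<^sub>e\<^sub>v = - exp \<phi> \<beta>\<^sub>o\<^sub>d\<close> the Bezout form of \<open>x = X k t\<close> and \<open>z = X l s\<close> is a multiple of
  \<open>exp (2 s) - exp (2 t)\<close>, so that the Cauchy kernel \<open>1 / (x - z)\<close>, with the weights of the isometry, is the
  kernel \<open>A / sinh (s - t)\<close>.\<close>

theorem kernel_identity:
  assumes k: "k < n" and l: "l < n"
  shows "A k l t s * (X k t - X l s) = 2 * \<omega> k t * \<omega> l s * sinh (s - t)"
proof (cases "X k t = X l s")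
  case True
  then have "2 * t = 2 * s" using phi_X[OF k, of t] phi_X[OF l, of s] by simp
  then show ?thesis using True by simp
next
  case False
  have sqQ: "sqrt (Q (X i r)) = sqrt \<bar>dphi (X i r)\<bar> * \<bar>bod (X i r)\<bar> * exp r" if "i < n" for i r
  proof -
    have e2: "exp (2 * r) = (exp r)\<^sup>2" by (rule exp_double)
    have "Q (X i r) = - dphi (X i r) * (bod (X i r))\<^sup>2 * (exp r)\<^sup>2"
      unfolding Q_eq[OF that X_in[OF that]] exp_phi[OF that X_in[OF that]] phi_X[OF that] e2
      by (simp add: power2_eq_square)
    also have "- dphi (X i r) = \<bar>dphi (X i r)\<bar>" using dphi_neg[OF that X_in[OF that, of r]] by simp
    finally show ?thesis by (simp add: real_sqrt_mult)
  qed
  have bnz: "bod (X k t) \<noteq> 0" "bod (X l s) \<noteq> 0" using bod_nonzero X_in k l by auto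
  have dnz: "sqrt \<bar>dphi (X k t)\<bar> \<noteq> 0" "sqrt \<bar>dphi (X l s)\<bar> \<noteq> 0"
    using dphi_neg[OF k X_in[OF k, of t]] dphi_neg[OF l X_in[OF l, of s]] by auto
  have "bev (X k t) * bod (X l s) - bev (X l s) * bod (X k t) = bod (X k t) * bod (X l s) * (exp (2 * s) - exp (2 * t))"
    unfolding exp_phi[OF k X_in[OF k]] exp_phi[OF l X_in[OF l]] phi_X[OF k] phi_X[OF l] by (simp add: algebra_simps)
  also have "exp (2 * s) - exp (2 * t) = 2 * sinh (s - t) * (exp t * exp s)"
  proof -
    have "exp (2 * s) = exp (s - t) * (exp t * exp s)" "exp (2 * t) = exp (- (s - t)) * (exp t * exp s)"
      unfolding mult_exp_exp by simp_all
    then show ?thesis by (simp only: sinh_field_def) (simp add: algebra_simps)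
  qed
  finally have num: "bev (X k t) * bod (X l s) - bev (X l s) * bod (X k t) = bod (X k t) * bod (X l s) * (2 * sinh (s - t) * (exp t * exp s))" .
  have "A k l t s * (X k t - X l s) = (bev (X k t) * bod (X l s) - bev (X l s) * bod (X k t)) / (sqrt (Q (X k t)) * sqrt (Q (X l s)))"
    unfolding A_eq[OF k l] bezout_sum[OF False] using False by simp
  also have "\<dots> = 2 * (bod (X k t) / \<bar>bod (X k t)\<bar> / sqrt \<bar>dphi (X k t)\<bar>) * (bod (X l s) / \<bar>bod (X l s)\<bar> / sqrt \<bar>dphi (X l s)\<bar>) * sinh (s - t)"
    unfolding num sqQ[OF k] sqQ[OF l] using bnz dnz by (simp add: divide_simps)
  also have "\<dots> = 2 * \<omega> k t * \<omega> l s * sinh (s - t)"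
    unfolding weight_def real_sgn_eq by simp
  finally show ?thesis .
qed

end

section \<open>The isometry and the composed transform\<close>

lemma borel_measurable_poly [measurable]: "poly (p :: real poly) \<in> borel_measurable borel"
  by (intro borel_measurable_continuous_onI continuous_intros)

context multi_intervals
begin

abbreviation "I \<equiv> multi_interval n \<alpha> \<beta>"
abbreviation "T \<equiv> T_op n \<alpha> \<beta>"
definition ext :: "(real \<Rightarrow> complex) \<Rightarrow> real \<Rightarrow> complex" where "ext f x = (if x \<in> I then f x else 0)"

lemma borel_measurable_dphi [measurable]: "dphi \<in> borel_measurable borel"
  unfolding dphi_def[abs_def] by measurable

lemma borel_measurable_weight [measurable]: "weight \<in> borel_measurable borel"
  unfolding weight_def[abs_def] by measurable

lemma borel_measurable_phi [measurable]: "\<phi> \<in> borel_measurable borel"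
  unfolding phi_def[abs_def] by measurable

lemma borel_measurable_X: "k < n \<Longrightarrow> X k \<in> borel_measurable borel"
  by (intro borel_measurable_continuous_onI X_continuous)

lemma lebesgue_measurable_X: "k < n \<Longrightarrow> X k \<in> borel_measurable lebesgue"
  by (rule measurable_completion) (simp add: borel_measurable_X)

lemma weight_nonzero: "k < n \<Longrightarrow> x \<in> J k \<Longrightarrow> weight x \<noteq> 0"
  unfolding weight_def using bod_nonzero[of k x] dphi_neg[of k x] by (auto simp: sgn_zero_iff)

lemma weight_sq: "k < n \<Longrightarrow> x \<in> J k \<Longrightarrow> weight x * weight x = 1 / \<bar>dphi x\<bar>"
  unfolding weight_def using bod_nonzero[of k x] by (simp add: sgn_if)

lemma T_eq:
  assumes "k < n" shows "T f k t = of_real (sqrt 2 * weight (X k t)) * f (X k t)"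
  unfolding T_op_def Let_def X_def[symmetric] deriv_phi[OF assms X_in[OF assms]] weight_def by simp

lemma I_sets: "I \<in> sets lebesgue" unfolding multi_interval_def by (auto intro!: sets.finite_UN)

lemma J_subset_I: "k < n \<Longrightarrow> J k \<subseteq> I" unfolding multi_interval_def by force

lemma J_disjoint: "k < n \<Longrightarrow> l < n \<Longrightarrow> x \<in> J k \<Longrightarrow> x \<in> J l \<Longrightarrow> k = l"
  using intervals_ordered[of k l] intervals_ordered[of l k] by (cases k l rule: linorder_cases) auto

lemma L2_I_iff: "f \<in> L2 I \<longleftrightarrow> ext f \<in> L2 UNIV"
  unfolding ext_def[abs_def] by (rule L2_on_iff[OF I_sets])

text \<open>The substitution \<open>x = X k t\<close> for the Lebesgue integral; it preserves integrability in both directions.\<close>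

lemma change_of_variables:
  fixes f :: "real \<Rightarrow> 'a :: euclidean_space"
  assumes k: "k < n"
  shows "set_integrable lebesgue (J k) f \<longleftrightarrow> integrable lebesgue (\<lambda>t. \<bar>2 / dphi (X k t)\<bar> *\<^sub>R f (X k t))"
  and "set_integrable lebesgue (J k) f \<Longrightarrow> (LINT x:J k|lebesgue. f x) = (LINT t|lebesgue. \<bar>2 / dphi (X k t)\<bar> *\<^sub>R f (X k t))"
proof -
  let ?g = "\<lambda>t. \<bar>2 / dphi (X k t)\<bar> *\<^sub>R f (X k t)"
  have U: "set_integrable lebesgue UNIV ?g \<longleftrightarrow> integrable lebesgue ?g" by (simp add: set_integrable_def)
  have der: "(X k has_real_derivative 2 / dphi (X k t)) (at t within UNIV)" for t using X_deriv[OF k] by simp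
  note cov = has_absolute_integral_change_of_variables_real[of UNIV "X k" "\<lambda>t. 2 / dphi (X k t)" f, OF _ der X_inj[OF k], unfolded X_image[OF k]]
  show 1: "set_integrable lebesgue (J k) f \<longleftrightarrow> integrable lebesgue ?g"
    unfolding U[symmetric] using cov by auto
  assume f: "set_integrable lebesgue (J k) f"
  then have "integral UNIV ?g = integral (J k) f" using cov 1 U by auto
  then show "(LINT x:J k|lebesgue. f x) = (LINT t|lebesgue. ?g t)"
    using set_lebesgue_integral_eq_integral(2)[OF f] integral_lebesgue[of ?g] f 1 by simp
qed

lemma jacobian_eq: "k < n \<Longrightarrow> \<bar>2 / dphi (X k t)\<bar> = 2 * (weight (X k t) * weight (X k t))"
  using weight_sq[OF _ X_in, of k t] by simp

lemma L2_set_integrable_J: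
  assumes f: "f \<in> L2 I" and k: "k < n"
  shows "set_integrable lebesgue (J k) f" "set_integrable lebesgue (J k) (\<lambda>x. (cmod (f x))\<^sup>2)"
proof -
  have fe: "ext f \<in> L2 UNIV" using f L2_I_iff by simp
  have fx: "ext f x = f x" if "x \<in> J k" for x using J_subset_I[OF k] that by (auto simp: ext_def)
  have JL: "(\<lambda>x. complex_of_real (indicator (J k) x)) \<in> L2 UNIV"
    by (rule L2_dominated[OF L2_indicator[of "\<alpha> k" "\<beta> k"]]) (auto simp: indicator_def)
  have "integrable lebesgue (\<lambda>x. of_real (indicator (J k) x) * ext f x)"
    by (rule L2_integrable_mult[OF JL fe])
  moreover have "of_real (indicator (J k) x) * ext f x = indicator (J k) x *\<^sub>R f x" for x
    using fx by (cases "x \<in> J k") auto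
  ultimately show "set_integrable lebesgue (J k) f" by (simp add: set_integrable_def)
  have "integrable lebesgue (\<lambda>x. indicator (J k) x *\<^sub>R (cmod (ext f x))\<^sup>2)"
    using fe unfolding L2_def lebesgue_on_UNIV_eq by (intro integrable_mult_indicator) auto
  moreover have "indicator (J k) x *\<^sub>R (cmod (ext f x))\<^sup>2 = indicator (J k) x *\<^sub>R (cmod (f x))\<^sup>2" for x
    using fx by (cases "x \<in> J k") auto
  ultimately show "set_integrable lebesgue (J k) (\<lambda>x. (cmod (f x))\<^sup>2)" by (simp only: set_integrable_def)
qed

text \<open>Measurability of \<open>f \<circ> X k\<close> is read off from the change of variables formula, which provides an
  integrable function that differs from it by a positive continuous factor.\<close>

lemma T_L2:
  assumes f: "f \<in> L2 I" and k: "k < n"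
  shows "T f k \<in> L2 UNIV"
proof -
  note [measurable] = lebesgue_measurable_X[OF k]
  note int = L2_set_integrable_J[OF f k]
  have nz: "weight (X k t) \<noteq> 0" for t by (rule weight_nonzero[OF k X_in[OF k]])
  have "(\<lambda>t. \<bar>2 / dphi (X k t)\<bar> *\<^sub>R f (X k t)) \<in> borel_measurable lebesgue"
    using int(1) change_of_variables(1)[OF k, of f] by auto
  then have [measurable]: "(\<lambda>t. (2 * (weight (X k t) * weight (X k t))) *\<^sub>R f (X k t)) \<in> borel_measurable lebesgue"
    unfolding jacobian_eq[OF k] .
  have "T f k = (\<lambda>t. of_real (sqrt 2 / (2 * weight (X k t))) * ((2 * (weight (X k t) * weight (X k t))) *\<^sub>R f (X k t)))"
    unfolding T_eq[OF k, abs_def] by (rule ext) (use nz in \<open>simp add: scaleR_conv_of_real field_simps\<close>)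
  also have "\<dots> \<in> borel_measurable lebesgue" by measurable
  finally have meas: "T f k \<in> borel_measurable lebesgue" .
  have "integrable lebesgue (\<lambda>t. \<bar>2 / dphi (X k t)\<bar> *\<^sub>R (cmod (f (X k t)))\<^sup>2)"
    using int(2) change_of_variables(1)[OF k, of "\<lambda>x. (cmod (f x))\<^sup>2"] by simp
  moreover have "\<bar>2 / dphi (X k t)\<bar> *\<^sub>R (cmod (f (X k t)))\<^sup>2 = (cmod (T f k t))\<^sup>2" for t
    unfolding T_eq[OF k] norm_mult norm_of_real power_mult_distrib jacobian_eq[OF k] power2_abs
    by (simp add: power2_eq_square)
  ultimately show ?thesis using meas unfolding L2_def lebesgue_on_UNIV_eq by simp
qed

text \<open>As \<open>h k\<close> is square integrable on the whole line only, the change of variables formula is applied to \<open>h k\<close>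
  times a Poisson kernel in order to obtain measurability of the composition with \<open>\<phi> / 2\<close>.\<close>

lemma T_onto:
  assumes h: "\<And>k. k < n \<Longrightarrow> h k \<in> L2 UNIV"
  obtains f where "f \<in> L2 I" "\<And>k t. k < n \<Longrightarrow> T f k t = h k t"
proof -
  define F where "F k x = indicator (J k) x *\<^sub>R (h k (\<phi> x / 2) / of_real (sqrt 2 * weight x))" for k x
  define f where "f x = (\<Sum>k<n. F k x)" for x
  have F0: "F k x = 0" if "x \<notin> J k" for k x using that by (simp add: F_def)
  have f_J: "f x = F k x" if "k < n" "x \<in> J k" for k x
  proof -
    have "F l x = 0" if "l \<in> {..<n} - {k}" for l
      using J_disjoint[of k l x] that \<open>k < n\<close> \<open>x \<in> J k\<close> by (intro F0) auto
    then show ?thesis unfolding f_def using \<open>k < n\<close> by (subst sum.remove[of _ k]) auto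
  qed
  have FX: "F k (X k t) = h k t / of_real (sqrt 2 * weight (X k t))" if "k < n" for k t
    using X_in[OF that, of t] by (simp add: F_def phi_X[OF that])
  have FL: "F k \<in> L2 UNIV" if k: "k < n" for k
  proof -
    note [measurable] = lebesgue_measurable_X[OF k]
    have hL: "h k \<in> L2 UNIV" by (rule h[OF k])
    have [measurable]: "h k \<in> borel_measurable lebesgue" using hL L2_measurable by auto
    have nz: "weight (X k t) \<noteq> 0" for t by (rule weight_nonzero[OF k X_in[OF k]])
    define u where "u x = F k x * of_real (poisson 1 (\<phi> x / 2) / (sqrt 2 * weight x))" for x
    have "integrable lebesgue (\<lambda>t. h k t * of_real (poisson 1 (t - 0)))"
      by (intro L2_integrable_mult hL L2_poisson) simp
    moreover have "h k t * of_real (poisson 1 (t - 0)) = \<bar>2 / dphi (X k t)\<bar> *\<^sub>R u (X k t)" for t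
      unfolding u_def FX[OF k] jacobian_eq[OF k] phi_X[OF k] using nz[of t] by (simp add: scaleR_conv_of_real field_simps flip: of_real_mult)
    ultimately have "set_integrable lebesgue (J k) u"
      using change_of_variables(1)[OF k, of u] by simp
    then have [measurable]: "(\<lambda>x. indicator (J k) x *\<^sub>R u x) \<in> borel_measurable lebesgue"
      unfolding set_integrable_def by auto
    have "F k = (\<lambda>x. (indicator (J k) x *\<^sub>R u x) * of_real (sqrt 2 * weight x / poisson 1 (\<phi> x / 2)))"
    proof
      fix x
      have "poisson 1 (\<phi> x / 2) \<noteq> 0" by (simp add: poisson_def add_nonneg_eq_0_iff)
      then show "F k x = (indicator (J k) x *\<^sub>R u x) * of_real (sqrt 2 * weight x / poisson 1 (\<phi> x / 2))"
        using weight_nonzero[OF k, of x] by (cases "x \<in> J k") (auto simp: F0 u_def)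
    qed
    also have "\<dots> \<in> borel_measurable lebesgue" by measurable
    finally have meas: "F k \<in> borel_measurable lebesgue" .
    have "integrable lebesgue (\<lambda>t. (cmod (h k t))\<^sup>2)" using hL unfolding L2_def lebesgue_on_UNIV_eq by simp
    moreover have "(cmod (h k t))\<^sup>2 = \<bar>2 / dphi (X k t)\<bar> *\<^sub>R (cmod (F k (X k t)))\<^sup>2" for t
      unfolding FX[OF k] jacobian_eq[OF k] norm_divide norm_of_real power_divide power2_abs using nz[of t]
      by (simp add: power_mult_distrib power2_eq_square)
    ultimately have "set_integrable lebesgue (J k) (\<lambda>x. (cmod (F k x))\<^sup>2)"
      using change_of_variables(1)[OF k, of "\<lambda>x. (cmod (F k x))\<^sup>2"] by simp
    moreover have "indicator (J k) x *\<^sub>R (cmod (F k x))\<^sup>2 = (cmod (F k x))\<^sup>2" for x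
      using F0[of x k] by (cases "x \<in> J k") auto
    ultimately have "integrable lebesgue (\<lambda>x. (cmod (F k x))\<^sup>2)" by (simp only: set_integrable_def)
    then show ?thesis using meas unfolding L2_def lebesgue_on_UNIV_eq by simp
  qed
  have "f x = 0" if "x \<notin> I" for x
    unfolding f_def using J_subset_I that by (intro sum.neutral ballI F0) blast
  then have "ext f = f" by (auto simp: ext_def)
  moreover have "f \<in> L2 UNIV" unfolding f_def[abs_def] using FL by (intro L2_sum) auto
  ultimately have "f \<in> L2 I" unfolding L2_I_iff by simp
  moreover have "T f k t = h k t" if k: "k < n" for k t
    unfolding T_eq[OF k] f_J[OF k X_in[OF k]] FX[OF k] using weight_nonzero[OF k X_in[OF k, of t]] by simp
  ultimately show ?thesis using that by blast
qed

text \<open>Both \<open>X k\<close> and its inverse \<open>\<phi> / 2\<close> are differentiable, and differentiable maps preserve null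
  sets.\<close>

lemma AE_X_iff:
  assumes k: "k < n"
  shows "(AE t in lebesgue. P (X k t)) \<longleftrightarrow> (AE x in lebesgue. x \<in> J k \<longrightarrow> P x)"
proof -
  have 1: "{x. \<not> (x \<in> J k \<longrightarrow> P x)} = X k ` {t. \<not> P (X k t)}"
    using X_in[OF k] X_phi[OF k] by (auto simp: image_iff) metis
  have 2: "{t. \<not> P (X k t)} = (\<lambda>x. \<phi> x / 2) ` {x. \<not> (x \<in> J k \<longrightarrow> P x)}"
  proof (intro equalityI subsetI)
    fix t assume "t \<in> {t. \<not> P (X k t)}"
    then show "t \<in> (\<lambda>x. \<phi> x / 2) ` {x. \<not> (x \<in> J k \<longrightarrow> P x)}"
      using X_in[OF k, of t] phi_X[OF k, of t] by (intro image_eqI[of _ _ "X k t"]) auto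
  next
    fix t assume "t \<in> (\<lambda>x. \<phi> x / 2) ` {x. \<not> (x \<in> J k \<longrightarrow> P x)}"
    then show "t \<in> {t. \<not> P (X k t)}" using X_phi[OF k] by auto
  qed
  have d1: "X k differentiable_on S" for S
    using X_deriv[OF k] by (meson differentiable_at_imp_differentiable_on real_differentiable_def)
  have d2: "(\<lambda>x. \<phi> x / 2) differentiable_on {x. \<not> (x \<in> J k \<longrightarrow> P x)}"
    using DERIV_cdivide[OF phi_deriv[OF k], of _ 2]
    by (intro differentiable_at_imp_differentiable_on) (auto simp: real_differentiable_def)
  show ?thesis unfolding AE_lebesgue_iff_negligible
    using negligible_differentiable_image_negligible[OF _ _ d1, of "{t. \<not> P (X k t)}"]
      negligible_differentiable_image_negligible[OF _ _ d2] 1 2 by auto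
qed

lemma eq_ae_I_iff: "eq_ae I f g \<longleftrightarrow> (\<forall>k<n. AE t in lebesgue. f (X k t) = g (X k t))"
proof -
  have "eq_ae I f g \<longleftrightarrow> (AE x in lebesgue. x \<in> I \<longrightarrow> f x = g x)"
    unfolding eq_ae_def using I_sets by (intro AE_restrict_space_iff) auto
  also have "\<dots> \<longleftrightarrow> (AE x in lebesgue. \<forall>k\<in>{..<n}. x \<in> J k \<longrightarrow> f x = g x)"
  proof -
    have "AE x in lebesgue. \<forall>k\<in>{..<n}. x \<noteq> \<alpha> k \<and> x \<noteq> \<beta> k"
      by (intro AE_finite_allI AE_conjI AE_lebesgue_neq) auto
    then have "AE x in lebesgue. (x \<in> I \<longrightarrow> f x = g x) \<longleftrightarrow> (\<forall>k\<in>{..<n}. x \<in> J k \<longrightarrow> f x = g x)"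
      by eventually_elim (force simp: multi_interval_def)
    then show ?thesis by (rule eventually_subst)
  qed
  also have "\<dots> \<longleftrightarrow> (\<forall>k\<in>{..<n}. AE x in lebesgue. x \<in> J k \<longrightarrow> f x = g x)"
    by (rule AE_finite_all) simp
  also have "\<dots> \<longleftrightarrow> (\<forall>k<n. AE t in lebesgue. f (X k t) = g (X k t))"
    using AE_X_iff[of _ "\<lambda>x. f x = g x"] by auto
  finally show ?thesis .
qed

lemma eq_ae_I_iff_T: "eq_ae I f g \<longleftrightarrow> (\<forall>k<n. AE t in lebesgue. T f k t = T g k t)"
  unfolding eq_ae_I_iff using weight_nonzero[OF _ X_in] by (simp add: T_eq)

end

context bezout_setting
begin

abbreviation "MT f \<equiv> M_op n \<alpha> \<beta> W \<rho> (T f)"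
abbreviation "FMTf f \<equiv> FMT n \<alpha> \<beta> W \<rho> f"

lemma borel_measurable_M:
  assumes k: "k < n" shows "(\<lambda>t. M j k t) \<in> borel_measurable lebesgue"
proof -
  note [measurable] = lebesgue_measurable_X[OF k]
  have [measurable]: "(\<lambda>x. P j x) \<in> borel_measurable borel" unfolding P_fun_def by measurable
  show ?thesis unfolding M_eq by measurable
qed

lemma M_bound:
  assumes "j < n" "k < n" shows "\<bar>M j k t\<bar> \<le> 1"
proof -
  have "M j k t * M j k t \<le> (\<Sum>k<n. M j k t * M j k t)" using assms by (intro member_le_sum) auto
  then have "(M j k t)\<^sup>2 \<le> 1" using M_rows[OF assms(1) assms(1), of t] by (simp add: power2_eq_square)
  then show ?thesis by (simp add: abs_square_le_1)
qed

lemma L2_M_mult: "j < n \<Longrightarrow> k < n \<Longrightarrow> h \<in> L2 UNIV \<Longrightarrow> (\<lambda>t. of_real (M j k t) * h t) \<in> L2 UNIV"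
  using borel_measurable_M[of k j] M_bound by (intro L2_mult_bounded[where C=1]) auto

lemma MT_L2: "f \<in> L2 I \<Longrightarrow> j < n \<Longrightarrow> MT f j \<in> L2 UNIV"
  unfolding M_op_def[abs_def] by (intro L2_sum L2_M_mult T_L2) auto

lemma M_inverse:
  assumes "k < n" shows "(\<Sum>j<n. of_real (M j k t) * M_op n \<alpha> \<beta> W \<rho> h j t) = h k t"
proof -
  have "(\<Sum>j<n. of_real (M j k t) * M_op n \<alpha> \<beta> W \<rho> h j t) = (\<Sum>l<n. of_real (A k l t t) * h l t)"
    unfolding M_op_def A_def of_real_sum sum_distrib_left sum_distrib_right
    by (subst sum.swap) (simp add: mult_ac)
  also have "\<dots> = (\<Sum>l<n. if l = k then h l t else 0)" using A_diag[OF assms] by (intro sum.cong refl) auto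
  also have "\<dots> = h k t" using assms by simp
  finally show ?thesis .
qed

lemma M_transpose_inverse:
  assumes "j < n" shows "M_op n \<alpha> \<beta> W \<rho> (\<lambda>k t. \<Sum>i<n. of_real (M i k t) * u i t) j t = u j t"
proof -
  have "M_op n \<alpha> \<beta> W \<rho> (\<lambda>k t. \<Sum>i<n. of_real (M i k t) * u i t) j t = (\<Sum>i<n. of_real (\<Sum>k<n. M j k t * M i k t) * u i t)"
    unfolding M_op_def of_real_sum sum_distrib_left sum_distrib_right
    by (subst sum.swap) (simp add: mult_ac)
  also have "\<dots> = (\<Sum>i<n. if i = j then u i t else 0)" using M_rows[OF assms] by (intro sum.cong refl) auto
  also have "\<dots> = u j t" using assms by simp
  finally show ?thesis .
qed

lemma FMT_is_fourier: "f \<in> L2 I \<Longrightarrow> j < n \<Longrightarrow> is_L2_fourier (MT f j) (FMTf f j)"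
  unfolding FMT_def F_op_def by (intro L2_fourier MT_L2)

lemma FMT_L2: "f \<in> L2 I \<Longrightarrow> j < n \<Longrightarrow> FMTf f j \<in> L2 UNIV"
  using FMT_is_fourier is_L2_fourier_L2 by blast

text \<open>The isometry, the orthogonal matrix function and the Fourier transform are each injective
  modulo null sets.\<close>

lemma FMT_eq_iff:
  assumes f: "f \<in> L2 I" and g: "g \<in> L2 I"
  shows "(\<forall>m<n. AE t in lebesgue. FMTf f m t = FMTf g m t) \<longleftrightarrow> eq_ae I f g"
proof
  assume "\<forall>m<n. AE t in lebesgue. FMTf f m t = FMTf g m t"
  then have "AE t in lebesgue. MT f m t = MT g m t" if "m < n" for m
    using that by (intro L2_fourier_inj[OF MT_L2[OF f that] MT_L2[OF g that] FMT_is_fourier[OF f that] FMT_is_fourier[OF g that]]) auto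
  then have "AE t in lebesgue. \<forall>m\<in>{..<n}. MT f m t = MT g m t" by (intro AE_finite_allI) auto
  then have "AE t in lebesgue. T f k t = T g k t" if "k < n" for k
  proof eventually_elim
    case (elim t)
    have "(\<Sum>j<n. of_real (M j k t) * MT f j t) = (\<Sum>j<n. of_real (M j k t) * MT g j t)" using elim by (intro sum.cong refl) auto
    then show ?case unfolding M_inverse[OF that] .
  qed
  then show "eq_ae I f g" unfolding eq_ae_I_iff_T by blast
next
  assume "eq_ae I f g"
  then have "AE t in lebesgue. \<forall>k\<in>{..<n}. T f k t = T g k t"
    unfolding eq_ae_I_iff_T by (intro AE_finite_allI) auto
  then have "AE t in lebesgue. MT f m t = MT g m t" for m
    by eventually_elim (auto simp: M_op_def intro!: sum.cong)
  then show "\<forall>m<n. AE t in lebesgue. FMTf f m t = FMTf g m t"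
    using is_L2_fourier_cong_AE[OF MT_L2[OF f] FMT_is_fourier[OF f] FMT_is_fourier[OF g]] by blast
qed

text \<open>The isometry, the orthogonal matrix function and the Fourier transform are each onto.\<close>

lemma FMT_onto:
  assumes u: "\<And>m. m < n \<Longrightarrow> u m \<in> L2 UNIV"
  obtains f where "f \<in> L2 I" "\<And>m. m < n \<Longrightarrow> AE s in lebesgue. FMTf f m s = u m s"
    "\<And>m. m < n \<Longrightarrow> is_L2_fourier (MT f m) (u m)"
proof -
  have "\<forall>m\<in>{..<n}. \<exists>G. G \<in> L2 UNIV \<and> is_L2_fourier G (u m)" using L2_fourier_surj[OF u] by (metis lessThan_iff)
  then obtain G where G: "\<And>m. m < n \<Longrightarrow> G m \<in> L2 UNIV \<and> is_L2_fourier (G m) (u m)" by (metis lessThan_iff)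
  define h where "h k t = (\<Sum>i<n. of_real (M i k t) * G i t)" for k t
  have "h k \<in> L2 UNIV" if "k < n" for k
    unfolding h_def[abs_def] using that G by (intro L2_sum L2_M_mult) auto
  then obtain f where f: "f \<in> L2 I" "\<And>k t. k < n \<Longrightarrow> T f k t = h k t" using T_onto by blast
  have "MT f m t = M_op n \<alpha> \<beta> W \<rho> h m t" for m t unfolding M_op_def using f(2) by (intro sum.cong refl) auto
  then have MT: "MT f m = G m" if "m < n" for m using M_transpose_inverse[OF that, of G] by (auto simp: h_def[abs_def])
  have F: "is_L2_fourier (MT f m) (u m)" if "m < n" for m using G MT that by simp
  have "AE s in lebesgue. FMTf f m s = u m s" if "m < n" for m
    by (rule is_L2_fourier_cong_AE[OF MT_L2[OF f(1) that] FMT_is_fourier[OF f(1) that] F[OF that]]) simp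
  then show ?thesis using that[OF f(1)] F by simp
qed

end

section \<open>Truncated and regularised kernels\<close>

definition conj_poisson :: "real \<Rightarrow> real \<Rightarrow> real" where
  "conj_poisson e v = v / (e\<^sup>2 + v\<^sup>2)"

text \<open>The kernel of the truncated integrals that define the principal value.\<close>

definition trunc_recip :: "real \<Rightarrow> real \<Rightarrow> real" where
  "trunc_recip e v = (if \<bar>v\<bar> < e then 0 else 1 / v)"

lemma borel_measurable_kernels [measurable]:
  "conj_poisson e \<in> borel_measurable borel" "trunc_recip e \<in> borel_measurable borel"
  "csch_reg e \<in> borel_measurable borel"
  unfolding conj_poisson_def[abs_def] trunc_recip_def[abs_def] csch_reg_def[abs_def] sinh_field_def
  supply [measurable del] = borel_measurable_ident_lebesgue by measurable

lemma truncation_error_bound: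
  assumes e: "e > 0"
  shows "\<bar>trunc_recip e v - conj_poisson e v\<bar> \<le> poisson e v"
proof -
  have pos: "e\<^sup>2 + v\<^sup>2 > 0" using e by (intro add_pos_nonneg) auto
  show ?thesis
  proof (cases "\<bar>v\<bar> < e")
    case True
    then have "\<bar>trunc_recip e v - conj_poisson e v\<bar> = \<bar>v\<bar> / (e\<^sup>2 + v\<^sup>2)"
      using pos by (simp add: trunc_recip_def conj_poisson_def abs_divide)
    also have "\<dots> \<le> e / (e\<^sup>2 + v\<^sup>2)" using True pos by (intro divide_right_mono) auto
    finally show ?thesis by (simp add: poisson_def)
  next
    case False
    then have v: "v \<noteq> 0" "e \<le> \<bar>v\<bar>" using e by auto
    have "1 / v - v / (e\<^sup>2 + v\<^sup>2) = e\<^sup>2 / (v * (e\<^sup>2 + v\<^sup>2))"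
      using v pos by (simp add: divide_simps power2_eq_square)
    then have "\<bar>trunc_recip e v - conj_poisson e v\<bar> = (e / \<bar>v\<bar>) * (e / (e\<^sup>2 + v\<^sup>2))"
      using False pos e by (simp add: trunc_recip_def conj_poisson_def abs_mult power2_eq_square)
    also have "\<dots> \<le> 1 * (e / (e\<^sup>2 + v\<^sup>2))" using v pos e by (intro mult_right_mono) auto
    finally show ?thesis by (simp add: poisson_def)
  qed
qed

lemma odd_integral_zero:
  fixes g :: "real \<Rightarrow> complex"
  assumes "\<And>v. g (- v) = - g v"
  shows "(LINT x|lebesgue. g (x - z)) = 0"
proof -
  have "(LINT x|lebesgue. g (x - z)) = \<bar>-1\<bar> *\<^sub>R (LINT x|lebesgue. g ((2 * z + (-1) * x) - z))"
    by (rule lebesgue_integral_real_affine) simp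
  also have "\<dots> = (LINT x|lebesgue. - g (x - z))"
    using assms[of "_ - z"] by (simp add: algebra_simps)
  finally show ?thesis by simp
qed

text \<open>The difference of the two kernels is odd and dominated by the Poisson kernel, so it acts as an
  approximate identity of mass zero.\<close>

lemma truncation_vs_conj_poisson:
  assumes f: "f \<in> L2 UNIV" and z: "lebesgue_point f z"
  shows "((\<lambda>e. LINT x|lebesgue. f x * of_real (trunc_recip e (x - z) - conj_poisson e (x - z))) \<longlongrightarrow> 0) (at_right 0)"
proof -
  have "((\<lambda>e. LINT x|lebesgue. f x * of_real (trunc_recip e (x - z) - conj_poisson e (x - z))) \<longlongrightarrow> f z * 0) (at_right 0)"
  proof (rule approximate_identity_at_lebesgue_point[OF f z, where C=1])
    show "cmod (of_real (trunc_recip e (x - z) - conj_poisson e (x - z))) \<le> 1 * poisson e (x - z)" if "e > 0" for e x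
      unfolding norm_of_real using truncation_error_bound[OF that] by simp
    show "(LINT x|lebesgue. complex_of_real (trunc_recip e (x - z) - conj_poisson e (x - z))) = 0" for e
      by (rule odd_integral_zero[of "\<lambda>v. of_real (trunc_recip e v - conj_poisson e v)"])
        (auto simp: trunc_recip_def conj_poisson_def)
  qed measurable
  then show ?thesis by simp
qed

lemma L2_conj_poisson:
  assumes e: "e > 0"
  shows "(\<lambda>x. complex_of_real (conj_poisson e (x - z))) \<in> L2 UNIV"
proof -
  have "N2 (\<lambda>x. complex_of_real (conj_poisson e (x - z))) \<le> (\<integral>\<^sup>+x. ennreal (1/e) * ennreal (poisson e (x - z)) \<partial>lebesgue)"
    unfolding N2_def
  proof (rule nn_integral_mono)
    fix x
    define v where "v = x - z"
    have pos: "e\<^sup>2 + v\<^sup>2 > 0" using e by (intro add_pos_nonneg) auto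
    have "(conj_poisson e v)\<^sup>2 = (v\<^sup>2 / (e\<^sup>2 + v\<^sup>2)) * (1 / (e\<^sup>2 + v\<^sup>2))"
      by (simp add: conj_poisson_def power_divide power2_eq_square)
    also have "\<dots> \<le> 1 * (1 / (e\<^sup>2 + v\<^sup>2))" using pos by (intro mult_right_mono) auto
    also have "\<dots> = (1/e) * poisson e v" using e by (simp add: poisson_def)
    finally have "(cmod (complex_of_real (conj_poisson e v)))\<^sup>2 \<le> (1/e) * poisson e v" unfolding norm_of_real by simp
    then show "ennreal ((cmod (complex_of_real (conj_poisson e (x - z))))\<^sup>2) \<le> ennreal (1/e) * ennreal (poisson e (x - z))"
      using e poisson_nonneg[OF e] unfolding v_def by (subst ennreal_mult[symmetric]) (auto intro!: ennreal_leI)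
  qed
  also have "\<dots> = ennreal (1/e) * ennreal pi" by (subst nn_integral_cmult) (auto simp: nn_integral_poisson[OF e])
  also have "\<dots> < \<infinity>" by (simp add: ennreal_mult_less_top)
  finally show ?thesis by (simp add: L2_UNIV_iff)
qed

lemma abs_sinh_ge: "\<bar>u\<bar> \<le> \<bar>sinh u\<bar>" for u :: real
  using real_le_abs_sinh[of u] by (simp add: sinh_field_def exp_minus)

lemma sinh_second_order:
  fixes u :: real
  assumes "\<bar>u\<bar> \<le> 1" shows "\<bar>sinh u - u\<bar> \<le> sinh 1 * u\<^sup>2"
proof -
  have "\<bar>sinh u - sinh 0 - cosh 0 * (u - 0)\<bar> \<le> sinh 1 * (u - 0)\<^sup>2"
  proof (rule second_order_bound[where f''=sinh])
    fix t :: real assume "\<bar>t - 0\<bar> \<le> 1"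
    then have "sinh t \<le> sinh 1" "sinh (- t) \<le> sinh 1" by (auto simp del: sinh_minus)
    then show "\<bar>sinh t\<bar> \<le> sinh 1" unfolding sinh_minus by (rule abs_leI)
  qed (use assms in \<open>auto intro!: derivative_eq_intros\<close>)
  then show ?thesis by simp
qed

lemma abs_sinh_far:
  fixes u :: real
  assumes "1 \<le> \<bar>u\<bar>" shows "(1 + u\<^sup>2) / 4 \<le> \<bar>sinh u\<bar>"
proof -
  have *: "(1 + x\<^sup>2) / 4 \<le> sinh x" if "1 \<le> x" for x :: real
  proof -
    have "1 + x + x\<^sup>2 / 2 \<le> exp x" using exp_lower_Taylor_quadratic[of x] that by simp
    moreover have "exp (- x) \<le> 1" using that by simp
    ultimately have "x + x\<^sup>2 / 2 \<le> exp x - exp (- x)" by linarith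
    moreover have "(1 + x\<^sup>2) / 2 \<le> x + x\<^sup>2 / 2" using that by (simp add: field_simps)
    ultimately have "(1 + x\<^sup>2) / 2 \<le> exp x - exp (- x)" by (rule order_trans[rotated])
    then show ?thesis unfolding sinh_field_def by (simp add: field_simps)
  qed
  show ?thesis
  proof (cases "u \<ge> 0")
    case True then show ?thesis using *[of u] assms by simp
  next
    case False then show ?thesis using *[of "- u"] assms by simp
  qed
qed

text \<open>The singular parts of \<open>1 / u\<close> and \<open>1 / S\<close> are damped by the same profile up to the rescaling \<open>Y \<approx> c u\<close>.
  Because \<open>Y\<close> and \<open>S\<close> deviate from \<open>c u\<close> and \<open>u\<close> only to second order, the difference stays bounded, uniformly
  in \<open>e\<close>.\<close>

lemma near_diagonal_bound:
  fixes u Y c B e S B1 :: real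
  assumes u: "u \<noteq> 0" "\<bar>u\<bar> \<le> 1" and c: "c > 0" and B: "B \<ge> 0" and Y: "\<bar>Y - c * u\<bar> \<le> B * u\<^sup>2" and e: "e > 0"
    and S: "\<bar>S - u\<bar> \<le> B1 * u\<^sup>2" "\<bar>u\<bar> \<le> \<bar>S\<bar>"
  shows "\<bar>e\<^sup>2 / (e\<^sup>2 + u\<^sup>2) / u - (c * e)\<^sup>2 / ((c * e)\<^sup>2 + Y\<^sup>2) / S\<bar> \<le> B / c * (B / c + 2) + B1"
proof -
  \<comment> \<open>In the rescaled variable \<open>y \<approx> u\<close> both profiles have height \<open>e\<close>.\<close>
  define y where "y = Y / c"
  define a where "a = e\<^sup>2 / (e\<^sup>2 + u\<^sup>2)"
  define b where "b = e\<^sup>2 / (e\<^sup>2 + y\<^sup>2)"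
  have e2: "e\<^sup>2 > 0" using e by simp
  have pos: "e\<^sup>2 + u\<^sup>2 > 0" "e\<^sup>2 + y\<^sup>2 > 0" using e2 by (auto intro: add_pos_nonneg)
  have u2: "u\<^sup>2 > 0" using u by simp
  have Yy: "Y = c * y" using c by (simp add: y_def)
  have b_eq: "(c * e)\<^sup>2 / ((c * e)\<^sup>2 + Y\<^sup>2) = b"
    unfolding Yy b_def power_mult_distrib distrib_left[symmetric] using c by simp
  have b01: "0 \<le> b" "b \<le> 1" using pos e2 by (auto simp: b_def)
  have yu: "\<bar>y - u\<bar> \<le> B / c * u\<^sup>2"
  proof -
    have "\<bar>Y - c * u\<bar> = c * \<bar>y - u\<bar>" unfolding Yy right_diff_distrib[symmetric] using c by (simp add: abs_mult)
    then show ?thesis using Y c by (simp add: field_simps)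
  qed
  have "\<bar>y + u\<bar> \<le> (B / c + 2) * \<bar>u\<bar>"
  proof -
    have "\<bar>y + u\<bar> \<le> \<bar>y - u\<bar> + 2 * \<bar>u\<bar>" by linarith
    also have "\<bar>y - u\<bar> \<le> B / c * \<bar>u\<bar>"
    proof -
      have "u\<^sup>2 \<le> \<bar>u\<bar>" using u mult_left_le[of "\<bar>u\<bar>" "\<bar>u\<bar>"] by (simp add: power2_eq_square)
      then have "B / c * u\<^sup>2 \<le> B / c * \<bar>u\<bar>" using B c by (intro mult_left_mono) auto
      then show ?thesis using yu by linarith
    qed
    finally show ?thesis by (simp add: algebra_simps)
  qed
  then have sq: "\<bar>y\<^sup>2 - u\<^sup>2\<bar> \<le> (B / c * u\<^sup>2) * ((B / c + 2) * \<bar>u\<bar>)"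
    using yu B c unfolding power2_eq_square[of y] power2_eq_square[of u] square_diff_square_factored abs_mult
    by (subst mult.commute[of "\<bar>y + u\<bar>"]) (intro mult_mono, auto simp: power2_eq_square)
  have ab: "a - b = b * ((y\<^sup>2 - u\<^sup>2) / (e\<^sup>2 + u\<^sup>2))"
  proof -
    have "E / p - E / q = E / q * ((q - p) / p)" if "p > 0" "q > 0" for E p q :: real
      using that by (simp add: field_simps)
    from this[OF pos, of "e\<^sup>2"] show ?thesis by (simp add: a_def b_def)
  qed
  have "\<bar>a - b\<bar> \<le> 1 * ((B / c * u\<^sup>2) * ((B / c + 2) * \<bar>u\<bar>) / u\<^sup>2)"
    unfolding ab abs_mult abs_divide
  proof (intro mult_mono frac_le)
    show "u\<^sup>2 \<le> \<bar>e\<^sup>2 + u\<^sup>2\<bar>" using e2 pos by simp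
  qed (use b01 sq u2 pos B c in auto)
  also have "\<dots> = B / c * (B / c + 2) * \<bar>u\<bar>" using u2 by simp
  finally have 1: "\<bar>(a - b) / u\<bar> \<le> B / c * (B / c + 2)" using u by (simp add: abs_divide divide_le_eq)
  have S0: "S \<noteq> 0" using S u by auto
  have uu: "0 < u * u" using u by (metis not_real_square_gt_zero)
  have "\<bar>1 / u - 1 / S\<bar> = \<bar>S - u\<bar> / (\<bar>u\<bar> * \<bar>S\<bar>)"
    using u S0 by (subst diff_frac_eq) (auto simp: abs_mult)
  also have "\<dots> \<le> (B1 * u\<^sup>2) / (\<bar>u\<bar> * \<bar>u\<bar>)"
    using S u uu by (intro frac_le mult_left_mono) auto
  also have "\<dots> = B1" using u by (simp add: power2_eq_square)
  finally have "\<bar>b * (1 / u - 1 / S)\<bar> \<le> 1 * B1" unfolding abs_mult using b01 by (intro mult_mono) auto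
  then have 2: "\<bar>b * (1 / u - 1 / S)\<bar> \<le> B1" by simp
  have "a / u - b / S = (a - b) / u + b * (1 / u - 1 / S)" by (simp add: diff_divide_distrib right_diff_distrib)
  then show ?thesis unfolding b_eq a_def[symmetric] using 1 2 by linarith
qed

lemma poisson_1_near: "\<bar>u\<bar> \<le> 1 \<Longrightarrow> 1 \<le> 2 * poisson 1 u"
  by (simp add: poisson_def abs_square_le_1 divide_simps add_pos_nonneg)

lemma poisson_1_far:
  assumes "1 \<le> \<bar>u\<bar>" shows "1 / u\<^sup>2 \<le> 2 * poisson 1 u" "1 / \<bar>sinh u\<bar> \<le> 4 * poisson 1 u"
proof -
  have u2: "1 \<le> u\<^sup>2" using assms by (metis abs_le_square_iff abs_1 one_power2)
  then show "1 / u\<^sup>2 \<le> 2 * poisson 1 u" by (simp add: poisson_def divide_simps)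
  have "1 / \<bar>sinh u\<bar> \<le> 1 / ((1 + u\<^sup>2) / 4)" using abs_sinh_far[OF assms] u2 by (intro divide_left_mono mult_pos_pos) auto
  then show "1 / \<bar>sinh u\<bar> \<le> 4 * poisson 1 u" by (simp add: poisson_def)
qed

lemma csch_reg_eq:
  assumes "u \<noteq> 0" "e > 0"
  shows "csch_reg e u = (1 / sinh u - e\<^sup>2 / (e\<^sup>2 + u\<^sup>2) / u) / pi"
proof -
  have pos: "e\<^sup>2 + u\<^sup>2 > 0" using assms by (intro add_pos_nonneg) auto
  have "u / (e\<^sup>2 + u\<^sup>2) - 1 / u = - (e\<^sup>2 / (e\<^sup>2 + u\<^sup>2) / u)"
    using assms pos by (simp add: divide_simps power2_eq_square)
  then show ?thesis unfolding csch_reg_def by (simp add: algebra_simps)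
qed

text \<open>The bound depends on \<open>e\<close>; it serves only to justify the interchange of sums and integrals.\<close>

lemma L2_csch_reg:
  assumes e: "e > 0"
  shows "(\<lambda>t. complex_of_real (csch_reg e (s - t))) \<in> L2 UNIV"
proof -
  define C where "C = 2 / e\<^sup>2 + 2 * sinh 1 + 2 * e\<^sup>2 + 4"
  have bound: "\<bar>csch_reg e u\<bar> \<le> C * poisson 1 u" if u: "u \<noteq> 0" for u
  proof -
    have e2: "e\<^sup>2 > 0" using e by simp
    have P: "poisson 1 u \<ge> 0" by (rule poisson_nonneg) simp
    have pi: "\<bar>x / pi\<bar> \<le> \<bar>x\<bar>" for x using pi_gt3 by (simp add: abs_divide divide_le_eq mult_le_cancel_left1)
    show ?thesis
    proof (cases "\<bar>u\<bar> \<le> 1")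
      case True
      have "\<bar>u / (e\<^sup>2 + u\<^sup>2)\<bar> \<le> 1 / e\<^sup>2" unfolding abs_divide using True e2 by (intro frac_le) auto
      moreover have "\<bar>1 / sinh u - 1 / u\<bar> \<le> sinh 1"
      proof -
        have S0: "sinh u \<noteq> 0" and uu: "0 < u * u" using u by (simp, metis not_real_square_gt_zero)
        have "\<bar>1 / sinh u - 1 / u\<bar> = \<bar>u - sinh u\<bar> / (\<bar>sinh u\<bar> * \<bar>u\<bar>)"
          using u S0 by (subst diff_frac_eq) (auto simp: abs_mult)
        also have "\<dots> \<le> (sinh 1 * u\<^sup>2) / (\<bar>u\<bar> * \<bar>u\<bar>)"
          using sinh_second_order[OF True] abs_sinh_ge[of u] u uu by (intro frac_le mult_right_mono) (auto simp: abs_minus_commute)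
        also have "\<dots> = sinh 1" using u by (simp add: power2_eq_square)
        finally show ?thesis .
      qed
      ultimately have "\<bar>u / (e\<^sup>2 + u\<^sup>2) + 1 / sinh u - 1 / u\<bar> \<le> 1 / e\<^sup>2 + sinh 1" by linarith
      then have "\<bar>csch_reg e u\<bar> \<le> 1 / e\<^sup>2 + sinh 1" unfolding csch_reg_def using pi order_trans by blast
      also have "\<dots> \<le> (1 / e\<^sup>2 + sinh 1) * (2 * poisson 1 u)"
      proof -
        have "0 \<le> 1 / e\<^sup>2 + sinh (1::real)" by (intro add_nonneg_nonneg) auto
        from mult_left_mono[OF poisson_1_near[OF True] this] show ?thesis by simp
      qed
      also have "\<dots> \<le> C * poisson 1 u"
        using mult_right_mono[OF _ P, of "2 / e\<^sup>2 + 2 * sinh 1" C] e2 by (simp add: C_def algebra_simps)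
      finally show ?thesis .
    next
      case False
      then have u1: "1 \<le> \<bar>u\<bar>" by simp
      have "\<bar>e\<^sup>2 / (e\<^sup>2 + u\<^sup>2) / u\<bar> \<le> e\<^sup>2 * (1 / u\<^sup>2)"
      proof -
        have "\<bar>e\<^sup>2 / (e\<^sup>2 + u\<^sup>2) / u\<bar> = e\<^sup>2 / ((e\<^sup>2 + u\<^sup>2) * \<bar>u\<bar>)" using e2 by (simp add: abs_divide abs_mult)
        also have "\<dots> \<le> e\<^sup>2 / (u\<^sup>2 * 1)" using u1 u e2 by (intro divide_left_mono mult_mono mult_pos_pos add_pos_nonneg) auto
        finally show ?thesis by simp
      qed
      also have "\<dots> \<le> e\<^sup>2 * (2 * poisson 1 u)" using poisson_1_far(1)[OF u1] e2 by (intro mult_left_mono) auto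
      finally have "\<bar>1 / sinh u - e\<^sup>2 / (e\<^sup>2 + u\<^sup>2) / u\<bar> \<le> (2 * e\<^sup>2 + 4) * poisson 1 u"
        using poisson_1_far(2)[OF u1] abs_triangle_ineq4[of "1 / sinh u" "e\<^sup>2 / (e\<^sup>2 + u\<^sup>2) / u"] by (simp add: abs_divide algebra_simps)
      then have "\<bar>csch_reg e u\<bar> \<le> (2 * e\<^sup>2 + 4) * poisson 1 u" unfolding csch_reg_eq[OF u e] using pi order_trans by blast
      also have "\<dots> \<le> C * poisson 1 u" using e2 by (intro mult_right_mono P) (simp add: C_def)
      finally show ?thesis .
    qed
  qed
  show ?thesis
  proof (rule L2_dominated[OF L2_cmult[OF L2_poisson[of 1 s], of "of_real C"]])
    have "C \<ge> 0" by (simp add: C_def)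
    show "AE t in lebesgue. cmod (of_real (csch_reg e (s - t))) \<le> cmod (of_real C * of_real (poisson 1 (t - s)))"
      using AE_lebesgue_neq[of s]
    proof eventually_elim
      case (elim t)
      have "\<bar>csch_reg e (s - t)\<bar> \<le> C * poisson 1 (t - s)" using bound[of "s - t"] elim by (simp add: poisson_commute)
      then show ?case unfolding norm_mult norm_of_real using \<open>C \<ge> 0\<close> poisson_nonneg[of 1 "t - s"] by simp
    qed
  qed auto
qed

section \<open>Comparison of the regularisations\<close>

lemma proper_fraction_bounds:
  fixes x y :: real
  assumes "0 \<le> x" "0 \<le> y" shows "0 \<le> x / (x + y)" "x / (x + y) \<le> 1"
proof -
  show "0 \<le> x / (x + y)" using assms by simp
  show "x / (x + y) \<le> 1"
  proof (cases "x + y = 0")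
    case False
    then have "x + y > 0" using assms by linarith
    then show ?thesis using assms by (subst divide_le_eq_1_pos) auto
  qed simp
qed

context bezout_setting
begin

text \<open>The difference of the two regularised kernels between the intervals \<open>k\<close> and \<open>l\<close>, both in the variable \<open>t\<close>: the
  conjugate Poisson regularisation of the Cauchy kernel in \<open>x\<close>, and the regularisation of the hyperbolic
  cosecant. The heights differ by the local scale \<open>2 / |\<phi>'|\<close> of the change of variables.\<close>

definition D :: "nat \<Rightarrow> nat \<Rightarrow> real \<Rightarrow> real \<Rightarrow> real \<Rightarrow> real" where
  "D k l s e t = 2 / pi * (\<omega> k t * \<omega> l s) * conj_poisson (2 / \<bar>dphi (X l s)\<bar> * e) (X k t - X l s)
     - A k l t s * csch_reg e (s - t)"

lemma X_distinct:
  assumes "k < n" "l < n" "t \<noteq> s" shows "X k t \<noteq> X l s"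
  using phi_X[OF assms(1), of t] phi_X[OF assms(2), of s] assms(3) by auto

text \<open>By the kernel identity both kernels have the same principal part, so only the two damping terms remain.\<close>

lemma D_eq:
  assumes k: "k < n" and l: "l < n" and t: "t \<noteq> s" and e: "e > 0"
  defines "c \<equiv> 2 / \<bar>dphi (X l s)\<bar>" and "Y \<equiv> X k t - X l s" and "u \<equiv> s - t"
  shows "D k l s e t = A k l t s / pi * (e\<^sup>2 / (e\<^sup>2 + u\<^sup>2) / u - (c * e)\<^sup>2 / ((c * e)\<^sup>2 + Y\<^sup>2) / sinh u)"
proof -
  have u: "u \<noteq> 0" "sinh u \<noteq> 0" using t by (auto simp: u_def)
  have Y: "Y \<noteq> 0" using X_distinct[OF k l t] by (simp add: Y_def)
  have c: "c > 0" using dphi_neg[OF l X_in[OF l, of s]] by (simp add: c_def)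
  have pos: "(c * e)\<^sup>2 + Y\<^sup>2 > 0" using Y by (intro add_nonneg_pos) auto
  have "A k l t s * Y = 2 * (\<omega> k t * \<omega> l s) * sinh u"
    using kernel_identity[OF k l, of t s] by (simp add: Y_def u_def)
  then have ww: "2 * (\<omega> k t * \<omega> l s) = A k l t s * Y / sinh u" using u by (simp add: field_simps)
  have Y2: "Y * (Y / ((c * e)\<^sup>2 + Y\<^sup>2)) = 1 - (c * e)\<^sup>2 / ((c * e)\<^sup>2 + Y\<^sup>2)"
  proof -
    have "Y * (Y / ((c * e)\<^sup>2 + Y\<^sup>2)) = ((c * e)\<^sup>2 + Y\<^sup>2 - (c * e)\<^sup>2) / ((c * e)\<^sup>2 + Y\<^sup>2)"
      by (simp add: power2_eq_square)
    then show ?thesis unfolding diff_divide_distrib divide_self[OF pos[THEN less_imp_neq, THEN not_sym]] .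
  qed
  have "D k l s e t = A k l t s / pi * (Y * (Y / ((c * e)\<^sup>2 + Y\<^sup>2)) / sinh u) - A k l t s * csch_reg e u"
  proof -
    have "2 / pi * (\<omega> k t * \<omega> l s) = (A k l t s * Y / sinh u) / pi" unfolding ww[symmetric] by simp
    then show ?thesis unfolding D_def c_def[symmetric] Y_def[symmetric] u_def[symmetric] conj_poisson_def by (simp add: ac_simps)
  qed
  also have "\<dots> = A k l t s / pi * (e\<^sup>2 / (e\<^sup>2 + u\<^sup>2) / u - (c * e)\<^sup>2 / ((c * e)\<^sup>2 + Y\<^sup>2) / sinh u)"
    unfolding Y2 csch_reg_eq[OF u(1) e] by (simp add: diff_divide_distrib right_diff_distrib)
  finally show ?thesis .
qed

lemma D_tendsto_0:
  assumes k: "k < n" and l: "l < n" and t: "t \<noteq> s"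
  shows "((\<lambda>e. D k l s e t) \<longlongrightarrow> 0) (at_right 0)"
proof -
  define c Y u where "c = 2 / \<bar>dphi (X l s)\<bar>" and "Y = X k t - X l s" and "u = s - t"
  have u: "u \<noteq> 0" "sinh u \<noteq> 0" using t by (auto simp: u_def)
  have Y: "Y \<noteq> 0" using X_distinct[OF k l t] by (simp add: Y_def)
  have "((\<lambda>e. A k l t s / pi * (e\<^sup>2 / (e\<^sup>2 + u\<^sup>2) / u - (c * e)\<^sup>2 / ((c * e)\<^sup>2 + Y\<^sup>2) / sinh u)) \<longlongrightarrow>
     A k l t s / pi * (0\<^sup>2 / (0\<^sup>2 + u\<^sup>2) / u - (c * 0)\<^sup>2 / ((c * 0)\<^sup>2 + Y\<^sup>2) / sinh u)) (at_right 0)"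
    using u Y by (intro tendsto_intros) auto
  then have "((\<lambda>e. A k l t s / pi * (e\<^sup>2 / (e\<^sup>2 + u\<^sup>2) / u - (c * e)\<^sup>2 / ((c * e)\<^sup>2 + Y\<^sup>2) / sinh u)) \<longlongrightarrow> 0) (at_right 0)"
    by simp
  then show ?thesis
  proof (rule Lim_transform_eventually)
    show "\<forall>\<^sub>F e in at_right 0. A k l t s / pi * (e\<^sup>2 / (e\<^sup>2 + u\<^sup>2) / u - (c * e)\<^sup>2 / ((c * e)\<^sup>2 + Y\<^sup>2) / sinh u) = D k l s e t"
      using eventually_at_right_0 by eventually_elim (simp only: D_eq[OF k l t] c_def Y_def u_def)
  qed
qed

lemma continuous_abs_weight:
  assumes k: "k < n" shows "continuous_on UNIV (\<lambda>t. \<bar>\<omega> k t\<bar>)"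
proof -
  have nz: "dphi (X k t) \<noteq> 0" for t using dphi_neg[OF k X_in[OF k]] by (metis less_irrefl)
  have "\<bar>\<omega> k t\<bar> = 1 / sqrt \<bar>dphi (X k t)\<bar>" for t
    unfolding weight_def using bod_nonzero[OF k X_in[OF k, of t]] by (simp add: abs_divide abs_sgn_eq)
  moreover have "continuous_on (J k) dphi"
    using dphi_deriv[OF k] by (meson DERIV_isCont continuous_at_imp_continuous_on)
  then have "continuous_on UNIV (\<lambda>t. dphi (X k t))"
    by (rule continuous_on_compose2[OF _ X_continuous[OF k]]) (use X_in[OF k] in auto)
  then have "continuous_on UNIV (\<lambda>t. 1 / sqrt \<bar>dphi (X k t)\<bar>)" using nz by (intro continuous_intros) auto
  ultimately show ?thesis by simp
qed

lemma bracket_far_bound: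
  fixes u e b :: real
  assumes u: "1 \<le> \<bar>u\<bar>" and e: "0 < e" "e \<le> 1" and b: "0 \<le> b" "b \<le> 1"
  shows "\<bar>e\<^sup>2 / (e\<^sup>2 + u\<^sup>2) / u - b / sinh u\<bar> \<le> 6 * poisson 1 u"
proof -
  have e2: "0 < e\<^sup>2" "e\<^sup>2 \<le> 1" using e by (auto simp: power_le_one)
  have "\<bar>e\<^sup>2 / (e\<^sup>2 + u\<^sup>2) / u\<bar> = e\<^sup>2 / ((e\<^sup>2 + u\<^sup>2) * \<bar>u\<bar>)" using e2 by (simp add: abs_divide abs_mult)
  also have "\<dots> \<le> 1 / (u\<^sup>2 * 1)" using u e2 by (intro frac_le mult_mono mult_pos_pos) auto
  also have "\<dots> \<le> 2 * poisson 1 u" using poisson_1_far(1)[OF u] by simp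
  finally have 1: "\<bar>e\<^sup>2 / (e\<^sup>2 + u\<^sup>2) / u\<bar> \<le> 2 * poisson 1 u" .
  have "\<bar>b / sinh u\<bar> \<le> 1 / \<bar>sinh u\<bar>" using b u by (simp add: abs_divide divide_right_mono)
  also have "\<dots> \<le> 4 * poisson 1 u" by (rule poisson_1_far(2)[OF u])
  finally have 2: "\<bar>b / sinh u\<bar> \<le> 4 * poisson 1 u" .
  have "\<bar>e\<^sup>2 / (e\<^sup>2 + u\<^sup>2) / u - b / sinh u\<bar> \<le> \<bar>e\<^sup>2 / (e\<^sup>2 + u\<^sup>2) / u\<bar> + \<bar>b / sinh u\<bar>"
    by (rule abs_triangle_ineq4)
  also have "\<dots> \<le> 2 * poisson 1 u + 4 * poisson 1 u" by (intro add_mono 1 2)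
  finally show ?thesis by simp
qed

text \<open>For \<open>k = l\<close> the singularities cancel to second order; for \<open>k \<noteq> l\<close> there is no singularity, since the
  intervals have positive distance and \<open>A\<close> is of the size of \<open>sinh (s - t)\<close>.\<close>

lemma D_near_bound:
  assumes k: "k < n" and l: "l < n"
  obtains C where "C \<ge> 0" "\<And>e t. 0 < e \<Longrightarrow> t \<noteq> s \<Longrightarrow> \<bar>t - s\<bar> \<le> 1 \<Longrightarrow> \<bar>D k l s e t\<bar> \<le> C"
proof -
  define c where "c = 2 / \<bar>dphi (X l s)\<bar>"
  have c: "c > 0" using dphi_neg[OF l X_in[OF l, of s]] by (simp add: c_def)
  have b01: "0 \<le> (c * e)\<^sup>2 / ((c * e)\<^sup>2 + Y\<^sup>2)" "(c * e)\<^sup>2 / ((c * e)\<^sup>2 + Y\<^sup>2) \<le> 1" for e Y :: real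
    by (intro proper_fraction_bounds; simp)+
  have pi: "\<bar>x / pi * y\<bar> \<le> \<bar>x * y\<bar>" for x y :: real
  proof -
    have "\<bar>x / pi * y\<bar> = \<bar>x * y\<bar> / pi" by (simp add: abs_mult)
    then show ?thesis using pi_gt3 by (simp add: divide_le_eq mult_le_cancel_left1)
  qed
  show ?thesis
  proof (cases "k = l")
    case True
    obtain B0 where B0: "\<And>t. \<bar>t - s\<bar> \<le> 1 \<Longrightarrow> \<bar>X l t - X l s - 2 / dphi (X l s) * (t - s)\<bar> \<le> B0 * (t - s)\<^sup>2"
      using X_second_order[OF l] by blast
    define B where "B = max B0 0"
    show ?thesis
    proof (rule that)
      show "0 \<le> B / c * (B / c + 2) + sinh 1" using c by (simp add: B_def)
      fix e t assume e: "0 < (e::real)" and t: "t \<noteq> s" "\<bar>t - s\<bar> \<le> 1"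
      define Y u where "Y = X k t - X l s" and "u = s - t"
      have u: "u \<noteq> 0" "\<bar>u\<bar> \<le> 1" using t by (auto simp: u_def)
      have "2 / dphi (X l s) = - c" using dphi_neg[OF l X_in[OF l, of s]] by (simp add: c_def)
      then have "\<bar>Y - c * u\<bar> \<le> B0 * u\<^sup>2"
        using B0[OF t(2)] by (simp add: Y_def u_def True power2_commute algebra_simps)
      also have "\<dots> \<le> B * u\<^sup>2" by (intro mult_right_mono) (auto simp: B_def)
      finally have Y: "\<bar>Y - c * u\<bar> \<le> B * u\<^sup>2" .
      let ?br = "e\<^sup>2 / (e\<^sup>2 + u\<^sup>2) / u - (c * e)\<^sup>2 / ((c * e)\<^sup>2 + Y\<^sup>2) / sinh u"
      have "\<bar>D k l s e t\<bar> = \<bar>A k l t s / pi * ?br\<bar>" unfolding D_eq[OF k l t(1) e] c_def Y_def u_def ..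
      also have "\<dots> \<le> \<bar>A k l t s\<bar> * \<bar>?br\<bar>" using pi[of "A k l t s" ?br] by (simp only: abs_mult)
      also have "\<dots> \<le> 1 * (B / c * (B / c + 2) + sinh 1)"
        using near_diagonal_bound[OF u c _ Y e sinh_second_order[OF u(2)] abs_sinh_ge] A_bound[OF k l, of t s]
        by (intro mult_mono) (auto simp: B_def)
      finally show "\<bar>D k l s e t\<bar> \<le> B / c * (B / c + 2) + sinh 1" by simp
    qed
  next
    case False
    obtain d where d: "d > 0" "\<And>t. d \<le> \<bar>X k t - X l s\<bar>"
    proof (cases "k < l")
      case True
      show ?thesis
      proof (rule that[of "X l s - \<beta> k"])
        show "0 < X l s - \<beta> k" using X_in[OF l, of s] intervals_ordered[OF True l] by simp
        show "X l s - \<beta> k \<le> \<bar>X k t - X l s\<bar>" for t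
          using X_in[OF k, of t] abs_ge_minus_self[of "X k t - X l s"] by simp
      qed
    next
      case F: False
      then have lk: "l < k" using False by simp
      show ?thesis
      proof (rule that[of "\<alpha> k - X l s"])
        show "0 < \<alpha> k - X l s" using X_in[OF l, of s] intervals_ordered[OF lk k] by simp
        show "\<alpha> k - X l s \<le> \<bar>X k t - X l s\<bar>" for t
          using X_in[OF k, of t] abs_ge_self[of "X k t - X l s"] by simp
      qed
    qed
    have "bounded ((\<lambda>t. \<bar>\<omega> k t\<bar>) ` cball s 1)"
      by (intro compact_imp_bounded compact_continuous_image continuous_on_subset[OF continuous_abs_weight[OF k]]) auto
    then obtain K where K: "\<And>t. t \<in> cball s 1 \<Longrightarrow> \<bar>\<omega> k t\<bar> \<le> K" unfolding bounded_iff by (auto simp del: mem_cball)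
    have K0: "K \<ge> 0" using order_trans[OF abs_ge_zero K[of s]] by simp
    define R where "R = 2 * (K * \<bar>\<omega> l s\<bar>) / d"
    have R0: "R \<ge> 0" using K0 d by (simp add: R_def)
    show ?thesis
    proof (rule that)
      show "0 \<le> R * (sinh 1 + 2)" using R0 by simp
      fix e t assume e: "0 < (e::real)" and t: "t \<noteq> s" "\<bar>t - s\<bar> \<le> 1"
      define Y u where "Y = X k t - X l s" and "u = s - t"
      have u: "u \<noteq> 0" "\<bar>u\<bar> \<le> 1" "sinh u \<noteq> 0" using t by (auto simp: u_def)
      have Yd: "d \<le> \<bar>Y\<bar>" using d(2) by (simp add: Y_def)
      have "A k l t s * Y = 2 * (\<omega> k t * \<omega> l s) * sinh u"
        using kernel_identity[OF k l, of t s] by (simp add: Y_def u_def)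
      then have "\<bar>A k l t s\<bar> * \<bar>Y\<bar> = 2 * (\<bar>\<omega> k t\<bar> * \<bar>\<omega> l s\<bar>) * \<bar>sinh u\<bar>" unfolding abs_mult[symmetric] by (simp add: abs_mult)
      also have "\<dots> \<le> 2 * (K * \<bar>\<omega> l s\<bar>) * \<bar>sinh u\<bar>"
        using K[of t] t by (intro mult_right_mono mult_left_mono) (auto simp: dist_real_def)
      finally have "\<bar>A k l t s\<bar> * \<bar>Y\<bar> \<le> R * \<bar>sinh u\<bar> * d" using d by (simp add: R_def)
      moreover have "\<bar>A k l t s\<bar> * d \<le> \<bar>A k l t s\<bar> * \<bar>Y\<bar>" using Yd by (intro mult_left_mono) auto
      ultimately have "\<bar>A k l t s\<bar> * d \<le> R * \<bar>sinh u\<bar> * d" by linarith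
      then have AS: "\<bar>A k l t s\<bar> \<le> R * \<bar>sinh u\<bar>" using d by simp
      have su: "\<bar>sinh u\<bar> \<le> (sinh 1 + 1) * \<bar>u\<bar>"
      proof -
        have "u\<^sup>2 \<le> \<bar>u\<bar>" using u mult_left_le[of "\<bar>u\<bar>" "\<bar>u\<bar>"] by (simp add: power2_eq_square)
        then have "sinh 1 * u\<^sup>2 \<le> sinh 1 * \<bar>u\<bar>" by (intro mult_left_mono) auto
        moreover have "\<bar>sinh u\<bar> \<le> \<bar>sinh u - u\<bar> + \<bar>u\<bar>" using abs_triangle_ineq[of "sinh u - u" u] by simp
        ultimately have "\<bar>sinh u\<bar> \<le> sinh 1 * \<bar>u\<bar> + \<bar>u\<bar>" using sinh_second_order[OF u(2)] by linarith
        then show ?thesis by (simp add: distrib_right)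
      qed
      let ?a = "e\<^sup>2 / (e\<^sup>2 + u\<^sup>2)" and ?b = "(c * e)\<^sup>2 / ((c * e)\<^sup>2 + Y\<^sup>2)"
      have a1: "0 \<le> ?a" "?a \<le> 1" by (intro proper_fraction_bounds; simp)+
      have "\<bar>D k l s e t\<bar> = \<bar>A k l t s / pi * (?a / u - ?b / sinh u)\<bar>" unfolding D_eq[OF k l t(1) e] c_def Y_def u_def ..
      also have "\<dots> \<le> \<bar>A k l t s\<bar> * \<bar>?a / u - ?b / sinh u\<bar>" using pi[of "A k l t s" "?a / u - ?b / sinh u"] by (simp only: abs_mult)
      also have "\<dots> \<le> (R * \<bar>sinh u\<bar>) * (1 / \<bar>u\<bar> + 1 / \<bar>sinh u\<bar>)"
      proof (intro mult_mono AS)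
        have "\<bar>?a / u\<bar> \<le> 1 / \<bar>u\<bar>" unfolding abs_divide[of ?a u] using a1 by (intro divide_right_mono) auto
        moreover have "\<bar>?b / sinh u\<bar> \<le> 1 / \<bar>sinh u\<bar>" unfolding abs_divide[of ?b "sinh u"] using b01[of e Y] by (intro divide_right_mono) auto
        ultimately show "\<bar>?a / u - ?b / sinh u\<bar> \<le> 1 / \<bar>u\<bar> + 1 / \<bar>sinh u\<bar>"
          by (intro order_trans[OF abs_triangle_ineq4] add_mono)
      qed (use R0 in auto)
      also have "\<dots> = R * (\<bar>sinh u\<bar> / \<bar>u\<bar> + 1)" using u by (simp add: distrib_left)
      also have "\<dots> \<le> R * ((sinh 1 + 1) + 1)"
        using su u R0 by (intro mult_left_mono add_right_mono) (auto simp: divide_le_eq)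
      finally show "\<bar>D k l s e t\<bar> \<le> R * (sinh 1 + 2)" by (simp add: add_ac)
    qed
  qed
qed

text \<open>Away from the diagonal \<open>|A| \<le> 1\<close> suffices, because both damping terms are then of the size of
  \<open>1 / (s - t)\<^sup>2\<close>.\<close>

lemma D_bound:
  assumes k: "k < n" and l: "l < n"
  obtains C where "C \<ge> 0" "\<And>e t. 0 < e \<Longrightarrow> e \<le> 1 \<Longrightarrow> t \<noteq> s \<Longrightarrow> \<bar>D k l s e t\<bar> \<le> C * poisson 1 (t - s)"
proof -
  obtain C where C: "C \<ge> 0" "\<And>e t. 0 < e \<Longrightarrow> t \<noteq> s \<Longrightarrow> \<bar>t - s\<bar> \<le> 1 \<Longrightarrow> \<bar>D k l s e t\<bar> \<le> C"
    using D_near_bound[OF k l] by blast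
  show ?thesis
  proof (rule that)
    show "0 \<le> 2 * C + 6" using C by simp
    fix e t assume e: "0 < (e::real)" "e \<le> 1" and t: "t \<noteq> s"
    have P: "0 \<le> poisson 1 (t - s)" by (rule poisson_nonneg) simp
    show "\<bar>D k l s e t\<bar> \<le> (2 * C + 6) * poisson 1 (t - s)"
    proof (cases "\<bar>t - s\<bar> \<le> 1")
      case True
      have "\<bar>D k l s e t\<bar> \<le> C * 1" using C(2)[OF e(1) t True] by simp
      also have "\<dots> \<le> C * (2 * poisson 1 (t - s))" using poisson_1_near[OF True] C by (intro mult_left_mono) auto
      also have "\<dots> \<le> (2 * C + 6) * poisson 1 (t - s)" using P by (simp add: algebra_simps)
      finally show ?thesis .
    next
      case False
      define c Y u where "c = 2 / \<bar>dphi (X l s)\<bar>" and "Y = X k t - X l s" and "u = s - t"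
      have u: "1 \<le> \<bar>u\<bar>" using False by (simp add: u_def abs_minus_commute)
      let ?br = "e\<^sup>2 / (e\<^sup>2 + u\<^sup>2) / u - (c * e)\<^sup>2 / ((c * e)\<^sup>2 + Y\<^sup>2) / sinh u"
      have "\<bar>D k l s e t\<bar> = \<bar>A k l t s\<bar> * \<bar>?br\<bar> / pi" unfolding D_eq[OF k l t e(1)] c_def Y_def u_def by (simp add: abs_mult)
      also have "\<dots> \<le> \<bar>A k l t s\<bar> * \<bar>?br\<bar> / 1" using pi_gt3 by (intro divide_left_mono) auto
      also have "\<dots> \<le> 1 * (6 * poisson 1 u)"
        unfolding div_by_1 by (intro mult_mono A_bound[OF k l] bracket_far_bound[OF u e] proper_fraction_bounds) auto
      also have "\<dots> = 6 * poisson 1 (t - s)" by (simp add: u_def poisson_commute)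
      also have "\<dots> \<le> (2 * C + 6) * poisson 1 (t - s)" using P C by (intro mult_right_mono) auto
      finally show ?thesis .
    qed
  qed
qed

lemma borel_measurable_D:
  assumes k: "k < n" and l: "l < n" shows "D k l s e \<in> borel_measurable lebesgue"
proof -
  note [measurable] = lebesgue_measurable_X[OF k] borel_measurable_M[OF k]
  show ?thesis unfolding D_def[abs_def] A_def by measurable
qed

text \<open>The two regularisations are asymptotically equal, by dominated convergence: the kernels \<open>D\<close> are
  dominated by a fixed multiple of a Poisson kernel.\<close>

lemma D_integral_tendsto_0:
  assumes h: "h \<in> L2 UNIV" and k: "k < n" and l: "l < n"
  shows "((\<lambda>e. LINT t|lebesgue. h t * of_real (D k l s e t)) \<longlongrightarrow> 0) (at_right 0)"
proof -
  note [measurable] = borel_measurable_D[OF k l] L2_measurable[OF h]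
  obtain C where C: "C \<ge> 0" "\<And>e t. 0 < e \<Longrightarrow> e \<le> 1 \<Longrightarrow> t \<noteq> s \<Longrightarrow> \<bar>D k l s e t\<bar> \<le> C * poisson 1 (t - s)"
    using D_bound[OF k l] by blast
  have "((\<lambda>e. LINT t|lebesgue. h t * of_real (D k l s e t)) \<longlongrightarrow> (LINT t|(lebesgue :: real measure). (0::complex))) (at_right 0)"
  proof (rule integral_dominated_at_right[where b=1 and w="\<lambda>t. cmod (h t * of_real (C * poisson 1 (t - s)))"])
    show "integrable lebesgue (\<lambda>t. cmod (h t * of_real (C * poisson 1 (t - s))))"
      using L2_cmult[OF L2_poisson[of 1 s], of "of_real C"] by (intro integrable_norm L2_integrable_mult h) simp_all
    show "AE t in lebesgue. ((\<lambda>e. h t * of_real (D k l s e t)) \<longlongrightarrow> 0) (at_right 0)"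
      using AE_lebesgue_neq[of s]
    proof eventually_elim
      case (elim t)
      have "((\<lambda>e. h t * of_real (D k l s e t)) \<longlongrightarrow> h t * of_real 0) (at_right 0)"
        by (intro tendsto_mult tendsto_const tendsto_of_real D_tendsto_0 k l elim)
      then show ?case by simp
    qed
    show "AE t in lebesgue. cmod (h t * of_real (D k l s e t)) \<le> cmod (h t * of_real (C * poisson 1 (t - s)))" if "e > 0" "e < 1" for e
      using AE_lebesgue_neq[of s]
    proof eventually_elim
      case (elim t)
      have "\<bar>D k l s e t\<bar> \<le> \<bar>C * poisson 1 (t - s)\<bar>" using C(2)[of e t] that elim by simp
      then show ?case unfolding norm_mult norm_of_real by (intro mult_left_mono) auto
    qed
  qed auto
  then show ?thesis by simp
qed

lemma ext_integral_split:
  assumes f: "f \<in> L2 I" and w: "(\<lambda>x. of_real (w x)) \<in> L2 UNIV"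
  shows "(LINT x|lebesgue. ext f x * of_real (w x)) = (\<Sum>k<n. LINT x:J k|lebesgue. f x * of_real (w x))"
    and "\<And>k. k < n \<Longrightarrow> set_integrable lebesgue (J k) (\<lambda>x. f x * of_real (w x))"
proof -
  have fe: "ext f \<in> L2 UNIV" using f L2_I_iff by simp
  have eq: "indicator (J k) x *\<^sub>R (ext f x * of_real (w x)) = indicator (J k) x *\<^sub>R (f x * of_real (w x))" if "k < n" for k x
    using J_subset_I[OF that] by (auto simp: ext_def indicator_def)
  have int: "integrable lebesgue (\<lambda>x. indicator (J k) x *\<^sub>R (ext f x * of_real (w x)))" for k
    by (intro integrable_mult_indicator L2_integrable_mult fe w) auto
  then show si: "set_integrable lebesgue (J k) (\<lambda>x. f x * of_real (w x))" if "k < n" for k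
    unfolding set_integrable_def using int[of k] by (simp only: eq[OF that])
  have "AE x in lebesgue. \<forall>k\<in>{..<n}. x \<noteq> \<alpha> k \<and> x \<noteq> \<beta> k"
    by (intro AE_finite_allI AE_conjI AE_lebesgue_neq) auto
  then have "AE x in lebesgue. ext f x * of_real (w x) = (\<Sum>k<n. indicator (J k) x *\<^sub>R (f x * of_real (w x)))"
  proof eventually_elim
    case (elim x)
    show ?case
    proof (cases "x \<in> I")
      case True
      then obtain k where k: "k < n" "x \<in> J k" using elim by (force simp: multi_interval_def)
      have "(\<Sum>l\<in>{..<n} - {k}. indicator (J l) x *\<^sub>R (f x * of_real (w x))) = 0"
      proof (intro sum.neutral ballI)
        fix l assume "l \<in> {..<n} - {k}"
        then have "x \<notin> J l" using J_disjoint[OF k(1) _ k(2), of l] by blast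
        then show "indicator (J l) x *\<^sub>R (f x * of_real (w x)) = 0" by simp
      qed
      then have "(\<Sum>k<n. indicator (J k) x *\<^sub>R (f x * of_real (w x))) = f x * of_real (w x)"
        using k by (subst sum.remove[of _ k]) auto
      then show ?thesis using True by (simp add: ext_def)
    next
      case False
      then have "x \<notin> J k" if "k < n" for k using J_subset_I[OF that] by blast
      then have "(\<Sum>k<n. indicator (J k) x *\<^sub>R (f x * of_real (w x))) = 0" by (intro sum.neutral ballI) simp
      then show ?thesis using False by (simp add: ext_def)
    qed
  qed
  then have "(LINT x|lebesgue. ext f x * of_real (w x)) = (LINT x|lebesgue. (\<Sum>k<n. indicator (J k) x *\<^sub>R (f x * of_real (w x))))"
    using L2_integrable_mult[OF fe w] si unfolding set_integrable_def
    by (intro integral_cong_AE borel_measurable_sum borel_measurable_integrable) auto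
  also have "\<dots> = (\<Sum>k<n. LINT x:J k|lebesgue. f x * of_real (w x))"
    unfolding set_lebesgue_integral_def using si unfolding set_integrable_def by (intro Bochner_Integration.integral_sum) auto
  finally show "(LINT x|lebesgue. ext f x * of_real (w x)) = (\<Sum>k<n. LINT x:J k|lebesgue. f x * of_real (w x))" .
qed

text \<open>Both terms on the left are transported to the variable \<open>t\<close>; the sum over \<open>j\<close> collapses to \<open>A\<close>.\<close>

lemma regularisations_agree:
  fixes s :: real
  assumes f: "f \<in> L2 I" and l: "l < n" and e: "e > 0"
  defines "c \<equiv> 2 / \<bar>dphi (X l s)\<bar>"
  shows "of_real (sqrt 2 * \<omega> l s / pi) * (LINT x|lebesgue. ext f x * of_real (conj_poisson (c * e) (x - X l s)))
     - (\<Sum>j<n. of_real (M j l s) * (LINT t|lebesgue. MT f j t * of_real (csch_reg e (s - t))))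
     = (\<Sum>k<n. LINT t|lebesgue. T f k t * of_real (D k l s e t))"
proof -
  have c: "c > 0" using dphi_neg[OF l X_in[OF l, of s]] by (simp add: c_def)
  let ?w = "\<lambda>x. conj_poisson (c * e) (x - X l s)"
  have wL: "(\<lambda>x. of_real (?w x)) \<in> L2 UNIV" using c e by (intro L2_conj_poisson) simp
  note split = ext_integral_split[OF f wL]
  let ?g = "\<lambda>k t. T f k t * of_real (2 / pi * (\<omega> k t * \<omega> l s) * ?w (X k t))"
  have gk: "of_real (sqrt 2 * \<omega> l s / pi) * (\<bar>2 / dphi (X k t)\<bar> *\<^sub>R (f (X k t) * of_real (?w (X k t)))) = ?g k t" if k: "k < n" for k t
  proof -
    have arith: "a * (b * (x * y)) = p * x * (q * y)" if "a * b = p * q" for a b p q x y :: complex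
    proof -
      have "a * (b * (x * y)) = (a * b) * (x * y)" by (simp only: mult.assoc)
      also have "\<dots> = p * x * (q * y)" unfolding that by (simp only: mult_ac)
      finally show ?thesis .
    qed
    show ?thesis unfolding jacobian_eq[OF k] T_eq[OF k] scaleR_conv_of_real of_real_mult[of _ "?w (X k t)"]
      by (rule arith) simp
  qed
  have U: "of_real (sqrt 2 * \<omega> l s / pi) * (LINT x|lebesgue. ext f x * of_real (?w x)) = (\<Sum>k<n. LINT t|lebesgue. ?g k t)"
  proof -
    have "of_real (sqrt 2 * \<omega> l s / pi) * (LINT x:J k|lebesgue. f x * of_real (?w x)) = (LINT t|lebesgue. ?g k t)" if k: "k < n" for k
      unfolding change_of_variables(2)[OF k split(2)[OF k]] integral_mult_right_zero[symmetric] gk[OF k] ..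
    then show ?thesis unfolding split(1) sum_distrib_left by (intro sum.cong refl) auto
  qed
  have gi: "integrable lebesgue (?g k)" if k: "k < n" for k
  proof -
    have "integrable lebesgue (\<lambda>t. of_real (sqrt 2 * \<omega> l s / pi) * (\<bar>2 / dphi (X k t)\<bar> *\<^sub>R (f (X k t) * of_real (?w (X k t)))))"
      by (rule integrable_mult_right[OF change_of_variables(1)[OF k, THEN iffD1, OF split(2)[OF k]]])
    then show ?thesis unfolding gk[OF k] .
  qed
  have TC: "integrable lebesgue (\<lambda>t. of_real (A k l t s) * (T f k t * of_real (csch_reg e (s - t))))" if k: "k < n" for k
  proof -
    note [measurable] = borel_measurable_M[OF k]
    have "(\<lambda>t. complex_of_real (A k l t s)) \<in> borel_measurable lebesgue"
      unfolding A_def by measurable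
    then have "(\<lambda>t. of_real (A k l t s) * T f k t) \<in> L2 UNIV"
      using A_bound[OF k l] by (intro L2_mult_bounded[where C=1] T_L2 f k) auto
    from L2_integrable_mult[OF this L2_csch_reg[OF e, of s]] show ?thesis by (simp add: mult.assoc)
  qed
  have V: "(\<Sum>j<n. of_real (M j l s) * (LINT t|lebesgue. MT f j t * of_real (csch_reg e (s - t)))) =
     (\<Sum>k<n. LINT t|lebesgue. of_real (A k l t s) * (T f k t * of_real (csch_reg e (s - t))))"
  proof -
    have int: "integrable lebesgue (\<lambda>t. MT f j t * of_real (csch_reg e (s - t)))" if "j < n" for j
      by (intro L2_integrable_mult MT_L2 f that L2_csch_reg e)
    have "(\<Sum>j<n. of_real (M j l s) * (LINT t|lebesgue. MT f j t * of_real (csch_reg e (s - t)))) =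
       (LINT t|lebesgue. (\<Sum>j<n. of_real (M j l s) * (MT f j t * of_real (csch_reg e (s - t)))))"
      unfolding integral_mult_right_zero[symmetric] using int
      by (intro Bochner_Integration.integral_sum[symmetric]) auto
    also have "\<dots> = (LINT t|lebesgue. (\<Sum>k<n. of_real (A k l t s) * (T f k t * of_real (csch_reg e (s - t)))))"
    proof (rule Bochner_Integration.integral_cong[OF refl])
      fix t
      show "(\<Sum>j<n. of_real (M j l s) * (MT f j t * of_real (csch_reg e (s - t)))) = (\<Sum>k<n. of_real (A k l t s) * (T f k t * of_real (csch_reg e (s - t))))"
        unfolding M_op_def A_def of_real_sum sum_distrib_left sum_distrib_right
        by (subst sum.swap) (simp add: mult_ac)
    qed
    also have "\<dots> = (\<Sum>k<n. LINT t|lebesgue. of_real (A k l t s) * (T f k t * of_real (csch_reg e (s - t))))"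
      using TC by (intro Bochner_Integration.integral_sum) auto
    finally show ?thesis .
  qed
  have "(LINT t|lebesgue. T f k t * of_real (D k l s e t)) = (LINT t|lebesgue. ?g k t) - (LINT t|lebesgue. of_real (A k l t s) * (T f k t * of_real (csch_reg e (s - t))))" if k: "k < n" for k
  proof -
    have "T f k t * of_real (D k l s e t) = ?g k t - of_real (A k l t s) * (T f k t * of_real (csch_reg e (s - t)))" for t
      unfolding D_def c_def[symmetric] of_real_diff right_diff_distrib by (simp only: of_real_mult mult_ac)
    then show ?thesis by (simp only: Bochner_Integration.integral_diff[OF gi[OF k] TC[OF k]])
  qed
  then show ?thesis unfolding U V by (simp add: sum_subtractf)
qed

end

section \<open>Diagonalisation, range and inverse\<close>

lemma tanh_abs_le: "\<bar>tanh x\<bar> \<le> \<bar>x\<bar>" for x :: real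
proof -
  have "norm (tanh x - tanh 0) \<le> 1 * norm (x - 0)"
  proof (rule field_differentiable_bound[of UNIV tanh "\<lambda>x. 1 - (tanh x)\<^sup>2"])
    show "(tanh has_real_derivative 1 - (tanh y)\<^sup>2) (at y within UNIV)" for y :: real
      by (auto intro!: derivative_eq_intros)
    show "norm (1 - (tanh y)\<^sup>2) \<le> 1" for y :: real
    proof -
      have "(tanh y)\<^sup>2 \<le> 1" using tanh_real_bounds[of y] by (simp add: abs_square_le_1 abs_le_iff)
      then show ?thesis by simp
    qed
  qed auto
  then show ?thesis by simp
qed

text \<open>The quotient is at most \<open>cosh (s \<pi> / 2)\<close>, because \<open>|sinh y| \<ge> |y|\<close>.\<close>

lemma s_div_tanh_bound:
  fixes s d :: real
  assumes "\<bar>s\<bar> \<le> d" shows "\<bar>s / tanh (s * pi / 2)\<bar> \<le> exp (d * pi / 2)"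
proof (cases "s = 0")
  case False
  define y where "y = s * pi / 2"
  have y: "y \<noteq> 0" using False by (simp add: y_def)
  have sy: "\<bar>s\<bar> \<le> \<bar>y\<bar>" using pi_gt3 False by (simp add: y_def abs_mult)
  have "cosh y \<le> exp \<bar>y\<bar>" unfolding cosh_field_def by (cases "y \<ge> 0") auto
  also have "\<dots> \<le> exp (d * pi / 2)" using assms by (simp add: y_def abs_mult)
  finally have c: "cosh y \<le> exp (d * pi / 2)" .
  have "\<bar>s / tanh y\<bar> = (\<bar>s\<bar> / \<bar>sinh y\<bar>) * cosh y" by (simp add: tanh_def abs_mult)
  also have "\<dots> \<le> 1 * exp (d * pi / 2)"
    using sy abs_sinh_ge[of y] y c by (intro mult_mono) (auto simp: divide_le_eq_1)
  finally show ?thesis by (simp add: y_def)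
qed simp

text \<open>Near the origin \<open>tanh (s \<pi> / 2)\<close> is comparable to \<open>s\<close>, and elsewhere it is bounded away from \<open>0\<close>, so
  only the behaviour of \<open>F\<close> near the origin decides.\<close>

lemma L2_divide_tanh_iff:
  assumes F: "F \<in> L2 UNIV"
  shows "(\<lambda>s. 1 / (\<i> * of_real (tanh (s * pi / 2))) * F s) \<in> L2 UNIV \<longleftrightarrow>
    (\<exists>U. open U \<and> 0 \<in> U \<and> (\<lambda>s. of_real (1 / s) * F s) \<in> L2_loc U)"
proof
  let ?u = "\<lambda>s. 1 / (\<i> * of_real (tanh (s * pi / 2))) * F s"
  assume u: "?u \<in> L2 UNIV"
  have "(\<lambda>s. (\<i> * of_real (tanh (s * pi / 2) / s)) * ?u s) \<in> L2 UNIV"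
  proof (rule L2_mult_bounded[OF u, where C="pi / 2"])
    show "AE s in lebesgue. cmod (\<i> * of_real (tanh (s * pi / 2) / s)) \<le> pi / 2"
    proof (rule AE_I2)
      fix s :: real
      show "cmod (\<i> * of_real (tanh (s * pi / 2) / s)) \<le> pi / 2"
        unfolding norm_mult norm_of_real using tanh_abs_le[of "s * pi / 2"]
        by (cases "s = 0") (simp_all add: abs_mult divide_le_eq mult.commute)
    qed
  qed auto
  moreover have "(\<i> * of_real (tanh (s * pi / 2) / s)) * ?u s = of_real (1 / s) * F s" for s
    by (cases "s = 0") auto
  ultimately have v: "(\<lambda>s. of_real (1 / s) * F s) \<in> L2 UNIV" by simp
  have "(\<lambda>s. of_real (1 / s) * F s) \<in> L2_loc UNIV"
    unfolding L2_loc_def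
  proof (intro CollectI allI impI)
    fix K :: "real set" assume "compact K \<and> K \<subseteq> UNIV"
    then have K: "K \<in> sets lebesgue" by (intro fmeasurableD lmeasurable_compact) blast
    show "(\<lambda>s. of_real (1 / s) * F s) \<in> L2 K"
      unfolding L2_on_iff[OF K]
    proof (rule L2_dominated[OF v])
      show "(\<lambda>x. if x \<in> K then of_real (1 / x) * F x else 0) \<in> borel_measurable lebesgue"
        by (rule measurable_If_set) (use K L2_measurable[OF v] in simp_all)
    qed auto
  qed
  then show "\<exists>U. open U \<and> 0 \<in> U \<and> (\<lambda>s. of_real (1 / s) * F s) \<in> L2_loc U" by (intro exI[of _ UNIV]) auto
next
  let ?u = "\<lambda>s. 1 / (\<i> * of_real (tanh (s * pi / 2))) * F s"
  assume "\<exists>U. open U \<and> 0 \<in> U \<and> (\<lambda>s. of_real (1 / s) * F s) \<in> L2_loc U"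
  then obtain U where U: "open U" "0 \<in> U" "(\<lambda>s. of_real (1 / s) * F s) \<in> L2_loc U" by blast
  obtain d where d: "d > 0" "cball 0 d \<subseteq> U" using U open_contains_cball by blast
  define K where "K = cball (0::real) d"
  have K: "K \<in> sets lebesgue" "compact K" by (auto simp: K_def)
  have KL: "(\<lambda>s. of_real (1 / s) * F s) \<in> L2 K" using U(3) d K(2) unfolding L2_loc_def K_def by blast
  define p where "p s = (if s \<in> K then \<i> * of_real (- (s / tanh (s * pi / 2))) else 0)" for s
  define q where "q s = (if s \<in> K then 0 else 1 / (\<i> * of_real (tanh (s * pi / 2))))" for s
  have K': "K \<in> sets borel" by (auto simp: K_def)
  have [measurable]: "p \<in> borel_measurable lebesgue" "q \<in> borel_measurable lebesgue"
    unfolding p_def[abs_def] q_def[abs_def] using K(1) by (intro measurable_If_set; simp)+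
  have "(\<lambda>s. p s * (if s \<in> K then of_real (1 / s) * F s else 0)) \<in> L2 UNIV"
  proof (rule L2_mult_bounded[where C="exp (d * pi / 2)"])
    show "(\<lambda>s. if s \<in> K then of_real (1 / s) * F s else 0) \<in> L2 UNIV" by (rule L2_on_iff[OF K(1), THEN iffD1, OF KL])
    show "AE s in lebesgue. cmod (p s) \<le> exp (d * pi / 2)"
    proof (rule AE_I2)
      fix s show "cmod (p s) \<le> exp (d * pi / 2)"
        unfolding p_def using s_div_tanh_bound[of s d] by (simp add: K_def norm_mult norm_divide)
    qed
  qed measurable
  moreover have "(\<lambda>s. q s * F s) \<in> L2 UNIV"
  proof (rule L2_mult_bounded[OF F, where C="1 / tanh (d * pi / 2)"])
    have td: "tanh (d * pi / 2) > 0" using d by simp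
    have "cmod (q s) \<le> 1 / tanh (d * pi / 2)" for s
    proof (cases "s \<in> K")
      case False
      then have ds: "d < \<bar>s\<bar>" by (simp add: K_def)
      have "tanh (d * pi / 2) \<le> tanh (\<bar>s\<bar> * pi / 2)" using ds by simp
      also have "\<dots> = \<bar>tanh (s * pi / 2)\<bar>"
        by (simp only: tanh_real_abs[symmetric]) (simp add: abs_mult)
      finally have "1 / \<bar>tanh (s * pi / 2)\<bar> \<le> 1 / tanh (d * pi / 2)" using td by (intro frac_le) simp_all
      then show ?thesis using False by (simp add: q_def norm_divide norm_mult)
    qed (use td in \<open>simp add: q_def\<close>)
    then show "AE s in lebesgue. cmod (q s) \<le> 1 / tanh (d * pi / 2)" by simp
  qed measurable
  ultimately have "(\<lambda>s. p s * (if s \<in> K then of_real (1 / s) * F s else 0) + q s * F s) \<in> L2 UNIV" by (rule L2_add)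
  moreover have "p s * (if s \<in> K then of_real (1 / s) * F s else 0) + q s * F s = ?u s" for s
  proof (cases "s = 0 \<or> s \<notin> K")
    case False
    have "\<i> * of_real (- (s / t)) * (of_real (1 / s) * w) = 1 / (\<i> * of_real t) * w" for t :: real and w :: complex
      using False by (cases "t = 0") (simp_all add: field_simps)
    then show ?thesis using False by (simp add: p_def q_def)
  qed (auto simp: p_def q_def)
  ultimately show "?u \<in> L2 UNIV" by simp
qed

context bezout_setting
begin

lemma finite_hilbert_integral_eq:
  assumes "0 < e"
  shows "(LINT x:(I - {z - e<..<z + e})|lebesgue. f x / of_real (x - z)) = (LINT x|lebesgue. ext f x * of_real (trunc_recip e (x - z)))"
  unfolding set_lebesgue_integral_def
proof (rule Bochner_Integration.integral_cong[OF refl])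
  fix x
  have "x \<in> {z - e<..<z + e} \<longleftrightarrow> \<bar>x - z\<bar> < e" by auto
  then show "indicator (I - {z - e<..<z + e}) x *\<^sub>R (f x / of_real (x - z)) = ext f x * of_real (trunc_recip e (x - z))"
    by (auto simp: ext_def trunc_recip_def indicator_def divide_inverse)
qed

text \<open>At a Lebesgue point of \<open>f\<close> the truncated integrals may be replaced by conjugate Poisson integrals. After the
  change of variables and with the matching height these may be replaced by the regularised
  convolutions with the hyperbolic cosecant, whose limit is known almost everywhere.\<close>

theorem finite_hilbert_eq:
  assumes f: "f \<in> L2 I" and g: "g \<in> L2 I"
    and fourier: "\<And>j. j < n \<Longrightarrow> is_L2_fourier (MT g j) (\<lambda>s. \<i> * of_real (tanh (s * pi / 2)) * FMTf f j s)"
  shows "eq_ae I (finite_hilbert I f) g"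
  unfolding eq_ae_I_iff
proof (intro allI impI)
  fix l assume l: "l < n"
  have fe: "ext f \<in> L2 UNIV" using f L2_I_iff by simp
  have "AE s in lebesgue. \<forall>j\<in>{..<n}. ((\<lambda>e. LINT t|lebesgue. MT f j t * of_real (csch_reg e (s - t))) \<longlongrightarrow> MT g j s) (at_right 0)"
    by (intro AE_finite_allI csch_convolution[OF MT_L2[OF f] FMT_is_fourier[OF f] MT_L2[OF g] fourier]) auto
  moreover have "AE x in lebesgue. x \<in> J l \<longrightarrow> lebesgue_point (ext f) x"
    using AE_lebesgue_point[OF fe] by eventually_elim simp
  then have "AE s in lebesgue. lebesgue_point (ext f) (X l s)" unfolding AE_X_iff[OF l] .
  ultimately show "AE s in lebesgue. finite_hilbert I f (X l s) = g (X l s)"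
  proof eventually_elim
    case (elim s)
    define z where "z = X l s"
    define c where "c = 2 / \<bar>dphi z\<bar>"
    define \<theta> where "\<theta> = sqrt 2 * \<omega> l s / pi"
    have c: "c > 0" using dphi_neg[OF l X_in[OF l, of s]] by (simp add: c_def z_def)
    have th: "\<theta> \<noteq> 0" using weight_nonzero[OF l X_in[OF l, of s]] by (simp add: \<theta>_def)
    define U where "U e = (LINT x|lebesgue. ext f x * of_real (conj_poisson e (x - z)))" for e
    define V where "V e = (\<Sum>j<n. of_real (M j l s) * (LINT t|lebesgue. MT f j t * of_real (csch_reg e (s - t))))" for e
    have "(V \<longlongrightarrow> (\<Sum>j<n. of_real (M j l s) * MT g j s)) (at_right 0)"
      unfolding V_def using elim(1) by (intro tendsto_sum tendsto_mult tendsto_const) auto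
    then have V: "(V \<longlongrightarrow> T g l s) (at_right 0)" unfolding M_inverse[OF l] .
    have "((\<lambda>e. \<Sum>k<n. LINT t|lebesgue. T f k t * of_real (D k l s e t)) \<longlongrightarrow> (\<Sum>k<n. 0)) (at_right 0)"
      using l by (intro tendsto_sum D_integral_tendsto_0 T_L2 f) auto
    from tendsto_add[OF this V]
    have "((\<lambda>e. (\<Sum>k<n. LINT t|lebesgue. T f k t * of_real (D k l s e t)) + V e) \<longlongrightarrow> T g l s) (at_right 0)" by simp
    then have "((\<lambda>e. of_real \<theta> * U (c * e)) \<longlongrightarrow> T g l s) (at_right 0)"
    proof (rule Lim_transform_eventually)
      show "\<forall>\<^sub>F e in at_right 0. (\<Sum>k<n. LINT t|lebesgue. T f k t * of_real (D k l s e t)) + V e = of_real \<theta> * U (c * e)"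
        using eventually_at_right_0
      proof eventually_elim
        case (elim e)
        show ?case using regularisations_agree[OF f l elim, of s]
          unfolding U_def V_def \<theta>_def c_def z_def by (simp add: algebra_simps)
      qed
    qed
    then have "((\<lambda>e. (1 / of_real \<theta>) * (of_real \<theta> * U (c * e))) \<longlongrightarrow> (1 / of_real \<theta>) * T g l s) (at_right 0)"
      by (intro tendsto_mult tendsto_const)
    moreover have "(1 / of_real \<theta>) * T g l s = of_real pi * g z"
      unfolding T_eq[OF l] \<theta>_def z_def using weight_nonzero[OF l X_in[OF l, of s]] by simp
    ultimately have Uc: "((\<lambda>e. U (c * e)) \<longlongrightarrow> of_real pi * g z) (at_right 0)" using th by simp
    have "filterlim (\<lambda>e. e / c) (at_right 0) (at_right 0)"
    proof (rule filterlim_at_withinI)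
      show "((\<lambda>e. e / c) \<longlongrightarrow> 0) (at_right 0)" using c by (auto intro!: tendsto_eq_intros)
      show "\<forall>\<^sub>F e in at_right 0. e / c \<in> {0<..} - {0}" using eventually_at_right_0 by eventually_elim (use c in auto)
    qed
    \<comment> \<open>The height \<open>c e\<close> matched the two regularisations; for the limit the factor \<open>c\<close> is immaterial.\<close>
    from filterlim_compose[OF Uc this] have U: "(U \<longlongrightarrow> of_real pi * g z) (at_right 0)" using c by simp
    have "((\<lambda>e. (LINT x|lebesgue. ext f x * of_real (trunc_recip e (x - z) - conj_poisson e (x - z))) + U e) \<longlongrightarrow> 0 + of_real pi * g z) (at_right 0)"
      using elim(2) by (intro tendsto_add U truncation_vs_conj_poisson fe) (simp add: z_def)
    then have "((\<lambda>e. LINT x:(I - {z - e<..<z + e})|lebesgue. f x / of_real (x - z)) \<longlongrightarrow> 0 + of_real pi * g z) (at_right 0)"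
    proof (rule Lim_transform_eventually)
      show "\<forall>\<^sub>F e in at_right 0. (LINT x|lebesgue. ext f x * of_real (trunc_recip e (x - z) - conj_poisson e (x - z))) + U e =
         (LINT x:(I - {z - e<..<z + e})|lebesgue. f x / of_real (x - z))"
        using eventually_at_right_0
      proof eventually_elim
        case (elim e)
        have "(\<lambda>x. complex_of_real (trunc_recip e (x - z) - conj_poisson e (x - z))) \<in> L2 UNIV"
        proof (rule L2_dominated[OF L2_poisson[OF elim, of z]])
          show "AE x in lebesgue. cmod (complex_of_real (trunc_recip e (x - z) - conj_poisson e (x - z))) \<le> cmod (complex_of_real (poisson e (x - z)))"
            unfolding norm_of_real by (intro AE_I2 order_trans[OF truncation_error_bound[OF elim] abs_ge_self])
        qed measurable
        then have i1: "integrable lebesgue (\<lambda>x. ext f x * of_real (trunc_recip e (x - z) - conj_poisson e (x - z)))"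
          by (rule L2_integrable_mult[OF fe])
        have i2: "integrable lebesgue (\<lambda>x. ext f x * of_real (conj_poisson e (x - z)))"
          by (rule L2_integrable_mult[OF fe L2_conj_poisson[OF elim]])
        show ?case unfolding finite_hilbert_integral_eq[OF elim] U_def
          by (subst Bochner_Integration.integral_add[OF i1 i2, symmetric]) (simp add: algebra_simps)
      qed
    qed
    then have "Lim (at_right 0) (\<lambda>e. LINT x:(I - {z - e<..<z + e})|lebesgue. f x / of_real (x - z)) = of_real pi * g z"
      by (intro tendsto_Lim) auto
    then show ?case unfolding finite_hilbert_def z_def[symmetric] by simp
  qed
qed

text \<open>As the symbol is bounded and the composed transform is onto, there is a \<open>g\<close> whose transform is the product;
  the preceding theorem identifies it as the finite Hilbert transform of \<open>f\<close>.\<close>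

lemma finite_hilbert_diagonalised:
  assumes f: "f \<in> L2 I"
  obtains g where "g \<in> L2 I" "eq_ae I (finite_hilbert I f) g"
    "\<And>m. m < n \<Longrightarrow> AE s in lebesgue. FMTf g m s = \<i> * of_real (tanh (s * pi / 2)) * FMTf f m s"
proof -
  have "(\<lambda>s. \<i> * of_real (tanh (s * pi / 2)) * FMTf f m s) \<in> L2 UNIV" if "m < n" for m
    by (rule L2_mult_bounded[OF FMT_L2[OF f that], where C=1])
      (auto simp: norm_mult abs_le_iff less_imp_le tanh_real_lt_1 intro!: order.strict_implies_order[OF minus_less_iff[THEN iffD1]] tanh_real_gt_neg1)
  then show ?thesis
  proof (rule FMT_onto)
    fix g assume "g \<in> L2 I"
      "\<And>m. m < n \<Longrightarrow> AE s in lebesgue. FMTf g m s = \<i> * of_real (tanh (s * pi / 2)) * FMTf f m s"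
      "\<And>m. m < n \<Longrightarrow> is_L2_fourier (MT g m) (\<lambda>s. \<i> * of_real (tanh (s * pi / 2)) * FMTf f m s)"
    then show ?thesis by (intro that[of g] finite_hilbert_eq[OF f])
  qed
qed

lemma eq_ae_trans:
  assumes "eq_ae S f g" "eq_ae S g h" shows "eq_ae S f h"
  using assms unfolding eq_ae_def by eventually_elim simp

lemma eq_ae_sym:
  assumes "eq_ae S f g" shows "eq_ae S g f"
  using assms unfolding eq_ae_def by eventually_elim simp

lemma finite_hilbert_eq_iff:
  assumes f: "f \<in> L2 I" and g: "g \<in> L2 I"
  shows "eq_ae I (finite_hilbert I f) g \<longleftrightarrow>
    (\<forall>m<n. AE s in lebesgue. FMTf f m s = 1 / (\<i> * of_real (tanh (s * pi / 2))) * FMTf g m s)"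
proof -
  obtain g' where g': "g' \<in> L2 I" "eq_ae I (finite_hilbert I f) g'"
    "\<And>m. m < n \<Longrightarrow> AE s in lebesgue. FMTf g' m s = \<i> * of_real (tanh (s * pi / 2)) * FMTf f m s"
    using finite_hilbert_diagonalised[OF f] by blast
  have "eq_ae I (finite_hilbert I f) g \<longleftrightarrow> eq_ae I g' g"
    using g'(2) eq_ae_trans eq_ae_sym by blast
  also have "\<dots> \<longleftrightarrow> (\<forall>m<n. AE s in lebesgue. FMTf g' m s = FMTf g m s)"
    using FMT_eq_iff[OF g'(1) g] by simp
  also have "\<dots> \<longleftrightarrow> (\<forall>m<n. AE s in lebesgue. FMTf f m s = 1 / (\<i> * of_real (tanh (s * pi / 2))) * FMTf g m s)"
  proof (intro all_cong)
    fix m assume m: "m < n"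
    have "AE s in lebesgue. (FMTf g' m s = FMTf g m s) \<longleftrightarrow> (FMTf f m s = 1 / (\<i> * of_real (tanh (s * pi / 2))) * FMTf g m s)"
      using g'(3)[OF m] AE_lebesgue_neq[of 0]
    proof eventually_elim
      case (elim s)
      then show ?case by (simp add: eq_divide_eq mult.commute)
    qed
    then show "(AE s in lebesgue. FMTf g' m s = FMTf g m s) \<longleftrightarrow> (AE s in lebesgue. FMTf f m s = 1 / (\<i> * of_real (tanh (s * pi / 2))) * FMTf g m s)"
      by (rule eventually_subst)
  qed
  finally show ?thesis .
qed

text \<open>The symbol vanishes only at \<open>0\<close>, so \<open>g\<close> is a Hilbert transform exactly if the quotient of its transform by
  the symbol is square integrable, and the preimage is then unique and has this quotient as its transform.\<close>

theorem hilbert_range_and_inverse: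
  assumes g: "g \<in> L2 I"
  shows "(g \<in> hilbert_range I \<longleftrightarrow>
           (\<forall>m<n. \<exists>U. open U \<and> 0 \<in> U \<and> (\<lambda>s. of_real (1 / s) * FMTf g m s) \<in> L2_loc U)) \<and>
         (g \<in> hilbert_range I \<longrightarrow>
           (\<exists>f. is_inverse_value I (finite_hilbert I) (eq_ae I) g f \<and>
                is_inverse_value I (FMT n \<alpha> \<beta> W \<rho>) (eq_ae_n n)
                  (\<lambda>m s. 1 / (\<i> * of_real (tanh (s * pi / 2))) * FMTf g m s) f))"
proof -
  define u where "u m s = 1 / (\<i> * of_real (tanh (s * pi / 2))) * FMTf g m s" for m s
  have u_L2: "u m \<in> L2 UNIV \<longleftrightarrow> (\<exists>U. open U \<and> 0 \<in> U \<and> (\<lambda>s. of_real (1 / s) * FMTf g m s) \<in> L2_loc U)" if "m < n" for m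
    unfolding u_def[abs_def] by (rule L2_divide_tanh_iff[OF FMT_L2[OF g that]])
  have iff: "eq_ae I (finite_hilbert I f) g \<longleftrightarrow> (\<forall>m<n. AE s in lebesgue. FMTf f m s = u m s)" if "f \<in> L2 I" for f
    unfolding u_def by (rule finite_hilbert_eq_iff[OF that g])
  have range_iff: "g \<in> hilbert_range I \<longleftrightarrow> (\<forall>m<n. u m \<in> L2 UNIV)"
  proof
    assume "g \<in> hilbert_range I"
    then obtain f where f: "f \<in> L2 I" "eq_ae I (finite_hilbert I f) g" unfolding hilbert_range_def by blast
    then have "AE s in lebesgue. FMTf f m s = u m s" if "m < n" for m using iff that by blast
    then show "\<forall>m<n. u m \<in> L2 UNIV" using L2_cong_AE FMT_L2[OF f(1)] by blast
  next
    assume "\<forall>m<n. u m \<in> L2 UNIV"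
    then have "\<And>m. m < n \<Longrightarrow> u m \<in> L2 UNIV" by blast
    then show "g \<in> hilbert_range I"
    proof (rule FMT_onto)
      fix f assume "f \<in> L2 I" "\<And>m. m < n \<Longrightarrow> AE s in lebesgue. FMTf f m s = u m s"
      then show "g \<in> hilbert_range I" unfolding hilbert_range_def using g iff by blast
    qed
  qed
  have "\<exists>f. is_inverse_value I (finite_hilbert I) (eq_ae I) g f \<and> is_inverse_value I (FMT n \<alpha> \<beta> W \<rho>) (eq_ae_n n) u f"
    if range: "g \<in> hilbert_range I"
  proof -
    obtain f where f: "f \<in> L2 I" "eq_ae I (finite_hilbert I f) g" using range unfolding hilbert_range_def by blast
    have fu: "AE s in lebesgue. FMTf f m s = u m s" if "m < n" for m using iff f that by blast
    have same: "(\<forall>m<n. AE s in lebesgue. FMTf f' m s = u m s) \<longleftrightarrow> eq_ae I f' f" if f': "f' \<in> L2 I" for f'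
    proof -
      have "(AE s in lebesgue. FMTf f' m s = u m s) \<longleftrightarrow> (AE s in lebesgue. FMTf f' m s = FMTf f m s)" if "m < n" for m
        by (rule eventually_subst) (use fu[OF that] in \<open>auto elim!: eventually_mono\<close>)
      then show ?thesis unfolding FMT_eq_iff[OF f' f(1), symmetric] by blast
    qed
    have "is_inverse_value I (finite_hilbert I) (eq_ae I) g f"
      unfolding is_inverse_value_def using f(1) iff same by blast
    moreover have "is_inverse_value I (FMT n \<alpha> \<beta> W \<rho>) (eq_ae_n n) u f"
      unfolding is_inverse_value_def eq_ae_n_def eq_ae_def[of UNIV] lebesgue_on_UNIV_eq using f(1) same by blast
    ultimately show ?thesis by blast
  qed
  then show ?thesis using range_iff u_L2 unfolding u_def[abs_def] by blast
qed

end

theorem theorem6p2: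
  fixes n :: nat
    and \<alpha> \<beta> \<rho> :: "nat \<Rightarrow> real"
    and B W :: "real mat"
    and g :: "real \<Rightarrow> complex"
    and I :: "real set"
  assumes "1 \<le> n"
    and "\<And>j. j < n \<Longrightarrow> \<alpha> j < \<beta> j"
    and "\<And>j. Suc j < n \<Longrightarrow> \<beta> j < \<alpha> (Suc j)"
    and "I = multi_interval n \<alpha> \<beta>"
    and "is_bezout_mat n (beta_ev n \<beta>) (beta_od n \<alpha>) B"
    and "W \<in> carrier_mat n n"
    and "transpose_mat W * W = 1\<^sub>m n"
    and "B = transpose_mat W * mat_diag n \<rho> * W"
    and "g \<in> L2 I"
  shows "(g \<in> hilbert_range I \<longleftrightarrow>
           (\<forall>m<n. \<exists>U. open U \<and> 0 \<in> U \<and>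
              (\<lambda>s. of_real (1 / s) * FMT n \<alpha> \<beta> W \<rho> g m s) \<in> L2_loc U)) \<and>
         (g \<in> hilbert_range I \<longrightarrow>
           (\<exists>f. is_inverse_value I (finite_hilbert I) (eq_ae I) g f \<and>
                is_inverse_value I (FMT n \<alpha> \<beta> W \<rho>) (eq_ae_n n)
                  (\<lambda>m s. 1 / (\<i> * of_real (tanh (s * pi / 2))) * FMT n \<alpha> \<beta> W \<rho> g m s) f))"
proof -
  interpret bezout_setting n \<alpha> \<beta> \<rho> B W
    by unfold_locales (fact assms)+
  show ?thesis using hilbert_range_and_inverse assms(9) unfolding assms(4) .
qed

end
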